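(* Let $X$ be a smooth complex surface, $D\subset X$ a divisor with normal crossings, and $z\in D$ a smooth point of $D$. Let $\pi:\tilde X_z\to X$ be the blow-up of $X$ at $z$, and $\tilde D=\pi^{-1}(D)$. Let $(w_1,w_2)$ be local coordinates centered at $z$ identifying a neighborhood $W$ of $z$ with $V_R\times V_R$, where $V_R=\{|w|<R\}\subset\mathbb C$, such that $D\cap W=\{w_2=0\}$; let $0<r<R$, and let $Z$ be the space $\mathcal B^+_{\mathbb R}(X,D)$ with the circle action on its boundary modified over the disc $\{|w_1|<r,\ w_2=0\}$ as described in the context. Then there exists a homeomorphism $h:\mathcal B^+_{\mathbb R}(\tilde X_z,\tilde D)\to Z$ which coincides with $\tilde\pi$ outside $\tilde\rho^{-1}(\pi^{-1}(W))$, and which respects the circle actions.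
   Context: A divisor with normal crossings $D$ in a smooth complex surface $X$ is a locally finite union of smooth curves intersecting transversally, with at most two through any point; points on exactly one local branch are ordinary (smooth) points, the others are double points. Real oriented blow-up. $\rho:\mathcal B^+_{\mathbb R}(X,D)\to X$ is the space over $X$ obtained by real (oriented, prime-end) blow-up of $D$; concretely it equals $X-D$ over $X-D$, and locally: if $(w_1,w_2)$ are local coordinates with $D=\{w_2=0\}$, it is the closure in $\{(w_1,w_2,\theta_2)\}$, $\theta_2\in\mathbb R/2\pi\mathbb Z$, of the set where $w_2\ne0$ and $e^{i\theta_2}=w_2/|w_2|$; if $D=\{w_1w_2=0\}$, it is the closure in $\{(w_1,w_2,\theta_1,\theta_2)\}$ of the set where $w_1w_2\neq0$, $e^{i\theta_1}=w_1/|w_1|$, $e^{i\theta_2}=w_2/|w_2|$. It is a 4-manifold with boundary $\mathcal B^+_{\mathbb R}(D)=\rho^{-1}(D)$. The fiber of $\rho$ over an ordinary point of $D$ is a circle, on which $\mathbb R/2\pi\mathbb Z$ acts canonically by $\Theta*(w_1,0,\theta_2)=(w_1,0,\theta_2+\Theta)$; over a double point it is a torus. Thus there is a canonical circle action on the part of $\mathcal B^+_{\mathbb R}(D)$ over ordinary points. Denote by $\tilde\rho:\mathcal B^+_{\mathbb R}(\tilde X_z,\tilde D)\to\tilde X_z$ the corresponding projection. The map $\tilde\pi:\mathcal B^+_{\mathbb R}(\tilde X_z,\tilde D)\to\mathcal B^+_{\mathbb R}(X,D)$ is the unique continuous map with $\rho\circ\tilde\pi=\pi\circ\tilde\rho$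 extending $\pi$. The space $Z$: as a space $Z=\mathcal B^+_{\mathbb R}(X,D)$; over $\Delta_r=\{|w_1|<r,\ w_2=0\}\subset D$, the circle action on $\rho^{-1}(\Delta_r)$ (with coordinates $(w_1,0,\theta_2)$) is replaced by $\Theta*(w_1,0,\theta_2)=(w_1e^{i\Theta},0,\theta_2+\Theta)$; elsewhere the canonical circle action is kept. On the torus $\{|w_1|=r\}$ there are two limiting circle actions, one from each side. "Respects the circle actions" means that the restriction of $h$ to the boundaries carries the canonical circle action over ordinary points of $\tilde D$ to the circle action of $Z$. *)

theory Defs
  imports "HOL-Analysis.Analysis"
begin

section \<open>Complex surfaces\<close>

text \<open>Holomorphic maps between open subsets of \<open>\<complex>\<^sup>2\<close>: the total derivative exists at every
  point and is complex-linear, given by the Jacobian matrix with rows \<open>(a, b)\<close> and \<open>(c, d)\<close>.\<close>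

definition complex_derivative2 ::
  "(complex \<times> complex \<Rightarrow> complex \<times> complex) \<Rightarrow> complex \<Rightarrow> complex \<Rightarrow> complex \<Rightarrow> complex
    \<Rightarrow> complex \<times> complex \<Rightarrow> bool" where
  "complex_derivative2 f a b c d p \<longleftrightarrow>
     (f has_derivative (\<lambda>(h, k). (a * h + b * k, c * h + d * k))) (at p)"

definition holomorphic2_on ::
  "(complex \<times> complex \<Rightarrow> complex \<times> complex) \<Rightarrow> (complex \<times> complex) set \<Rightarrow> bool" where
  "holomorphic2_on f S \<longleftrightarrow> open S \<and> (\<forall>p\<in>S. \<exists>a b c d. complex_derivative2 f a b c d p)"

definition topological_chart ::
  "'a topology \<Rightarrow> 'a set \<Rightarrow> ('a \<Rightarrow> complex \<times> complex) \<Rightarrow> bool" where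
  "topological_chart X U \<phi> \<longleftrightarrow>
     openin X U \<and> open (\<phi> ` U) \<and> homeomorphic_map (subtopology X U) (top_of_set (\<phi> ` U)) \<phi>"

definition transition ::
  "'a set \<Rightarrow> ('a \<Rightarrow> complex \<times> complex) \<Rightarrow> ('a \<Rightarrow> complex \<times> complex)
    \<Rightarrow> complex \<times> complex \<Rightarrow> complex \<times> complex" where
  "transition U \<phi> \<psi> = \<psi> \<circ> inv_into U \<phi>"

definition holomorphically_compatible ::
  "'a set \<Rightarrow> ('a \<Rightarrow> complex \<times> complex) \<Rightarrow> 'a set \<Rightarrow> ('a \<Rightarrow> complex \<times> complex) \<Rightarrow> bool" where
  "holomorphically_compatible U \<phi> V \<psi> \<longleftrightarrow>
     holomorphic2_on (transition U \<phi> \<psi>) (\<phi> ` (U \<inter> V)) \<and>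
     holomorphic2_on (transition V \<psi> \<phi>) (\<psi> ` (U \<inter> V))"

text \<open>Neither second countability nor connectedness is required.\<close>

definition complex_surface ::
  "'a topology \<Rightarrow> ('a set \<times> ('a \<Rightarrow> complex \<times> complex)) set \<Rightarrow> bool" where
  "complex_surface X A \<longleftrightarrow>
     Hausdorff_space X \<and>
     (\<Union>(U, \<phi>)\<in>A. U) = topspace X \<and>
     (\<forall>(U, \<phi>)\<in>A. topological_chart X U \<phi>) \<and>
     (\<forall>(U, \<phi>)\<in>A. \<forall>(V, \<psi>)\<in>A. holomorphically_compatible U \<phi> V \<psi>)"

text \<open>Local holomorphic coordinates are the members of the maximal atlas generated by \<open>A\<close>.\<close>

definition local_coords ::
  "'a topology \<Rightarrow> ('a set \<times> ('a \<Rightarrow> complex \<times> complex)) set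
    \<Rightarrow> 'a set \<Rightarrow> ('a \<Rightarrow> complex \<times> complex) \<Rightarrow> bool" where
  "local_coords X A U \<phi> \<longleftrightarrow>
     topological_chart X U \<phi> \<and> (\<forall>(V, \<psi>)\<in>A. holomorphically_compatible U \<phi> V \<psi>)"

section \<open>Divisors with normal crossings\<close>

definition flat_coords ::
  "'a topology \<Rightarrow> ('a set \<times> ('a \<Rightarrow> complex \<times> complex)) set \<Rightarrow> 'a set
    \<Rightarrow> 'a set \<Rightarrow> ('a \<Rightarrow> complex \<times> complex) \<Rightarrow> bool" where
  "flat_coords X A D U \<phi> \<longleftrightarrow>
     local_coords X A U \<phi> \<and> D \<inter> U = {x \<in> U. snd (\<phi> x) = 0}"

definition crossing_coords ::
  "'a topology \<Rightarrow> ('a set \<times> ('a \<Rightarrow> complex \<times> complex)) set \<Rightarrow> 'a set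
    \<Rightarrow> 'a set \<Rightarrow> ('a \<Rightarrow> complex \<times> complex) \<Rightarrow> bool" where
  "crossing_coords X A D U \<phi> \<longleftrightarrow>
     local_coords X A U \<phi> \<and> D \<inter> U = {x \<in> U. fst (\<phi> x) * snd (\<phi> x) = 0}"

text \<open>The points of \<open>D\<close> lying on exactly one local branch.\<close>

definition ordinary_point ::
  "'a topology \<Rightarrow> ('a set \<times> ('a \<Rightarrow> complex \<times> complex)) set \<Rightarrow> 'a set \<Rightarrow> 'a \<Rightarrow> bool" where
  "ordinary_point X A D x \<longleftrightarrow> x \<in> D \<and> (\<exists>U \<phi>. flat_coords X A D U \<phi> \<and> x \<in> U)"

definition smooth_curve ::
  "'a topology \<Rightarrow> ('a set \<times> ('a \<Rightarrow> complex \<times> complex)) set \<Rightarrow> 'a set \<Rightarrow> bool" where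
  "smooth_curve X A C \<longleftrightarrow> closedin X C \<and> (\<forall>x\<in>C. ordinary_point X A C x)"

text \<open>In coordinates \<open>\<phi>\<close> flat for \<open>C\<close>, the tangent line of \<open>C\<close> is spanned by \<open>(1, 0)\<close>; in
  coordinates \<open>\<psi>\<close> flat for \<open>C'\<close>, the tangent line of \<open>C'\<close> is the kernel of the differential of
  the second coordinate.  The two lines differ iff the entry \<open>c\<close> of the Jacobian of
  \<open>\<psi> \<circ> \<phi>\<inverse>\<close> is nonzero.\<close>

definition transversal_at ::
  "'a topology \<Rightarrow> ('a set \<times> ('a \<Rightarrow> complex \<times> complex)) set \<Rightarrow> 'a set \<Rightarrow> 'a set \<Rightarrow> 'a \<Rightarrow> bool" where
  "transversal_at X A C C' x \<longleftrightarrow>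
     (\<exists>U \<phi> V \<psi>. flat_coords X A C U \<phi> \<and> flat_coords X A C' V \<psi> \<and> x \<in> U \<inter> V \<and>
        (\<exists>a b c d. complex_derivative2 (transition U \<phi> \<psi>) a b c d (\<phi> x) \<and> c \<noteq> 0))"

definition normal_crossings_divisor ::
  "'a topology \<Rightarrow> ('a set \<times> ('a \<Rightarrow> complex \<times> complex)) set \<Rightarrow> 'a set \<Rightarrow> bool" where
  "normal_crossings_divisor X A D \<longleftrightarrow>
     (\<exists>\<C>. D = \<Union>\<C> \<and> locally_finite_in X \<C> \<and> (\<forall>C\<in>\<C>. smooth_curve X A C) \<and>
        (\<forall>C\<in>\<C>. \<forall>C'\<in>\<C>. C \<noteq> C' \<longrightarrow> (\<forall>x\<in>C \<inter> C'. transversal_at X A C C' x)) \<and>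
        (\<forall>x. card {C\<in>\<C>. x \<in> C} \<le> 2))"

section \<open>Blow-up of a point\<close>

text \<open>Away from \<open>z\<close> the map \<open>\<pi>\<close> is biholomorphic.  Over a coordinate neighbourhood \<open>U\<close> centred at
  \<open>z\<close>, the blow-up is \<open>{(w, [l\<^sub>1 : l\<^sub>2]). w \<in> \<phi> ` U, w\<^sub>1 l\<^sub>2 = w\<^sub>2 l\<^sub>1}\<close>, written in the two
  standard affine charts \<open>\<psi>\<^sub>1 = (w\<^sub>1, l\<^sub>2 / l\<^sub>1)\<close> and \<open>\<psi>\<^sub>2 = (l\<^sub>1 / l\<^sub>2, w\<^sub>2)\<close>.\<close>

definition point_blowup ::
  "'a topology \<Rightarrow> ('a set \<times> ('a \<Rightarrow> complex \<times> complex)) set \<Rightarrow> 'a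
    \<Rightarrow> 'b topology \<Rightarrow> ('b set \<times> ('b \<Rightarrow> complex \<times> complex)) set \<Rightarrow> ('b \<Rightarrow> 'a) \<Rightarrow> bool" where
  "point_blowup X A z Xt At \<pi> \<longleftrightarrow>
     complex_surface Xt At \<and> continuous_map Xt X \<pi> \<and>
     homeomorphic_map (subtopology Xt {x \<in> topspace Xt. \<pi> x \<noteq> z})
                      (subtopology X (topspace X - {z})) \<pi> \<and>
     (\<forall>U \<phi>. local_coords X A U \<phi> \<and> z \<notin> U \<longrightarrow>
        local_coords Xt At {x \<in> topspace Xt. \<pi> x \<in> U} (\<phi> \<circ> \<pi>)) \<and>
     (\<forall>U \<phi>. local_coords X A U \<phi> \<and> z \<in> U \<and> \<phi> z = (0, 0) \<longrightarrow>
        (\<exists>U1 \<psi>1 U2 \<psi>2.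
           local_coords Xt At U1 \<psi>1 \<and> local_coords Xt At U2 \<psi>2 \<and>
           U1 \<union> U2 = {x \<in> topspace Xt. \<pi> x \<in> U} \<and>
           \<psi>1 ` U1 = {(u, v). (u, u * v) \<in> \<phi> ` U} \<and>
           \<psi>2 ` U2 = {(s, t). (s * t, t) \<in> \<phi> ` U} \<and>
           (\<forall>x\<in>U1. \<phi> (\<pi> x) = (fst (\<psi>1 x), fst (\<psi>1 x) * snd (\<psi>1 x))) \<and>
           (\<forall>x\<in>U2. \<phi> (\<pi> x) = (fst (\<psi>2 x) * snd (\<psi>2 x), snd (\<psi>2 x))) \<and>
           U1 \<inter> U2 = {x \<in> U1. snd (\<psi>1 x) \<noteq> 0} \<and>
           U1 \<inter> U2 = {x \<in> U2. fst (\<psi>2 x) \<noteq> 0} \<and>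
           (\<forall>x\<in>U1 \<inter> U2. snd (\<psi>1 x) * fst (\<psi>2 x) = 1)))"

section \<open>Real oriented blow-up\<close>

text \<open>An angle \<open>\<theta> \<in> \<real>/2\<pi>\<int>\<close> is represented by the point \<open>e\<^sup>i\<^sup>\<theta>\<close> of the unit circle;
  for complex \<open>w\<close>, \<open>sgn w = w / |w|\<close>.\<close>

definition flat_model ::
  "(complex \<times> complex) set \<Rightarrow> ((complex \<times> complex) \<times> complex) set" where
  "flat_model V =
     closure {(w, t). w \<in> V \<and> snd w \<noteq> 0 \<and> t = sgn (snd w)} \<inter> (V \<times> sphere 0 1)"

definition crossing_model ::
  "(complex \<times> complex) set \<Rightarrow> ((complex \<times> complex) \<times> complex \<times> complex) set" where
  "crossing_model V =
     closure {(w, t1, t2). w \<in> V \<and> fst w * snd w \<noteq> 0 \<and> t1 = sgn (fst w) \<and> t2 = sgn (snd w)}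
       \<inter> (V \<times> sphere 0 1 \<times> sphere 0 1)"

text \<open>\<open>\<Phi>\<close> identifies \<open>\<rho>\<inverse>(U)\<close> with a local model \<open>M\<close> over \<open>\<phi> ` U\<close>, compatibly with the
  projections.  Such a \<open>\<Phi>\<close> is unique: \<open>M\<close> is the closure of a graph, over which \<open>\<Phi>\<close> is
  determined by \<open>\<phi> \<circ> \<rho>\<close>.\<close>

definition blowup_coords ::
  "'b topology \<Rightarrow> ('b \<Rightarrow> 'a) \<Rightarrow> 'a set \<Rightarrow> ('a \<Rightarrow> complex \<times> complex)
    \<Rightarrow> ((complex \<times> complex) \<times> 'c::topological_space) set
    \<Rightarrow> ('b \<Rightarrow> (complex \<times> complex) \<times> 'c) \<Rightarrow> bool" where
  "blowup_coords B \<rho> U \<phi> M \<Phi> \<longleftrightarrow>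
     homeomorphic_map (subtopology B {b \<in> topspace B. \<rho> b \<in> U}) (top_of_set M) \<Phi> \<and>
     (\<forall>b\<in>topspace B. \<rho> b \<in> U \<longrightarrow> fst (\<Phi> b) = \<phi> (\<rho> b))"

definition real_oriented_blowup ::
  "'a topology \<Rightarrow> ('a set \<times> ('a \<Rightarrow> complex \<times> complex)) set \<Rightarrow> 'a set
    \<Rightarrow> 'b topology \<Rightarrow> ('b \<Rightarrow> 'a) \<Rightarrow> bool" where
  "real_oriented_blowup X A D B \<rho> \<longleftrightarrow>
     continuous_map B X \<rho> \<and>
     homeomorphic_map (subtopology B {b \<in> topspace B. \<rho> b \<notin> D})
                      (subtopology X (topspace X - D)) \<rho> \<and>
     (\<forall>U \<phi>. flat_coords X A D U \<phi> \<longrightarrow>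
        (\<exists>\<Phi>. blowup_coords B \<rho> U \<phi> (flat_model (\<phi> ` U)) \<Phi>)) \<and>
     (\<forall>U \<phi>. crossing_coords X A D U \<phi> \<longrightarrow>
        (\<exists>\<Phi>. blowup_coords B \<rho> U \<phi> (crossing_model (\<phi> ` U)) \<Phi>))"

section \<open>Circle actions\<close>

text \<open>The actions are given by their graphs: the following predicates say \<open>b' = \<Theta> * b\<close>, and
  hold only for \<open>b\<close> in the domain of the respective action.\<close>

text \<open>\<open>\<Theta> * (w\<^sub>1, 0, \<theta>\<^sub>2) = (w\<^sub>1, 0, \<theta>\<^sub>2 + \<Theta>)\<close> over the ordinary points of \<open>D\<close>.\<close>

definition canonical_action ::
  "'a topology \<Rightarrow> ('a set \<times> ('a \<Rightarrow> complex \<times> complex)) set \<Rightarrow> 'a set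
    \<Rightarrow> 'b topology \<Rightarrow> ('b \<Rightarrow> 'a) \<Rightarrow> real \<Rightarrow> 'b \<Rightarrow> 'b \<Rightarrow> bool" where
  "canonical_action X A D B \<rho> \<Theta> b b' \<longleftrightarrow>
     (\<exists>U \<phi> \<Phi> w1 t. flat_coords X A D U \<phi> \<and>
        blowup_coords B \<rho> U \<phi> (flat_model (\<phi> ` U)) \<Phi> \<and>
        b \<in> topspace B \<and> b' \<in> topspace B \<and> \<rho> b \<in> U \<and> \<rho> b' \<in> U \<and>
        \<Phi> b = ((w1, 0), t) \<and> \<Phi> b' = ((w1, 0), t * cis \<Theta>))"

text \<open>\<open>\<Theta> * (w\<^sub>1, 0, \<theta>\<^sub>2) = (w\<^sub>1 e\<^sup>i\<^sup>\<Theta>, 0, \<theta>\<^sub>2 + \<Theta>)\<close> over the disc \<open>|w\<^sub>1| < r, w\<^sub>2 = 0\<close>,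
  in the coordinates \<open>w\<close> on \<open>W\<close>.\<close>

definition disc_action ::
  "'b topology \<Rightarrow> ('b \<Rightarrow> 'a) \<Rightarrow> 'a set \<Rightarrow> ('a \<Rightarrow> complex \<times> complex) \<Rightarrow> real
    \<Rightarrow> real \<Rightarrow> 'b \<Rightarrow> 'b \<Rightarrow> bool" where
  "disc_action B \<rho> W w r \<Theta> b b' \<longleftrightarrow>
     (\<exists>\<Phi> w1 t. blowup_coords B \<rho> W w (flat_model (w ` W)) \<Phi> \<and>
        b \<in> topspace B \<and> b' \<in> topspace B \<and> \<rho> b \<in> W \<and> \<rho> b' \<in> W \<and> cmod w1 < r \<and>
        \<Phi> b = ((w1, 0), t) \<and> \<Phi> b' = ((w1 * cis \<Theta>, 0), t * cis \<Theta>))"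

text \<open>The action on \<open>Z\<close>: the disc action over the open disc, the canonical action over the ordinary
  points of \<open>D\<close> outside the closed disc.  On the torus over \<open>|w\<^sub>1| = r\<close>, where the limits
  of the two from either side differ, there is no action; so a map respecting the circle actions
  sends no point over an ordinary point into that torus.\<close>

definition Z_action ::
  "'a topology \<Rightarrow> ('a set \<times> ('a \<Rightarrow> complex \<times> complex)) set \<Rightarrow> 'a set
    \<Rightarrow> 'b topology \<Rightarrow> ('b \<Rightarrow> 'a) \<Rightarrow> 'a set \<Rightarrow> ('a \<Rightarrow> complex \<times> complex) \<Rightarrow> real
    \<Rightarrow> real \<Rightarrow> 'b \<Rightarrow> 'b \<Rightarrow> bool" where
  "Z_action X A D B \<rho> W w r \<Theta> b b' \<longleftrightarrow>
     disc_action B \<rho> W w r \<Theta> b b' \<or>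
     (\<not> (\<rho> b \<in> W \<and> cmod (fst (w (\<rho> b))) \<le> r) \<and> canonical_action X A D B \<rho> \<Theta> b b')"

end

(* Over W, the space B(X,D) has coordinates (w1, a, t) with w2 = a t, a >= 0, |t| = 1: a circle of closed
   half spaces.  For the blown-up surface the corresponding space is, for each t, the real oriented
   blow-up of that half space at its origin, with coordinates the size n = |w1| + a and the direction
   (p, 1 - |p|) = (w1, a) / n; the exceptional divisor is the hemisphere n = 0, on which the canonical
   circle action is (p, t) |-> (p e^(i Theta), t e^(i Theta)).  The map sending the polar coordinates (n, p, t) to
   (w1, a, t) = (g(n) p, n (1 - |p|), t), with g(0) = r, g increasing, and g(n) = n for large n, flattens the
   hemisphere onto the disc |w1| <= r, commutes with rotations of p and t, and is the canonical map
   outside a compact set, so that it can be continued by the canonical map over the rest of X. *)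

theory Submission
  imports Defs "HOL-Complex_Analysis.Cauchy_Integral_Formula"
begin

section \<open>Charts and transition maps\<close>

text \<open>Three obstacles shape the proof. The lift \<open>\<pi>t\<close> and the model
  coordinates of a real blow-up are known explicitly only off the divisor; identities between them
  are therefore proved there and extended by density. The divisor is given as a union of curves,
  each flat in coordinates of its own, so coordinates straightening two transversal branches at once
  have to be constructed before a double point has a model. The canonical action is defined by the
  existence of some flat coordinates; any other flat coordinates must be shown to change the angle
  on a fibre by a constant rotation only. The action on the hemisphere arises from the affine chart
  \<open>(s, v) = (w1 / w2, w2)\<close>: the canonical action fixes \<open>s\<close> and turns the
  angle \<open>t\<close> of \<open>v\<close>, while \<open>p = s t / (1 + |s|)\<close>. Measuring
  size by \<open>|w1| + a\<close> and taking \<open>g\<close> affine up to a radius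
  \<open>R0\<close> sends the rays of constant \<open>p\<close> and \<open>t\<close> to straight
  segments there, so inverting the map amounts to solving a quadratic equation. Any
  \<open>R0\<close> strictly between \<open>r\<close> and \<open>R\<close> will do; it confines the
  modification to a compact subset of \<open>W\<close>.\<close>

lemma topological_chartD:
  assumes "topological_chart X U \<phi>"
  shows "openin X U" "U \<subseteq> topspace X" "inj_on \<phi> U" "open (\<phi> ` U)"
    "continuous_map (subtopology X U) euclidean \<phi>"
    "homeomorphic_map (subtopology X U) (top_of_set (\<phi> ` U)) \<phi>"
proof -
  show 1: "openin X U" "open (\<phi> ` U)"
      and 2: "homeomorphic_map (subtopology X U) (top_of_set (\<phi> ` U)) \<phi>"
    using assms by (auto simp: topological_chart_def)
  show "U \<subseteq> topspace X" using 1 by (simp add: openin_subset)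
  then show "inj_on \<phi> U"
    using homeomorphic_imp_injective_map[OF 2] by (simp add: inf.absorb2)
  show "continuous_map (subtopology X U) euclidean \<phi>"
    using homeomorphic_imp_continuous_map[OF 2] by (simp add: continuous_map_in_subtopology)
qed

lemma topological_chart_restrict:
  assumes c: "topological_chart X U \<phi>" and V: "openin X V" "V \<subseteq> U"
  shows "topological_chart X V \<phi>"
proof -
  note D = topological_chartD[OF c]
  have eq: "\<phi> ` (topspace (subtopology X U) \<inter> V) = topspace (top_of_set (\<phi> ` U)) \<inter> \<phi> ` V"
    using D(2) V by auto
  have "homeomorphic_map (subtopology (subtopology X U) V)
      (subtopology (top_of_set (\<phi> ` U)) (\<phi> ` V)) \<phi>"
    by (rule homeomorphic_map_subtopologies[OF D(6) eq])
  moreover have "U \<inter> V = V" "\<phi> ` U \<inter> \<phi> ` V = \<phi> ` V" using V by auto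
  ultimately have h: "homeomorphic_map (subtopology X V) (top_of_set (\<phi> ` V)) \<phi>"
    by (simp add: subtopology_subtopology)
  have "openin (top_of_set (\<phi> ` U)) (\<phi> ` V)"
    using homeomorphic_imp_open_map[OF D(6)] V openin_open_subtopology[OF D(1)]
    unfolding open_map_def by blast
  then have "open (\<phi> ` V)" using D(4) openin_open_trans by blast
  then show ?thesis using h V by (simp add: topological_chart_def)
qed

lemma topological_chart_open_vimage:
  assumes c: "topological_chart X U \<phi>" and N: "open N"
  shows "openin X {x \<in> U. \<phi> x \<in> N}"
proof -
  note D = topological_chartD[OF c]
  have "openin (subtopology X U) {x \<in> topspace (subtopology X U). \<phi> x \<in> N}"
    by (rule openin_continuous_map_preimage[OF D(5)]) (use N in simp)
  moreover have "{x \<in> topspace (subtopology X U). \<phi> x \<in> N} = {x \<in> U. \<phi> x \<in> N}"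
    using D(2) by auto
  ultimately show ?thesis
    using D(1) openin_trans_full by metis
qed

lemma transition_apply:
  "inj_on \<phi> U \<Longrightarrow> x \<in> U \<Longrightarrow> transition U \<phi> \<psi> (\<phi> x) = \<psi> x"
  by (simp add: transition_def)

section \<open>Jacobians of maps of two complex variables\<close>

lemma complex_derivative2_compose:
  assumes "complex_derivative2 f a b c d p" "complex_derivative2 g a' b' c' d' (f p)"
  shows "complex_derivative2 (g \<circ> f) (a' * a + b' * c) (a' * b + b' * d)
           (c' * a + d' * c) (c' * b + d' * d) p"
proof -
  have "(g \<circ> f has_derivative (\<lambda>(h, k). (a' * h + b' * k, c' * h + d' * k)) \<circ>
      (\<lambda>(h, k). (a * h + b * k, c * h + d * k))) (at p)"
    using assms unfolding complex_derivative2_def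
    by (intro diff_chain_at) auto
  then show ?thesis
    unfolding complex_derivative2_def
    by (rule has_derivative_eq_rhs) (auto simp: fun_eq_iff algebra_simps)
qed

lemma complex_derivative2_cong:
  assumes "complex_derivative2 f a b c d p" "open S" "p \<in> S" "\<And>q. q \<in> S \<Longrightarrow> f q = g q"
  shows "complex_derivative2 g a b c d p"
  using has_derivative_transform_within_open[OF assms(1)[unfolded complex_derivative2_def] assms(2-4)]
  unfolding complex_derivative2_def .

lemma complex_derivative2_unique:
  assumes "complex_derivative2 f a b c d p" "complex_derivative2 f a' b' c' d' p"
  shows "a = a' \<and> b = b' \<and> c = c' \<and> d = d'"
proof -
  have "(\<lambda>(h, k). (a * h + b * k, c * h + d * k)) = (\<lambda>(h, k). (a' * h + b' * k, c' * h + d' * k))"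
    using assms unfolding complex_derivative2_def by (rule has_derivative_unique)
  from fun_cong[OF this, of "(1,0)"] fun_cong[OF this, of "(0,1)"] show ?thesis by auto
qed

lemma complex_derivative2_ident: "complex_derivative2 (\<lambda>x. x) 1 0 0 1 p"
  unfolding complex_derivative2_def
  by (rule has_derivative_eq_rhs[OF has_derivative_ident]) auto

text \<open>One direction of holomorphic compatibility at a single point. Charts can then be shrunk
  and composed without following the open domain of each transition map.\<close>

definition holo_transition_at ::
  "'a set \<Rightarrow> ('a \<Rightarrow> complex \<times> complex) \<Rightarrow> ('a \<Rightarrow> complex \<times> complex) \<Rightarrow> 'a \<Rightarrow> bool" where
  "holo_transition_at U \<phi> \<psi> x \<longleftrightarrow>
     (\<exists>a b c d. complex_derivative2 (transition U \<phi> \<psi>) a b c d (\<phi> x))"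

text \<open>The two transition maps invert \<open>\<phi>\<close> on different sets; by injectivity
  on \<open>U\<close> these inverses agree on the image of \<open>V\<close>, which is open.\<close>

lemma transition_derivative_subset:
  assumes c: "topological_chart X U \<phi>" and V: "openin X V" "V \<subseteq> U" "x \<in> V"
  shows "complex_derivative2 (transition V \<phi> \<psi>) a b c d (\<phi> x) \<longleftrightarrow>
         complex_derivative2 (transition U \<phi> \<psi>) a b c d (\<phi> x)"
proof -
  note D = topological_chartD[OF c]
  have o: "open (\<phi> ` V)"
    using topological_chartD(4)[OF topological_chart_restrict[OF c V(1,2)]] .
  have eq: "transition V \<phi> \<psi> q = transition U \<phi> \<psi> q" if q: "q \<in> \<phi> ` V" for q
  proof -
    obtain y where "y \<in> V" "q = \<phi> y" using q by auto
    then show ?thesis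
      using D(3) V(2) by (auto simp: transition_apply inj_on_subset)
  qed
  show ?thesis
    using complex_derivative2_cong[OF _ o, of _ a b c d "\<phi> x"] V(3) eq
    by (intro iffI) (force)+
qed

lemma holo_transition_at_subset:
  assumes "topological_chart X U \<phi>" "openin X V" "V \<subseteq> U" "x \<in> V"
  shows "holo_transition_at V \<phi> \<psi> x \<longleftrightarrow> holo_transition_at U \<phi> \<psi> x"
  unfolding holo_transition_at_def transition_derivative_subset[OF assms] ..

text \<open>Chain rule. The composite of the two transition maps is known to be a transition map
  only on the image of \<open>U \<inter> V\<close>, which is open.\<close>

lemma transition_derivative_trans:
  assumes U: "topological_chart X U \<phi>" and V: "topological_chart X V \<psi>" and x: "x \<in> U \<inter> V"
    and 1: "complex_derivative2 (transition U \<phi> \<psi>) a b c d (\<phi> x)"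
    and 2: "complex_derivative2 (transition V \<psi> \<omega>) a' b' c' d' (\<psi> x)"
  shows "complex_derivative2 (transition U \<phi> \<omega>) (a' * a + b' * c) (a' * b + b' * d)
           (c' * a + d' * c) (c' * b + d' * d) (\<phi> x)"
proof (rule complex_derivative2_cong)
  note D = topological_chartD[OF U] and E = topological_chartD[OF V]
  show "complex_derivative2 (transition V \<psi> \<omega> \<circ> transition U \<phi> \<psi>) (a' * a + b' * c) (a' * b + b' * d)
           (c' * a + d' * c) (c' * b + d' * d) (\<phi> x)"
    using 1 2 x D(3) by (intro complex_derivative2_compose) (auto simp: transition_apply)
  show "open (\<phi> ` (U \<inter> V))"
    by (rule topological_chartD(4)[OF topological_chart_restrict[OF U]])
      (use D(1) E(1) in auto)
  show "\<phi> x \<in> \<phi> ` (U \<inter> V)" using x by auto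
  fix q assume "q \<in> \<phi> ` (U \<inter> V)"
  then show "(transition V \<psi> \<omega> \<circ> transition U \<phi> \<psi>) q = transition U \<phi> \<omega> q"
    using D(3) E(3) by (auto simp: transition_apply)
qed

lemma holo_transition_at_trans:
  assumes "topological_chart X U \<phi>" "topological_chart X V \<psi>" "x \<in> U \<inter> V"
    "holo_transition_at U \<phi> \<psi> x" "holo_transition_at V \<psi> \<omega> x"
  shows "holo_transition_at U \<phi> \<omega> x"
  using transition_derivative_trans[OF assms(1-3)] assms(4,5)
  unfolding holo_transition_at_def by blast

lemma holomorphically_compatible_iff:
  assumes U: "topological_chart X U \<phi>" and V: "topological_chart X V \<psi>"
  shows "holomorphically_compatible U \<phi> V \<psi> \<longleftrightarrow>
    (\<forall>x\<in>U \<inter> V. holo_transition_at U \<phi> \<psi> x \<and> holo_transition_at V \<psi> \<phi> x)"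
proof -
  note D = topological_chartD[OF U] and E = topological_chartD[OF V]
  have "open (\<phi> ` (U \<inter> V))"
    by (rule topological_chartD(4)[OF topological_chart_restrict[OF U]]) (use D(1) E(1) in auto)
  moreover have "open (\<psi> ` (U \<inter> V))"
    by (rule topological_chartD(4)[OF topological_chart_restrict[OF V]]) (use D(1) E(1) in auto)
  ultimately show ?thesis
    unfolding holomorphically_compatible_def holomorphic2_on_def holo_transition_at_def by blast
qed

section \<open>The maximal atlas\<close>

lemma local_coords_iff:
  assumes S: "complex_surface X A"
  shows "local_coords X A U \<phi> \<longleftrightarrow> topological_chart X U \<phi> \<and>
    (\<forall>V \<psi> x. (V, \<psi>) \<in> A \<longrightarrow> x \<in> U \<inter> V \<longrightarrow>
       holo_transition_at U \<phi> \<psi> x \<and> holo_transition_at V \<psi> \<phi> x)"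
proof -
  have "holomorphically_compatible U \<phi> V \<psi> \<longleftrightarrow>
      (\<forall>x\<in>U \<inter> V. holo_transition_at U \<phi> \<psi> x \<and> holo_transition_at V \<psi> \<phi> x)"
    if "topological_chart X U \<phi>" "(V, \<psi>) \<in> A" for V \<psi>
    by (rule holomorphically_compatible_iff[OF that(1)])
      (use S that(2) in \<open>auto simp: complex_surface_def\<close>)
  then show ?thesis
    unfolding local_coords_def by blast
qed

lemma complex_surface_atlas:
  assumes S: "complex_surface X A" and V: "(V, \<psi>) \<in> A"
  shows "local_coords X A V \<psi>"
proof -
  have "\<forall>(U, \<phi>)\<in>A. topological_chart X U \<phi>"
    "\<forall>(U, \<phi>)\<in>A. \<forall>(V, \<psi>)\<in>A. holomorphically_compatible U \<phi> V \<psi>"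
    using S by (simp_all add: complex_surface_def)
  from bspec[OF this(1) V] bspec[OF this(2) V] show ?thesis
    by (simp add: local_coords_def)
qed

lemma complex_surface_chart:
  assumes S: "complex_surface X A" and x: "x \<in> topspace X"
  obtains V \<psi> where "(V, \<psi>) \<in> A" "local_coords X A V \<psi>" "x \<in> V"
proof -
  have "x \<in> (\<Union>(U, \<phi>)\<in>A. U)" using S x by (simp add: complex_surface_def)
  then obtain V \<psi> where "(V, \<psi>) \<in> A" "x \<in> V" by auto
  with complex_surface_atlas[OF S] that show ?thesis by blast
qed

lemma local_coords_restrict:
  assumes S: "complex_surface X A" and U: "local_coords X A U \<phi>" and V: "openin X V" "V \<subseteq> U"
  shows "local_coords X A V \<phi>"
proof -
  have c: "topological_chart X U \<phi>" using U by (simp add: local_coords_def)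
  show ?thesis
    unfolding local_coords_iff[OF S]
  proof (intro conjI allI impI)
    show "topological_chart X V \<phi>" using topological_chart_restrict[OF c V] .
    fix O' \<psi> x assume *: "(O', \<psi>) \<in> A" "x \<in> V \<inter> O'"
    then have "holo_transition_at U \<phi> \<psi> x \<and> holo_transition_at O' \<psi> \<phi> x"
      using U V unfolding local_coords_iff[OF S] by blast
    then show "holo_transition_at V \<phi> \<psi> x" "holo_transition_at O' \<psi> \<phi> x"
      using holo_transition_at_subset[OF c V] * by auto
  qed
qed

lemma local_coords_chart: "local_coords X A U \<phi> \<Longrightarrow> topological_chart X U \<phi>"
  by (simp add: local_coords_def)

text \<open>By definition coordinates are compared only with charts of \<open>A\<close>; an atlas
  chart at \<open>x\<close> mediates between two arbitrary systems.\<close>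

lemma local_coords_holo_transition:
  assumes S: "complex_surface X A" and U: "local_coords X A U \<phi>" and V: "local_coords X A V \<psi>"
    and x: "x \<in> U \<inter> V"
  shows "holo_transition_at U \<phi> \<psi> x"
proof -
  have "x \<in> topspace X" using x topological_chartD(2)[OF local_coords_chart[OF U]] by auto
  then obtain O' \<omega> where O: "(O', \<omega>) \<in> A" "local_coords X A O' \<omega>" "x \<in> O'"
    by (rule complex_surface_chart[OF S])
  show ?thesis
    by (rule holo_transition_at_trans[where V = O' and \<psi> = \<omega>])
      (use O U V x local_coords_iff[OF S] in auto)
qed

text \<open>By transitivity, one known system at each point, chosen at will, can replace the atlas
  as the test for new coordinates.\<close>

lemma local_coordsI:
  assumes S: "complex_surface X A" and c: "topological_chart X U \<phi>"
    and ex: "\<And>x. x \<in> U \<Longrightarrow> \<exists>V \<psi>. local_coords X A V \<psi> \<and> x \<in> V \<and>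
        holo_transition_at U \<phi> \<psi> x \<and> holo_transition_at V \<psi> \<phi> x"
  shows "local_coords X A U \<phi>"
  unfolding local_coords_iff[OF S]
proof (intro conjI allI impI)
  fix O' \<omega> x assume O: "(O', \<omega>) \<in> A" "x \<in> U \<inter> O'"
  then obtain V \<psi> where V: "local_coords X A V \<psi>" "x \<in> V"
      "holo_transition_at U \<phi> \<psi> x" "holo_transition_at V \<psi> \<phi> x" using ex by blast
  have O': "local_coords X A O' \<omega>"
    by (rule complex_surface_atlas[OF S O(1)])
  show "holo_transition_at U \<phi> \<omega> x"
    using holo_transition_at_trans[OF c local_coords_chart[OF V(1)] _ V(3)]
      local_coords_holo_transition[OF S V(1) O'] O V by auto
  show "holo_transition_at O' \<omega> \<phi> x"
    using holo_transition_at_trans[OF local_coords_chart[OF O'] local_coords_chart[OF V(1)] _ _ V(4)]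
      local_coords_holo_transition[OF S O' V(1)] O V by auto
qed (fact c)

text \<open>A zero second row would contradict the existence of an inverse transition map.\<close>

lemma transition_derivative_second_row_nonzero:
  assumes S: "complex_surface X A" and U: "local_coords X A U \<phi>" and V: "local_coords X A V \<psi>"
    and x: "x \<in> U \<inter> V"
    and der: "complex_derivative2 (transition U \<phi> \<psi>) a b c d (\<phi> x)"
  shows "c \<noteq> 0 \<or> d \<noteq> 0"
proof -
  note cU = local_coords_chart[OF U] and cV = local_coords_chart[OF V]
  obtain a' b' c' d' where 2: "complex_derivative2 (transition V \<psi> \<phi>) a' b' c' d' (\<psi> x)"
    using local_coords_holo_transition[OF S V U] x unfolding holo_transition_at_def by blast
  have 3: "complex_derivative2 (transition V \<psi> \<psi>) (a * a' + b * c') (a * b' + b * d')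
      (c * a' + d * c') (c * b' + d * d') (\<psi> x)"
    using transition_derivative_trans[OF cV cU _ 2 der] x by auto
  have "complex_derivative2 (transition V \<psi> \<psi>) 1 0 0 1 (\<psi> x)"
    by (rule complex_derivative2_cong[OF complex_derivative2_ident, of "\<psi> ` V"])
      (use topological_chartD[OF cV] x in \<open>auto simp: transition_apply\<close>)
  \<comment> \<open>The last entry gives \<open>c * b' + d * d' = 1\<close>, which excludes
    \<open>c = d = 0\<close>.\<close>
  from complex_derivative2_unique[OF 3 this] show ?thesis by auto
qed

section \<open>Crossing coordinates\<close>

text \<open>The Cauchy estimate makes the partial derivative in the first variable jointly continuous,
  so \<open>F\<close> stays close to its linearisation in that variable.\<close>

lemma inj_on_pair_snd_of_derivative_nonzero:
  fixes F :: "complex \<times> complex \<Rightarrow> complex"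
  assumes S: "open S" "p0 \<in> S"
    and der: "\<And>p. p \<in> S \<Longrightarrow> (F has_derivative (\<lambda>(h, k). c p * h + d p * k)) (at p)"
    and c0: "c p0 \<noteq> 0"
  shows "\<exists>N. open N \<and> p0 \<in> N \<and> N \<subseteq> S \<and> (\<forall>p\<in>N. c p \<noteq> 0) \<and> inj_on (\<lambda>p. (F p, snd p)) N"
proof -
  obtain a0 b0 where p0: "p0 = (a0, b0)" by (cases p0)
  obtain P Q where PQ0: "open P" "open Q" "p0 \<in> P \<times> Q" "P \<times> Q \<subseteq> S"
    by (rule open_prod_elim[OF S])
  then have PQ: "open P" "open Q" "a0 \<in> P" "b0 \<in> Q" "P \<times> Q \<subseteq> S" using p0 by auto
  obtain e1 where e1: "e1 > 0" "cball a0 e1 \<subseteq> P" using PQ open_contains_cball by blast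
  obtain e2 where e2: "e2 > 0" "cball b0 e2 \<subseteq> Q" using PQ open_contains_cball by blast
  \<comment> \<open>The radius of the Cauchy estimate. Working in the disc of radius
    \<open>2 * e\<close> leaves room for a closed disc of radius \<open>e\<close> about every
    \<open>w\<close> in \<open>ball a0 \<delta>\<close>.\<close>
  define e where "e = e1 / 2"
  have e: "e > 0" using e1 by (simp add: e_def)
  have sub: "cball a0 (2 * e) \<times> cball b0 e2 \<subseteq> S" using e1 e2 PQ by (auto simp: e_def)
  have fder: "((\<lambda>w. F (w, b)) has_field_derivative c (w, b)) (at w)"
    if "(w, b) \<in> S" for w b
  proof -
    have "((\<lambda>w. (w, b)) has_derivative (\<lambda>h. (h, 0))) (at w)"
      by (auto intro!: derivative_eq_intros)
    from diff_chain_at[OF this der[OF that]] show ?thesis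
      by (simp add: has_field_derivative_def o_def)
  qed
  have contF: "continuous_on S F"
    by (meson der continuous_at_imp_continuous_on has_derivative_continuous)
  have c0': "cmod (c p0) > 0" using c0 by simp
  have ucont: "uniformly_continuous_on (cball a0 (2 * e) \<times> cball b0 e2) F"
    by (intro compact_uniformly_continuous continuous_on_subset[OF contF sub] compact_Times) auto
  \<comment> \<open>The Cauchy estimate divides this tolerance by \<open>e\<close>, leaving a
    quarter of \<open>cmod (c p0)\<close>; a second quarter is spent on the variation of
    \<open>c\<close> along the slice \<open>b0\<close>.\<close>
  have "e * cmod (c p0) / 4 > 0" using e c0' by simp
  with ucont obtain \<eta> where \<eta>: "\<eta> > 0"
    and \<eta>F: "\<And>p q. p \<in> cball a0 (2 * e) \<times> cball b0 e2 \<Longrightarrow> q \<in> cball a0 (2 * e) \<times> cball b0 e2 \<Longrightarrow>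
        dist q p < \<eta> \<Longrightarrow> dist (F q) (F p) < e * cmod (c p0) / 4"
    unfolding uniformly_continuous_on_def by metis
  have hol0: "(\<lambda>w. F (w, b)) holomorphic_on ball a0 (2 * e)" if "b \<in> cball b0 e2" for b
  proof (subst holomorphic_on_open)
    show "\<forall>x\<in>ball a0 (2 * e). \<exists>f'. ((\<lambda>w. F (w, b)) has_field_derivative f') (at x)"
    proof
      fix x assume "x \<in> ball a0 (2 * e)"
      then have "(x, b) \<in> S" using sub that by auto
      from fder[OF this] show "\<exists>f'. ((\<lambda>w. F (w, b)) has_field_derivative f') (at x)" ..
    qed
  qed simp
  have "deriv (\<lambda>w. F (w, b0)) holomorphic_on ball a0 (2 * e)"
    using e2 by (intro holomorphic_deriv hol0) auto
  then have "isCont (deriv (\<lambda>w. F (w, b0))) a0"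
    using e by (meson centre_in_ball continuous_on_eq_continuous_at holomorphic_on_imp_continuous_on
        mult_pos_pos open_ball zero_less_numeral)
  then obtain \<delta>0 where \<delta>0: "\<delta>0 > 0" and \<delta>c: "\<And>w. dist w a0 < \<delta>0 \<Longrightarrow>
      dist (deriv (\<lambda>w. F (w, b0)) w) (deriv (\<lambda>w. F (w, b0)) a0) < cmod (c p0) / 4"
    unfolding continuous_at_eps_delta using c0' by (metis divide_pos_pos zero_less_numeral)
  define \<delta> where "\<delta> = min \<delta>0 (e / 2)"
  define \<eta>' where "\<eta>' = min \<eta> e2"
  have \<delta>: "\<delta> > 0" "\<delta> \<le> \<delta>0" "\<delta> \<le> e / 2" using \<delta>0 e by (auto simp: \<delta>_def)
  have \<eta>': "\<eta>' > 0" "\<eta>' \<le> \<eta>" "\<eta>' \<le> e2" using \<eta> e2 by (auto simp: \<eta>'_def)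
  have bound: "cmod (c (w, b) - c p0) \<le> cmod (c p0) / 2" if w: "w \<in> ball a0 \<delta>" and b: "b \<in> ball b0 \<eta>'" for w b
  proof -
    have wb: "cball w e \<subseteq> ball a0 (2 * e)"
    proof
      fix y assume "y \<in> cball w e"
      then have "dist a0 y \<le> dist a0 w + e" using dist_triangle[of a0 y w] by simp
      also have "\<dots> < 2 * e" using w \<delta> e by auto
      finally show "y \<in> ball a0 (2 * e)" by simp
    qed
    have bb: "b \<in> cball b0 e2" "b0 \<in> cball b0 e2" using b \<eta>' e2 by auto
    let ?g = "\<lambda>y. F (y, b) - F (y, b0)"
    have holg: "?g holomorphic_on ball a0 (2 * e)"
      using hol0 bb by (intro holomorphic_intros) auto
    \<comment> \<open>The slices at \<open>b\<close> and \<open>b0\<close> are uniformly close, so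
      their derivatives in the first variable are close at the centre of the disc.\<close>
    have "cmod ((deriv ^^ 1) ?g w) \<le> fact 1 * (e * cmod (c p0) / 4) / e ^ 1"
    proof (rule Cauchy_higher_deriv_bound[where y = 0])
      show "?g holomorphic_on ball w e"
        using holg wb by (meson ball_subset_cball holomorphic_on_subset subset_trans)
      show "continuous_on (cball w e) ?g"
        using holg wb by (meson holomorphic_on_imp_continuous_on holomorphic_on_subset)
      fix y assume "y \<in> ball w e"
      then have "y \<in> cball a0 (2 * e)" using wb by (meson ball_subset_cball subsetD)
      then have "dist (F (y, b)) (F (y, b0)) < e * cmod (c p0) / 4"
        using bb b \<eta>' by (intro \<eta>F) (auto simp: dist_Pair_Pair dist_commute)
      then show "?g y \<in> ball 0 (e * cmod (c p0) / 4)" by (simp add: dist_norm norm_minus_commute)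
    qed (use e in auto)
    moreover have inS: "(w, b) \<in> S" "(w, b0) \<in> S" "(a0, b0) \<in> S"
      using sub bb w \<delta> e by auto
    have "deriv ?g w = c (w, b) - c (w, b0)"
      by (intro DERIV_imp_deriv DERIV_diff fder inS)
    ultimately have "cmod (c (w, b) - c (w, b0)) \<le> cmod (c p0) / 4" using e by simp
    moreover have "cmod (c (w, b0) - c p0) < cmod (c p0) / 4"
      using \<delta>c[of w] w \<delta> DERIV_imp_deriv[OF fder[OF inS(2)]] DERIV_imp_deriv[OF fder[OF inS(3)]] p0
      by (simp add: dist_norm norm_minus_commute)
    moreover have "cmod (c (w, b) - c p0) \<le> cmod (c (w, b) - c (w, b0)) + cmod (c (w, b0) - c p0)"
      using norm_triangle_ineq[of "c (w, b) - c (w, b0)" "c (w, b0) - c p0"] by simp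
    ultimately show ?thesis by simp
  qed
  have NS: "(w, b) \<in> S" if "w \<in> ball a0 \<delta>" "b \<in> ball b0 \<eta>'" for w b
    using sub that \<delta> \<eta>' e by (intro subsetD[OF sub]) auto
  have inj: "w = w'" if w: "w \<in> ball a0 \<delta>" "w' \<in> ball a0 \<delta>" and b: "b \<in> ball b0 \<eta>'"
    and eq: "F (w, b) = F (w', b)" for w w' b
  proof -
    \<comment> \<open>After subtraction of the linear part, the slice has Lipschitz constant at most
      half of \<open>cmod (c p0)\<close>, too small to cancel that linear part between distinct
      points.\<close>
    have "cmod ((F (w, b) - c p0 * w) - (F (w', b) - c p0 * w')) \<le> cmod (c p0) / 2 * cmod (w - w')"
    proof (rule field_differentiable_bound[where f' = "\<lambda>w. c (w, b) - c p0"])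
      show "convex (ball a0 \<delta>)" by simp
      fix y assume y: "y \<in> ball a0 \<delta>"
      show "((\<lambda>w. F (w, b) - c p0 * w) has_field_derivative c (y, b) - c p0) (at y within ball a0 \<delta>)"
        by (rule has_field_derivative_at_within)
          (auto intro!: derivative_eq_intros fder NS y b)
      show "cmod (c (y, b) - c p0) \<le> cmod (c p0) / 2" by (rule bound[OF y b])
    qed (use w in auto)
    also have "(F (w, b) - c p0 * w) - (F (w', b) - c p0 * w') = - (c p0 * (w - w'))"
      using eq by (simp add: algebra_simps)
    finally have "cmod (c p0) * cmod (w - w') \<le> cmod (c p0) / 2 * cmod (w - w')"
      by (simp add: norm_mult)
    then have "cmod (c p0) * cmod (w - w') \<le> 0" by simp
    then show ?thesis using c0' by (simp add: mult_le_0_iff)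
  qed
  show ?thesis
  proof (intro exI conjI ballI)
    let ?N = "ball a0 \<delta> \<times> ball b0 \<eta>'"
    show "open ?N" by (intro open_Times) auto
    show "p0 \<in> ?N" using p0 \<delta> \<eta>' by auto
    show "?N \<subseteq> S" using NS by auto
    show "inj_on (\<lambda>p. (F p, snd p)) ?N" using inj by (auto simp: inj_on_def)
    fix p assume "p \<in> ?N"
    then have "cmod (c p - c p0) \<le> cmod (c p0) / 2" using bound by auto
    then show "c p \<noteq> 0" using c0' by auto
  qed
qed

lemma complex_derivative2_continuous: "complex_derivative2 f a b c d p \<Longrightarrow> isCont f p"
  unfolding complex_derivative2_def by (rule has_derivative_continuous)

text \<open>Since \<open>G\<close> is injective, invariance of domain makes it a homeomorphism onto
  an open set, and the nonzero determinant makes the inverse holomorphic.\<close>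

lemma local_coords_compose:
  assumes S: "complex_surface X A" and U: "local_coords X A U \<phi>"
    and N: "open N" "N \<subseteq> \<phi> ` U" and inj: "inj_on G N"
    and der: "\<And>p. p \<in> N \<Longrightarrow> \<exists>a b c d. complex_derivative2 G a b c d p \<and> a * d - b * c \<noteq> 0"
  shows "local_coords X A {x \<in> U. \<phi> x \<in> N} (G \<circ> \<phi>)"
proof (rule local_coordsI[OF S])
  let ?V = "{x \<in> U. \<phi> x \<in> N}"
  note cU = local_coords_chart[OF U]
  note D = topological_chartD[OF cU]
  have V: "openin X ?V" using topological_chart_open_vimage[OF cU N(1)] .
  have cV: "topological_chart X ?V \<phi>" by (rule topological_chart_restrict[OF cU V]) auto
  have im: "\<phi> ` ?V = N" using N by auto
  have contG: "continuous_on N G"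
    using der complex_derivative2_continuous by (intro continuous_at_imp_continuous_on) blast
  have oG: "open (G ` N)" by (rule invariance_of_domain[OF contG N(1) inj])
  obtain G' where G': "homeomorphism N (G ` N) G G'"
    using invariance_of_domain_homeomorphism[OF N(1) contG _ inj] by auto
  have "homeomorphic_map (top_of_set N) (top_of_set (G ` N)) G"
    unfolding homeomorphic_map_maps
    by (rule exI[of _ G']) (use G' in \<open>auto simp: homeomorphic_maps_def homeomorphism_def\<close>)
  then have h: "homeomorphic_map (subtopology X ?V) (top_of_set (G ` N)) (G \<circ> \<phi>)"
    using topological_chartD(6)[OF cV] unfolding im by (rule homeomorphic_map_compose[rotated])
  have im2: "(G \<circ> \<phi>) ` ?V = G ` N" using im by (metis image_comp)
  show cG: "topological_chart X ?V (G \<circ> \<phi>)"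
    unfolding topological_chart_def im2 using V oG h by auto
  fix x assume x: "x \<in> ?V"
  obtain a b c d where d: "complex_derivative2 G a b c d (\<phi> x)" "a * d - b * c \<noteq> 0"
    using der x by blast
  have "complex_derivative2 (transition ?V \<phi> (G \<circ> \<phi>)) a b c d (\<phi> x)"
    by (rule complex_derivative2_cong[OF d(1) N(1)])
      (use x im topological_chartD(3)[OF cV] in \<open>force simp: transition_apply\<close>)+
  then have 1: "complex_derivative2 (transition U \<phi> (G \<circ> \<phi>)) a b c d (\<phi> x)"
    using transition_derivative_subset[OF cU V _ x] by auto
  let ?q = "a * d - b * c"
  \<comment> \<open>The inverse of the Jacobian matrix by Cramer's rule, with determinant
    \<open>?q\<close>.\<close>
  have "(inv_into N G has_derivative (\<lambda>(h, k). (d / ?q * h + (- b / ?q) * k, (- c / ?q) * h + a / ?q * k))) (at (G (\<phi> x)))"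
  proof (rule has_derivative_inverse_strong[OF N(1) _ contG])
    show "(G has_derivative (\<lambda>(h, k). (a * h + b * k, c * h + d * k))) (at (\<phi> x))"
      using d(1) by (simp add: complex_derivative2_def)
    have *: "a * (d / q * h + - b / q * k) + b * (- c / q * h + a / q * k) = h"
       "c * (d / q * h + - b / q * k) + d * (- c / q * h + a / q * k) = k"
      if "q \<noteq> 0" "q = a * d - b * c" for h k q
      using that(1) by (simp_all add: divide_simps) (simp_all add: that(2) algebra_simps)
    show "(\<lambda>(h, k). (a * h + b * k, c * h + d * k)) \<circ>
        (\<lambda>(h, k). (d / ?q * h + (- b / ?q) * k, (- c / ?q) * h + a / ?q * k)) = id"
    proof
      fix p :: "complex \<times> complex"
      obtain h k where "p = (h, k)" by (cases p)
      then show "((\<lambda>(h, k). (a * h + b * k, c * h + d * k)) \<circ>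
          (\<lambda>(h, k). (d / ?q * h + (- b / ?q) * k, (- c / ?q) * h + a / ?q * k))) p = id p"
        using *[OF d(2) refl] by (simp only: o_apply prod.case id_apply)
    qed
  qed (use x inj in auto)
  then have "complex_derivative2 (inv_into N G) (d / ?q) (- b / ?q) (- c / ?q) (a / ?q) (G (\<phi> x))"
    unfolding complex_derivative2_def .
  then have 2: "complex_derivative2 (transition ?V (G \<circ> \<phi>) \<phi>) (d / ?q) (- b / ?q) (- c / ?q) (a / ?q) (G (\<phi> x))"
  proof (rule complex_derivative2_cong[OF _ oG])
    show "G (\<phi> x) \<in> G ` N" using x by auto
    fix y assume "y \<in> G ` N"
    then obtain v where v: "v \<in> ?V" "y = (G \<circ> \<phi>) v" unfolding im2[symmetric] by (rule imageE)
    have "inv_into N G (G (\<phi> v)) = \<phi> v" using v(1) by (intro inv_into_f_f[OF inj]) auto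
    moreover have "transition ?V (G \<circ> \<phi>) \<phi> ((G \<circ> \<phi>) v) = \<phi> v"
      by (rule transition_apply[OF topological_chartD(3)[OF cG] v(1)])
    ultimately show "inv_into N G y = transition ?V (G \<circ> \<phi>) \<phi> y"
      unfolding v(2) by simp
  qed
  have "holo_transition_at ?V (G \<circ> \<phi>) \<phi> x"
    using 2 unfolding holo_transition_at_def by auto
  moreover have "holo_transition_at U \<phi> (G \<circ> \<phi>) x"
    using 1 unfolding holo_transition_at_def by auto
  ultimately show "\<exists>V' \<psi>. local_coords X A V' \<psi> \<and> x \<in> V' \<and>
        holo_transition_at ?V (G \<circ> \<phi>) \<psi> x \<and> holo_transition_at V' \<psi> (G \<circ> \<phi>) x"
    using U x by blast
qed

section \<open>Coordinates adapted to the divisor\<close>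

lemma flat_coords_restrict:
  assumes "complex_surface X A" "flat_coords X A D U \<phi>" "openin X V" "V \<subseteq> U"
  shows "flat_coords X A D V \<phi>"
  using assms local_coords_restrict[OF assms(1) _ assms(3,4)] unfolding flat_coords_def by blast

lemma crossing_coords_restrict:
  assumes "complex_surface X A" "crossing_coords X A D U \<phi>" "openin X V" "V \<subseteq> U"
  shows "crossing_coords X A D V \<phi>"
  using assms local_coords_restrict[OF assms(1) _ assms(3,4)] unfolding crossing_coords_def by blast

text \<open>The local equation of \<open>C'\<close>, read in the coordinates \<open>\<phi>\<close>,
  is taken as the first coordinate, and that of \<open>C\<close> is kept as the second. The Jacobian
  determinant is then the entry \<open>c\<close> whose nonvanishing is transversality.\<close>

lemma transversal_crossing_coords:
  assumes S: "complex_surface X A" and t: "transversal_at X A C C' x"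
  shows "\<exists>U \<phi>. crossing_coords X A (C \<union> C') U \<phi> \<and> x \<in> U"
proof -
  obtain U \<phi> V \<psi> a b c d where U: "flat_coords X A C U \<phi>" and V: "flat_coords X A C' V \<psi>"
    and x: "x \<in> U \<inter> V"
    and der0: "complex_derivative2 (transition U \<phi> \<psi>) a b c d (\<phi> x)" and c: "c \<noteq> 0"
    using t unfolding transversal_at_def by blast
  have lU: "local_coords X A U \<phi>" and lV: "local_coords X A V \<psi>"
    using U V by (auto simp: flat_coords_def)
  note cU = local_coords_chart[OF lU] and cV = local_coords_chart[OF lV]
  have oUV: "openin X (U \<inter> V)"
    using topological_chartD(1)[OF cU] topological_chartD(1)[OF cV] by auto
  let ?S = "\<phi> ` (U \<inter> V)" and ?T = "transition U \<phi> \<psi>"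
  have oS: "open ?S"
    by (rule topological_chartD(4)[OF topological_chart_restrict[OF cU oUV]]) auto
  have "\<forall>p\<in>?S. \<exists>a b c d. complex_derivative2 ?T a b c d p"
    using local_coords_holo_transition[OF S lU lV] unfolding holo_transition_at_def by auto
  then obtain ja jb jc jd where J: "\<And>p. p \<in> ?S \<Longrightarrow> complex_derivative2 ?T (ja p) (jb p) (jc p) (jd p) p"
    by metis
  have "jc (\<phi> x) = c" using complex_derivative2_unique[OF J der0] x by auto
  define F where "F = (\<lambda>p. snd (?T p))"
  have derF: "(F has_derivative (\<lambda>(h, k). jc p * h + jd p * k)) (at p)" if "p \<in> ?S" for p
    unfolding F_def
    by (rule has_derivative_eq_rhs[OF has_derivative_snd[OF J[OF that, unfolded complex_derivative2_def]]])
      auto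
  obtain N where N: "open N" "\<phi> x \<in> N" "N \<subseteq> ?S" "\<forall>p\<in>N. jc p \<noteq> 0" "inj_on (\<lambda>p. (F p, snd p)) N"
    using inj_on_pair_snd_of_derivative_nonzero[OF oS _ derF, of "\<phi> x"] x \<open>jc (\<phi> x) = c\<close> c by auto
  let ?G = "\<lambda>p. (F p, snd p)" and ?V = "{y \<in> U. \<phi> y \<in> N}"
  have loc: "local_coords X A ?V (?G \<circ> \<phi>)"
  proof (rule local_coords_compose[OF S lU N(1) _ N(5)])
    show "N \<subseteq> \<phi> ` U" using N(3) by auto
    fix p assume p: "p \<in> N"
    then have "p \<in> ?S" using N by auto
    have "complex_derivative2 ?G (jc p) (jd p) 0 1 p"
      unfolding complex_derivative2_def
      by (rule has_derivative_eq_rhs[OF has_derivative_Pair[OF derF[OF \<open>p \<in> ?S\<close>] has_derivative_snd[OF has_derivative_ident]]])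
        auto
    then show "\<exists>a b c d. complex_derivative2 ?G a b c d p \<and> a * d - b * c \<noteq> 0"
      using N(4) p by force
  qed
  have "?V \<subseteq> V"
  proof
    fix y assume y: "y \<in> ?V"
    then obtain v where "v \<in> U \<inter> V" "\<phi> y = \<phi> v" using N(3) by auto
    then show "y \<in> V" using y topological_chartD(3)[OF cU] by (auto dest: inj_onD)
  qed
  moreover have "F (\<phi> y) = snd (\<psi> y)" if "y \<in> U" for y
    using that topological_chartD(3)[OF cU] by (simp add: F_def transition_apply)
  moreover have "y \<in> C \<longleftrightarrow> snd (\<phi> y) = 0" if "y \<in> U" for y
    using U that unfolding flat_coords_def by blast
  moreover have "y \<in> C' \<longleftrightarrow> snd (\<psi> y) = 0" if "y \<in> V" for y
    using V that unfolding flat_coords_def by blast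
  ultimately have "(C \<union> C') \<inter> ?V = {y \<in> ?V. fst ((?G \<circ> \<phi>) y) * snd ((?G \<circ> \<phi>) y) = 0}"
    by auto
  with loc have "crossing_coords X A (C \<union> C') ?V (?G \<circ> \<phi>)"
    unfolding crossing_coords_def by blast
  moreover have "x \<in> ?V" using x N by auto
  ultimately show ?thesis by blast
qed

text \<open>By local finiteness the curves missing \<open>x\<close> can be removed from a
  neighbourhood, where only the one or two curves through \<open>x\<close> are left.\<close>

lemma normal_crossings_cases:
  assumes S: "complex_surface X A" and D: "normal_crossings_divisor X A D" and x: "x \<in> D"
  shows "(\<exists>U \<phi>. flat_coords X A D U \<phi> \<and> x \<in> U) \<or> (\<exists>U \<phi>. crossing_coords X A D U \<phi> \<and> x \<in> U)"
proof -
  obtain \<C> where DC: "D = \<Union>\<C>" and lf: "locally_finite_in X \<C>"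
    and sm: "\<And>C. C \<in> \<C> \<Longrightarrow> smooth_curve X A C"
    and tr: "\<And>C C' x. C \<in> \<C> \<Longrightarrow> C' \<in> \<C> \<Longrightarrow> C \<noteq> C' \<Longrightarrow> x \<in> C \<inter> C' \<Longrightarrow> transversal_at X A C C' x"
    and two: "card {C\<in>\<C>. x \<in> C} \<le> 2"
    using D unfolding normal_crossings_divisor_def by metis
  have "x \<in> topspace X" using lf x DC unfolding locally_finite_in_def by auto
  then obtain V0 where V0: "openin X V0" "x \<in> V0" "finite {C \<in> \<C>. C \<inter> V0 \<noteq> {}}"
    using lf unfolding locally_finite_in_def by blast
  define \<C>0 where "\<C>0 = {C \<in> \<C>. C \<inter> V0 \<noteq> {} \<and> x \<notin> C}"
  have fin0: "finite \<C>0" by (rule finite_subset[OF _ V0(3)]) (auto simp: \<C>0_def)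
  \<comment> \<open>Finiteness comes from local finiteness: the bound on \<open>card\<close> alone
    would admit an infinite set, whose \<open>card\<close> is 0.\<close>
  have finx: "finite {C\<in>\<C>. x \<in> C}" by (rule finite_subset[OF _ V0(3)]) (use V0 in auto)
  define V1 where "V1 = V0 - \<Union>\<C>0"
  have "closedin X (\<Union>\<C>0)"
    using fin0 sm by (intro closedin_Union) (auto simp: \<C>0_def smooth_curve_def)
  then have V1: "openin X V1" unfolding V1_def by (rule openin_diff[OF V0(1)])
  have xV1: "x \<in> V1" using V0(2) unfolding V1_def \<C>0_def by blast
  have DV1: "D \<inter> V = \<Union>{C\<in>\<C>. x \<in> C} \<inter> V" if "V \<subseteq> V1" for V
    using that unfolding DC V1_def \<C>0_def by blast
  obtain C where C: "C \<in> \<C>" "x \<in> C" using x DC by auto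
  show ?thesis
  proof (cases "{C\<in>\<C>. x \<in> C} = {C}")
    case True
    obtain U \<phi> where U: "flat_coords X A C U \<phi>" "x \<in> U"
      using sm[OF C(1)] C(2) unfolding smooth_curve_def ordinary_point_def by blast
    let ?V = "U \<inter> V1"
    have "openin X U" using U topological_chartD(1)[OF local_coords_chart] by (auto simp: flat_coords_def)
    then have "flat_coords X A C ?V \<phi>"
      using V1 by (intro flat_coords_restrict[OF S U(1)]) auto
    then have "flat_coords X A D ?V \<phi>"
      unfolding flat_coords_def using DV1[of ?V] True by auto
    then show ?thesis using U xV1 by blast
  next
    case False
    then obtain C' where C': "C' \<in> \<C>" "x \<in> C'" "C \<noteq> C'" using C by blast
    have "{C, C'} = {C\<in>\<C>. x \<in> C}"
      by (rule card_subset_eq[OF finx]) (use C C' two finx card_mono[OF finx, of "{C, C'}"] in auto)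
    then have *: "\<Union>{C\<in>\<C>. x \<in> C} = C \<union> C'" by auto
    obtain U \<phi> where U: "crossing_coords X A (C \<union> C') U \<phi>" "x \<in> U"
      using transversal_crossing_coords[OF S tr[OF C(1) C'(1)]] C C' by blast
    let ?V = "U \<inter> V1"
    have "openin X U" using U topological_chartD(1)[OF local_coords_chart] by (auto simp: crossing_coords_def)
    then have "crossing_coords X A (C \<union> C') ?V \<phi>"
      using V1 by (intro crossing_coords_restrict[OF S U(1)]) auto
    then have "crossing_coords X A D ?V \<phi>"
      unfolding crossing_coords_def using DV1[of ?V] * by auto
    then show ?thesis using U xV1 by blast
  qed
qed

section \<open>Local models of the real oriented blow-up\<close>

lemma cmod_mult_sgn: "of_real (cmod z) * sgn z = (z::complex)"
  by (simp add: sgn_eq)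

lemma cmod_sgn: "z \<noteq> 0 \<Longrightarrow> cmod (sgn z) = 1"
  by (simp add: norm_sgn)

lemma sgn_of_real_mult: "0 < s \<Longrightarrow> cmod t = 1 \<Longrightarrow> sgn (of_real s * t) = (t::complex)"
  by (simp add: sgn_mult sgn_of_real) (simp add: sgn_eq)

lemma mem_closure_seq:
  fixes f :: "nat \<Rightarrow> 'a::first_countable_topology"
  assumes "f \<longlonglongrightarrow> l" "eventually (\<lambda>n. f n \<in> S) sequentially"
  shows "l \<in> closure S"
  by (rule Lim_in_closed_set[OF closed_closure _ _ assms(1)])
    (use assms(2) closure_subset[of S] in \<open>auto elim: eventually_mono\<close>)

lemma of_real_inverse_Suc_nonzero: "of_real (inverse (real (Suc n))) \<noteq> (0::complex)"
  by (simp only: of_real_eq_0_iff) simp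

text \<open>Nonzero points tending to \<open>w\<close> with direction \<open>t\<close>. Over
  \<open>w = 0\<close> any direction is reached along its ray; elsewhere the sequence is constant,
  \<open>t\<close> being already the direction of \<open>w\<close>.\<close>

definition approach :: "complex \<Rightarrow> complex \<Rightarrow> nat \<Rightarrow> complex" where
  "approach w t n = (if w = 0 then of_real (inverse (real (Suc n))) * t else w)"

lemma approach:
  assumes "cmod t = 1" "w = of_real (cmod w) * t"
  shows "approach w t n \<noteq> 0" "sgn (approach w t n) = t" "approach w t \<longlonglongrightarrow> w"
proof -
  have w: "sgn w = t" if "w \<noteq> 0"
    using assms sgn_of_real_mult[of "cmod w" t] that by simp
  have s: "0 < inverse (real (Suc n))" by simp
  show "approach w t n \<noteq> 0" 
    using assms(1) of_real_inverse_Suc_nonzero[of n] unfolding approach_def by (auto simp del: of_nat_Suc)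
  show "sgn (approach w t n) = t"
    using w sgn_of_real_mult[OF s assms(1)] by (simp add: approach_def)
  show "approach w t \<longlonglongrightarrow> w"
  proof (cases "w = 0")
    case True
    have "(\<lambda>n. of_real (inverse (real (Suc n))) * t) \<longlonglongrightarrow> of_real 0 * t"
      by (intro tendsto_intros LIMSEQ_inverse_real_of_nat)
    then show ?thesis using True by (simp add: approach_def[abs_def])
  qed (simp add: approach_def[abs_def])
qed

text \<open>The polar relation between \<open>snd w\<close> and \<open>t\<close> is closed and holds
  on the graph, which gives one inclusion. Conversely it fixes \<open>t\<close> off the divisor and
  leaves it free on the divisor, where \<open>approach\<close> exhibits each point as a
  limit.\<close>

lemma flat_model_eq:
  assumes V: "open V"
  shows "flat_model V = {(w, t). w \<in> V \<and> cmod t = 1 \<and> snd w = of_real (cmod (snd w)) * t}"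
    (is "_ = ?R")
proof
  let ?G = "{(w, t). w \<in> V \<and> snd w \<noteq> 0 \<and> t = sgn (snd w)}"
  let ?C = "{p::(complex \<times> complex) \<times> complex. snd (fst p) = of_real (cmod (snd (fst p))) * snd p}"
  have "closed ?C"
    by (intro closed_Collect_eq continuous_intros)
  moreover have "?G \<subseteq> ?C" by (auto simp: cmod_mult_sgn)
  ultimately have "closure ?G \<subseteq> ?C" by (rule closure_minimal[rotated])
  then show "flat_model V \<subseteq> ?R" unfolding flat_model_def by auto
  show "?R \<subseteq> flat_model V"
  proof clarify
    fix w1 w2 t assume *: "(w1, w2) \<in> V" "cmod t = 1" "snd (w1, w2) = of_real (cmod (snd (w1, w2))) * t"
    let ?f = "\<lambda>n. ((w1, approach w2 t n), t)"
    have a: "approach w2 t n \<noteq> 0" "sgn (approach w2 t n) = t" "approach w2 t \<longlonglongrightarrow> w2" for n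
      using approach[of t w2] * by auto
    have "(\<lambda>n. (w1, approach w2 t n)) \<longlonglongrightarrow> (w1, w2)" by (intro tendsto_intros a)
    then have "eventually (\<lambda>n. (w1, approach w2 t n) \<in> V) sequentially"
      using V *(1) by (rule topological_tendstoD)
    then have "eventually (\<lambda>n. ?f n \<in> ?G) sequentially"
      by eventually_elim (use a in auto)
    moreover have "?f \<longlonglongrightarrow> ((w1, w2), t)" by (intro tendsto_intros a)
    ultimately have "((w1, w2), t) \<in> closure ?G" by (rule mem_closure_seq[rotated])
    then show "((w1, w2), t) \<in> flat_model V" unfolding flat_model_def using * by auto
  qed
qed

lemma crossing_model_eq:
  assumes V: "open V"
  shows "crossing_model V = {(w, t1, t2). w \<in> V \<and> cmod t1 = 1 \<and> cmod t2 = 1 \<and>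
    fst w = of_real (cmod (fst w)) * t1 \<and> snd w = of_real (cmod (snd w)) * t2}"
    (is "_ = ?R")
proof
  let ?G = "{(w, t1, t2). w \<in> V \<and> fst w * snd w \<noteq> 0 \<and> t1 = sgn (fst w) \<and> t2 = sgn (snd w)}"
  let ?C = "{p::(complex \<times> complex) \<times> complex \<times> complex.
    fst (fst p) = of_real (cmod (fst (fst p))) * fst (snd p)} \<inter>
    {p. snd (fst p) = of_real (cmod (snd (fst p))) * snd (snd p)}"
  have "closed ?C"
    by (intro closed_Int closed_Collect_eq continuous_intros)
  moreover have "?G \<subseteq> ?C" by (auto simp: cmod_mult_sgn)
  ultimately have "closure ?G \<subseteq> ?C" by (rule closure_minimal[rotated])
  then show "crossing_model V \<subseteq> ?R" unfolding crossing_model_def by auto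
  show "?R \<subseteq> crossing_model V"
  proof clarify
    fix w1 w2 t1 t2 assume *: "(w1, w2) \<in> V" "cmod t1 = 1" "cmod t2 = 1"
      "fst (w1, w2) = of_real (cmod (fst (w1, w2))) * t1"
      "snd (w1, w2) = of_real (cmod (snd (w1, w2))) * t2"
    let ?w = "\<lambda>n. (approach w1 t1 n, approach w2 t2 n)"
    let ?f = "\<lambda>n. (?w n, t1, t2)"
    have a: "approach w1 t1 n \<noteq> 0" "sgn (approach w1 t1 n) = t1" "approach w1 t1 \<longlonglongrightarrow> w1"
       "approach w2 t2 n \<noteq> 0" "sgn (approach w2 t2 n) = t2" "approach w2 t2 \<longlonglongrightarrow> w2" for n
      using approach[of t1 w1] approach[of t2 w2] * by auto
    have "?w \<longlonglongrightarrow> (w1, w2)" by (intro tendsto_intros a)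
    then have "eventually (\<lambda>n. ?w n \<in> V) sequentially"
      using V *(1) by (rule topological_tendstoD)
    then have "eventually (\<lambda>n. ?f n \<in> ?G) sequentially"
      by eventually_elim (use a in auto)
    moreover have "?f \<longlonglongrightarrow> ((w1, w2), t1, t2)" by (intro tendsto_intros a)
    ultimately have "((w1, w2), t1, t2) \<in> closure ?G" by (rule mem_closure_seq[rotated])
    then show "((w1, w2), t1, t2) \<in> crossing_model V" unfolding crossing_model_def using * by auto
  qed
qed

section \<open>Model coordinates and density of the complement of the divisor\<close>

lemma blowup_coordsD:
  assumes "blowup_coords B \<rho> U \<phi> M \<Phi>"
  shows "\<And>b. b \<in> topspace B \<Longrightarrow> \<rho> b \<in> U \<Longrightarrow> \<Phi> b \<in> M"
    "\<And>b. b \<in> topspace B \<Longrightarrow> \<rho> b \<in> U \<Longrightarrow> fst (\<Phi> b) = \<phi> (\<rho> b)"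
    "\<And>m. m \<in> M \<Longrightarrow> \<exists>b\<in>topspace B. \<rho> b \<in> U \<and> \<Phi> b = m"
    "inj_on \<Phi> {b \<in> topspace B. \<rho> b \<in> U}"
    "continuous_map (subtopology B {b \<in> topspace B. \<rho> b \<in> U}) euclidean \<Phi>"
    "homeomorphic_map (subtopology B {b \<in> topspace B. \<rho> b \<in> U}) (top_of_set M) \<Phi>"
proof -
  let ?P = "{b \<in> topspace B. \<rho> b \<in> U}"
  show h: "homeomorphic_map (subtopology B ?P) (top_of_set M) \<Phi>"
    using assms by (simp add: blowup_coords_def)
  have t: "topspace (subtopology B ?P) = ?P" by auto
  have im: "\<Phi> ` ?P = M"
    using homeomorphic_imp_surjective_map[OF h] unfolding t by simp
  show "\<And>b. b \<in> topspace B \<Longrightarrow> \<rho> b \<in> U \<Longrightarrow> \<Phi> b \<in> M" using im by blast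
  show "\<And>m. m \<in> M \<Longrightarrow> \<exists>b\<in>topspace B. \<rho> b \<in> U \<and> \<Phi> b = m" using im by blast
  show "inj_on \<Phi> ?P" using homeomorphic_imp_injective_map[OF h] unfolding t .
  show "continuous_map (subtopology B ?P) euclidean \<Phi>"
    using homeomorphic_imp_continuous_map[OF h] by (simp add: continuous_map_in_subtopology)
  show "\<And>b. b \<in> topspace B \<Longrightarrow> \<rho> b \<in> U \<Longrightarrow> fst (\<Phi> b) = \<phi> (\<rho> b)"
    using assms by (simp add: blowup_coords_def)
qed

lemma blowup_coords_restrict:
  assumes c: "blowup_coords B \<rho> U \<phi> M \<Phi>" and V: "V \<subseteq> U"
    and inj: "inj_on \<phi> U" and M': "M' = {m \<in> M. fst m \<in> \<phi> ` V}"
  shows "blowup_coords B \<rho> V \<phi> M' \<Phi>"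
proof -
  note D = blowup_coordsD[OF c]
  let ?P = "{b \<in> topspace B. \<rho> b \<in> U}" and ?Q = "{b \<in> topspace B. \<rho> b \<in> V}"
  have "homeomorphic_map (subtopology (subtopology B ?P) ?Q)
      (subtopology (top_of_set M) M') \<Phi>"
  proof (rule homeomorphic_map_subtopologies_alt[OF D(6)])
    fix b assume "b \<in> topspace (subtopology B ?P)" "\<Phi> b \<in> topspace (top_of_set M)"
    then show "\<Phi> b \<in> M' \<longleftrightarrow> b \<in> ?Q"
      using D(2) V inj by (auto simp: M' inj_on_def)
  qed
  moreover have "?P \<inter> ?Q = ?Q" "M \<inter> M' = M'" using V M' by auto
  ultimately show ?thesis
    using D(2) V unfolding blowup_coords_def subtopology_subtopology by auto
qed

lemma flat_blowup_coords_restrict: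
  assumes "blowup_coords B \<rho> U \<phi> (flat_model (\<phi> ` U)) \<Phi>" "topological_chart X U \<phi>"
    and V: "openin X V" "V \<subseteq> U"
  shows "blowup_coords B \<rho> V \<phi> (flat_model (\<phi> ` V)) \<Phi>"
  using V(2) topological_chartD(3,4)[OF assms(2)]
    topological_chartD(4)[OF topological_chart_restrict[OF assms(2) V]]
  by (intro blowup_coords_restrict[OF assms(1)]) (auto simp: flat_model_eq)

text \<open>The homeomorphism \<open>\<Phi>\<close> transports closures, so density of the graph
  \<open>G\<close> in the model becomes density in the blow-up.\<close>

lemma blowup_coords_dense:
  assumes c: "blowup_coords B \<rho> U \<phi> M \<Phi>" and b: "b \<in> topspace B" "\<rho> b \<in> U"
    and G: "M \<subseteq> closure G" "\<And>m. m \<in> G \<Longrightarrow> m \<in> M" "\<And>b. b \<in> topspace B \<Longrightarrow> \<rho> b \<in> U \<Longrightarrow> \<Phi> b \<in> G \<Longrightarrow> \<rho> b \<notin> D"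
  shows "b \<in> B closure_of {b \<in> topspace B. \<rho> b \<notin> D}"
proof -
  let ?P = "{b \<in> topspace B. \<rho> b \<in> U}"
  let ?S = "{b \<in> ?P. \<Phi> b \<in> G}"
  note D = blowup_coordsD[OF c]
  have im: "\<Phi> ` ?S = G"
  proof
    show "G \<subseteq> \<Phi> ` ?S"
    proof
      fix m assume m: "m \<in> G"
      then obtain b1 where "b1 \<in> topspace B" "\<rho> b1 \<in> U" "\<Phi> b1 = m" using D(3) G(2) by blast
      then show "m \<in> \<Phi> ` ?S" using m by blast
    qed
  qed blast
  have "top_of_set M closure_of (\<Phi> ` ?S) = \<Phi> ` (subtopology B ?P closure_of ?S)"
    by (rule homeomorphic_map_closure_of[OF D(6)]) auto
  moreover have "M \<inter> G = G" using G(2) by blast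
  then have "\<Phi> b \<in> top_of_set M closure_of G"
    using subsetD[OF G(1) D(1)[OF b]] D(1)[OF b] unfolding closure_of_subtopology by simp
  ultimately have "\<Phi> b \<in> \<Phi> ` (subtopology B ?P closure_of ?S)" unfolding im by simp
  then obtain b' where b': "b' \<in> subtopology B ?P closure_of ?S" "\<Phi> b = \<Phi> b'"
    by (rule imageE)
  then have "b' \<in> ?P" using closure_of_subset_topspace[of "subtopology B ?P" ?S] by auto
  then have "b = b'" using b' b D(4) by (auto simp: inj_on_def)
  then have "b \<in> B closure_of ?S" using subsetD[OF closure_of_subtopology_subset b'(1)] by simp
  moreover have "?S \<subseteq> {b \<in> topspace B. \<rho> b \<notin> D}" using G(3) by auto
  ultimately show ?thesis using closure_of_mono by blast
qed

text \<open>Density is built into the models, which are closures of graphs over the complement of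
  \<open>D\<close>; the hypothesis \<open>cases\<close> provides a model at every point of
  \<open>D\<close>.\<close>

lemma real_oriented_blowup_dense:
  assumes B: "real_oriented_blowup X A D B \<rho>"
    and cases: "\<And>x. x \<in> D \<Longrightarrow> (\<exists>U \<phi>. flat_coords X A D U \<phi> \<and> x \<in> U) \<or>
        (\<exists>U \<phi>. crossing_coords X A D U \<phi> \<and> x \<in> U)"
    and b: "b \<in> topspace B"
  shows "b \<in> B closure_of {b \<in> topspace B. \<rho> b \<notin> D}"
proof (cases "\<rho> b \<in> D")
  case False
  then show ?thesis
    using b closure_of_subset[of "{b \<in> topspace B. \<rho> b \<notin> D}" B] by auto
next
  case True
  from cases[OF this] show ?thesis
  proof (elim disjE exE conjE)
    fix U \<phi> assume U: "flat_coords X A D U \<phi>" "\<rho> b \<in> U"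
    obtain \<Phi> where \<Phi>: "blowup_coords B \<rho> U \<phi> (flat_model (\<phi> ` U)) \<Phi>"
      using B U unfolding real_oriented_blowup_def by blast
    have o: "open (\<phi> ` U)" using U topological_chartD(4)[OF local_coords_chart] unfolding flat_coords_def by blast
    let ?G = "{(w, t). w \<in> \<phi> ` U \<and> snd w \<noteq> 0 \<and> t = sgn (snd w)}"
    show ?thesis
    proof (rule blowup_coords_dense[OF \<Phi> b U(2)])
      show "flat_model (\<phi> ` U) \<subseteq> closure ?G" unfolding flat_model_def by blast
      show "m \<in> flat_model (\<phi> ` U)" if "m \<in> ?G" for m
        using that by (auto simp: flat_model_eq[OF o] cmod_sgn cmod_mult_sgn)
      fix b' assume b': "b' \<in> topspace B" "\<rho> b' \<in> U" "\<Phi> b' \<in> ?G"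
      then show "\<rho> b' \<notin> D"
        using blowup_coordsD(2)[OF \<Phi> b'(1,2)] U(1) unfolding flat_coords_def by auto
    qed
  next
    fix U \<phi> assume U: "crossing_coords X A D U \<phi>" "\<rho> b \<in> U"
    obtain \<Phi> where \<Phi>: "blowup_coords B \<rho> U \<phi> (crossing_model (\<phi> ` U)) \<Phi>"
      using B U unfolding real_oriented_blowup_def by blast
    have o: "open (\<phi> ` U)" using U topological_chartD(4)[OF local_coords_chart] unfolding crossing_coords_def by blast
    let ?G = "{(w, t1, t2). w \<in> \<phi> ` U \<and> fst w * snd w \<noteq> 0 \<and> t1 = sgn (fst w) \<and> t2 = sgn (snd w)}"
    show ?thesis
    proof (rule blowup_coords_dense[OF \<Phi> b U(2)])
      show "crossing_model (\<phi> ` U) \<subseteq> closure ?G" unfolding crossing_model_def by blast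
      show "m \<in> crossing_model (\<phi> ` U)" if "m \<in> ?G" for m
        using that by (auto simp: crossing_model_eq[OF o] cmod_sgn cmod_mult_sgn)
      fix b' assume b': "b' \<in> topspace B" "\<rho> b' \<in> U" "\<Phi> b' \<in> ?G"
      then show "\<rho> b' \<notin> D"
        using blowup_coordsD(2)[OF \<Phi> b'(1,2)] U(1) unfolding crossing_coords_def by auto
    qed
  qed
qed

text \<open>Openness of \<open>O'\<close> lets density pass from \<open>B\<close> to the
  subspace.\<close>

lemma eq_on_open_of_dense:
  assumes dense: "\<And>b. b \<in> topspace B \<Longrightarrow> b \<in> B closure_of E" and O: "openin B O'" and Y: "Hausdorff_space Y"
    and f: "continuous_map (subtopology B O') Y f" and g: "continuous_map (subtopology B O') Y g"
    and eq: "\<And>b. b \<in> O' \<Longrightarrow> b \<in> E \<Longrightarrow> f b = g b" and b: "b \<in> O'"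
  shows "f b = g b"
proof (rule forall_in_closure_of_eq[OF _ Y f g])
  have "b \<in> O' \<inter> B closure_of E" using b dense openin_subset[OF O] by blast
  then have "b \<in> O' \<inter> B closure_of (O' \<inter> E)" using openin_Int_closure_of_eq[OF O] by blast
  then show "b \<in> subtopology B O' closure_of (O' \<inter> E)" by (simp add: closure_of_subtopology)
qed (use eq in auto)

section \<open>Independence of coordinates\<close>

text \<open>Makes the second row of a Jacobian computable along the coordinate axes, which are the
  branches of the divisor.\<close>

lemma complex_derivative2_slice:
  assumes d: "complex_derivative2 f a b c d p"
  shows "((\<lambda>h. snd (f (p + (h, 0)))) has_field_derivative c) (at 0)"
    "((\<lambda>h. snd (f (p + (0, h)))) has_field_derivative d) (at 0)"
proof -
  have 1: "((\<lambda>h. p + (h, 0)) has_derivative (\<lambda>h. (h, 0))) (at (0::complex))"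
    and 2: "((\<lambda>h. p + (0, h)) has_derivative (\<lambda>h. (0, h))) (at (0::complex))"
    by (auto intro!: derivative_eq_intros)
  have f1: "(f has_derivative (\<lambda>(h, k). (a * h + b * k, c * h + d * k))) (at (p + (0, 0)))"
    using d by (simp add: complex_derivative2_def zero_prod_def[symmetric])
  show "((\<lambda>h. snd (f (p + (h, 0)))) has_field_derivative c) (at 0)"
    using has_derivative_snd[OF diff_chain_at[OF 1 f1]]
    by (simp add: has_field_derivative_def o_def)
  show "((\<lambda>h. snd (f (p + (0, h)))) has_field_derivative d) (at 0)"
    using has_derivative_snd[OF diff_chain_at[OF 2 f1]]
    by (simp add: has_field_derivative_def o_def)
qed

lemma eventually_add_in_open:
  assumes "open S" "p \<in> S"
  shows "eventually (\<lambda>h. p + (h, 0::complex) \<in> S) (nhds (0::complex))"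
    "eventually (\<lambda>h. p + (0::complex, h) \<in> S) (nhds (0::complex))"
proof -
  have "((\<lambda>h. p + (h, 0::complex)) \<longlongrightarrow> p + (0, 0)) (nhds (0::complex))"
    "((\<lambda>h. p + (0::complex, h)) \<longlongrightarrow> p + (0, 0)) (nhds (0::complex))"
    by (intro tendsto_intros filterlim_ident)+
  then show "eventually (\<lambda>h. p + (h, 0::complex) \<in> S) (nhds (0::complex))"
    "eventually (\<lambda>h. p + (0::complex, h) \<in> S) (nhds (0::complex))"
    using assms by (auto simp: zero_prod_def[symmetric] dest: topological_tendstoD)
qed

lemma derivative_zero_of_eventually_zero:
  fixes f :: "complex \<Rightarrow> complex"
  assumes "(f has_field_derivative c) (at 0)" "eventually (\<lambda>h. f h = 0) (nhds 0)"
  shows "c = 0"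
proof -
  have "((\<lambda>_. 0) has_field_derivative c) (at 0)"
    using assms(1) DERIV_cong_ev[OF refl assms(2) refl] by simp
  then show ?thesis using DERIV_const DERIV_unique by blast
qed

text \<open>In flat coordinates the second coordinate would vanish along both axes, so the second
  row of the transition Jacobian would be zero.\<close>

lemma crossing_point_not_ordinary:
  assumes S: "complex_surface X A" and U: "crossing_coords X A D U \<phi>" and x: "x \<in> U" "\<phi> x = (0, 0)"
  shows "\<not> ordinary_point X A D x"
proof
  assume "ordinary_point X A D x"
  then obtain V \<psi> where V: "flat_coords X A D V \<psi>" "x \<in> V" unfolding ordinary_point_def by blast
  have lU: "local_coords X A U \<phi>" and lV: "local_coords X A V \<psi>"
    using U V by (auto simp: flat_coords_def crossing_coords_def)
  note cU = topological_chartD[OF local_coords_chart[OF lU]]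
    and cV = topological_chartD[OF local_coords_chart[OF lV]]
  let ?T = "transition U \<phi> \<psi>" and ?S = "\<phi> ` (U \<inter> V)"
  obtain a b c d where d: "complex_derivative2 ?T a b c d (\<phi> x)"
    using local_coords_holo_transition[OF S lU lV] x V unfolding holo_transition_at_def by blast
  have "open ?S"
    by (rule topological_chartD(4)[OF topological_chart_restrict[OF local_coords_chart[OF lU]]])
      (use cU cV in auto)
  note ev = eventually_add_in_open[OF this, of "\<phi> x"]
  have xS: "(0, 0) \<in> ?S" using x V by (metis IntI image_eqI)
  have 0: "snd (?T p) = 0" if p: "p \<in> ?S" "fst p * snd p = 0" for p
  proof -
    obtain y where y: "y \<in> U \<inter> V" "p = \<phi> y" using p by auto
    then have "y \<in> D" using U p unfolding crossing_coords_def by blast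
    then have "snd (\<psi> y) = 0" using V y unfolding flat_coords_def by blast
    then show ?thesis using y cU(3) by (simp add: transition_apply)
  qed
  have "eventually (\<lambda>h. snd (?T (\<phi> x + (h, 0))) = 0) (nhds 0)"
    by (rule eventually_mono[OF ev(1)]) (use x V 0 xS in auto)
  from derivative_zero_of_eventually_zero[OF complex_derivative2_slice(1)[OF d] this] have "c = 0" .
  moreover have "eventually (\<lambda>h. snd (?T (\<phi> x + (0, h))) = 0) (nhds 0)"
    by (rule eventually_mono[OF ev(2)]) (use x V 0 xS in auto)
  from derivative_zero_of_eventually_zero[OF complex_derivative2_slice(2)[OF d] this] have "d = 0" .
  ultimately show False
    using transition_derivative_second_row_nonzero[OF S lU lV _ d] x V by auto
qed

text \<open>Along \<open>(w\<^sub>1, s t)\<close>, \<open>s \<rightarrow> 0\<close>, the second component of the transition map is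
  \<open>d s t + o(s)\<close>, so the angle is rotated by the constant \<open>sgn d\<close>.\<close>

lemma flat_blowup_angle_change:
  assumes S: "complex_surface X A" and U: "flat_coords X A D U \<phi>" and V: "flat_coords X A D V \<psi>"
    and x: "x \<in> U \<inter> V" "x \<in> D"
    and \<Phi>0: "blowup_coords B \<rho> U \<phi> (flat_model (\<phi> ` U)) \<Phi>"
    and \<Psi>0: "blowup_coords B \<rho> V \<psi> (flat_model (\<psi> ` V)) \<Psi>"
  shows "\<exists>c. \<forall>b\<in>topspace B. \<rho> b = x \<longrightarrow> snd (\<Psi> b) = c * snd (\<Phi> b)"
proof -
  have lU: "local_coords X A U \<phi>" and lV: "local_coords X A V \<psi>"
    using U V by (auto simp: flat_coords_def)
  note cU = topological_chartD[OF local_coords_chart[OF lU]]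
    and cV = topological_chartD[OF local_coords_chart[OF lV]]
  let ?T = "transition U \<phi> \<psi>" and ?S = "\<phi> ` (U \<inter> V)" and ?W = "U \<inter> V"
  have oW: "openin X ?W" using cU cV by auto
  have oS: "open ?S" and oS': "open (\<psi> ` ?W)"
    using topological_chartD(4)[OF topological_chart_restrict[OF local_coords_chart[OF lU] oW]]
      topological_chartD(4)[OF topological_chart_restrict[OF local_coords_chart[OF lV] oW]] by auto
  have \<Phi>: "blowup_coords B \<rho> ?W \<phi> (flat_model ?S) \<Phi>"
    by (rule flat_blowup_coords_restrict[OF \<Phi>0 local_coords_chart[OF lU] oW]) auto
  have \<Psi>: "blowup_coords B \<rho> ?W \<psi> (flat_model (\<psi> ` ?W)) \<Psi>"
    by (rule flat_blowup_coords_restrict[OF \<Psi>0 local_coords_chart[OF lV] oW]) auto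
  obtain a b c d where der: "complex_derivative2 ?T a b c d (\<phi> x)"
    using local_coords_holo_transition[OF S lU lV] x unfolding holo_transition_at_def by blast
  note ev = eventually_add_in_open[OF oS, of "\<phi> x"]
  have \<phi>x: "snd (\<phi> x) = 0" using x U unfolding flat_coords_def by blast
  define w1 where "w1 = fst (\<phi> x)"
  have \<phi>x': "\<phi> x = (w1, 0)" using \<phi>x by (simp add: w1_def prod_eq_iff)
  have 0: "snd (?T p) = 0 \<longleftrightarrow> snd p = 0" if p: "p \<in> ?S" for p
  proof -
    obtain y where y: "y \<in> U \<inter> V" "p = \<phi> y" using p by auto
    then have "snd p = 0 \<longleftrightarrow> y \<in> D" using U p unfolding flat_coords_def by blast
    moreover have "snd (\<psi> y) = 0 \<longleftrightarrow> y \<in> D" using V y unfolding flat_coords_def by blast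
    ultimately show ?thesis using y cU(3) by (simp add: transition_apply)
  qed
  \<comment> \<open>The second component of the transition vanishes along the divisor, so its
    derivative in that direction is zero and \<open>d\<close> must be nonzero.\<close>
  have "eventually (\<lambda>h. snd (?T (\<phi> x + (h, 0))) = 0) (nhds 0)"
    by (rule eventually_mono[OF ev(1)]) (use x \<phi>x 0 in auto)
  from derivative_zero_of_eventually_zero[OF complex_derivative2_slice(1)[OF der] this] have "c = 0" .
  then have d: "d \<noteq> 0"
    using transition_derivative_second_row_nonzero[OF S lU lV _ der] x by auto
  have "snd (\<Psi> b) = sgn d * snd (\<Phi> b)" if b: "b \<in> topspace B" "\<rho> b = x" for b
  proof -
    define t where "t = snd (\<Phi> b)"
    have \<Phi>b: "\<Phi> b = ((w1, 0), t)"
      using blowup_coordsD(2)[OF \<Phi> b(1)] b(2) x \<phi>x' by (simp add: t_def prod_eq_iff)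
    have t: "cmod t = 1"
      using blowup_coordsD(1)[OF \<Phi> b(1)] b(2) x(1) \<Phi>b by (simp add: flat_model_eq[OF oS])
    let ?s = "\<lambda>n. of_real (inverse (real (Suc n))) * t"
    let ?m = "\<lambda>n. ((w1, ?s n), t)"
    have "(\<lambda>n. of_real (inverse (real (Suc n))) * t) \<longlonglongrightarrow> of_real 0 * t"
      by (intro tendsto_intros LIMSEQ_inverse_real_of_nat)
    then have s0: "?s \<longlonglongrightarrow> 0" by simp
    have sn: "?s n \<noteq> 0" for n
      using t of_real_inverse_Suc_nonzero[of n] by (auto simp del: of_nat_Suc)
    have m: "?m \<longlonglongrightarrow> \<Phi> b" unfolding \<Phi>b by (intro tendsto_intros s0)
    have evS: "eventually (\<lambda>n. (w1, ?s n) \<in> ?S) sequentially"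
    proof -
      have "eventually (\<lambda>h. \<phi> x + (0, h) \<in> ?S) (nhds 0)" using ev(2) x by auto
      from eventually_compose_filterlim[OF this s0] show ?thesis by (simp add: \<phi>x')
    qed
    \<comment> \<open>The map \<open>\<Psi> \<circ> \<Phi>'\<close> is continuous up to the boundary
      of the model, so the angle at \<open>b\<close> is the limit of angles off the divisor.\<close>
    obtain \<Phi>' where \<Phi>': "homeomorphic_maps (subtopology B {b \<in> topspace B. \<rho> b \<in> ?W})
        (top_of_set (flat_model ?S)) \<Phi> \<Phi>'"
      using blowup_coordsD(6)[OF \<Phi>] unfolding homeomorphic_map_maps by blast
    have cont: "continuous_on (flat_model ?S) (\<Psi> \<circ> \<Phi>')"
    proof -
      have "continuous_map (top_of_set (flat_model ?S)) (subtopology B {b \<in> topspace B. \<rho> b \<in> ?W}) \<Phi>'"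
        using \<Phi>' by (simp add: homeomorphic_maps_def)
      from continuous_map_compose[OF this blowup_coordsD(5)[OF \<Psi>]] show ?thesis by simp
    qed
    have evM: "eventually (\<lambda>n. ?m n \<in> flat_model ?S) sequentially"
      using evS
    proof eventually_elim
      case (elim n)
      have "cmod (?s n) = inverse (real (Suc n))"
        unfolding norm_mult norm_of_real t by simp
      then show ?case using elim t by (simp add: flat_model_eq[OF oS] del: of_nat_Suc)
    qed
    have "\<Phi> b \<in> flat_model ?S" using blowup_coordsD(1)[OF \<Phi> b(1)] b(2) x by auto
    then have "((\<Psi> \<circ> \<Phi>') \<longlongrightarrow> (\<Psi> \<circ> \<Phi>') (\<Phi> b)) (at (\<Phi> b) within flat_model ?S)"
      using cont unfolding continuous_on_def by blast
    then have "((\<lambda>n. (\<Psi> \<circ> \<Phi>') (?m n)) \<longlonglongrightarrow> (\<Psi> \<circ> \<Phi>') (\<Phi> b))"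
      by (rule filterlim_compose)
        (use m evM sn \<Phi>b in \<open>auto simp: filterlim_at\<close>)
    moreover have "\<Phi>' (\<Phi> b) = b" using \<Phi>' b x by (auto simp: homeomorphic_maps_def)
    ultimately have lim1: "(\<lambda>n. snd (\<Psi> (\<Phi>' (?m n)))) \<longlonglongrightarrow> snd (\<Psi> b)"
      by (auto intro: tendsto_snd)
    have "((\<lambda>h. snd (?T (\<phi> x + (0, h))) / h) \<longlongrightarrow> d) (at 0)"
      using complex_derivative2_slice(2)[OF der] 0[of "\<phi> x"] x \<phi>x
      by (simp add: has_field_derivative_iff zero_prod_def[symmetric])
    then have "(\<lambda>n. snd (?T (\<phi> x + (0, ?s n))) / ?s n) \<longlonglongrightarrow> d"
      by (rule filterlim_compose) (use s0 sn in \<open>auto simp: filterlim_at\<close>)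
    then have lim2: "(\<lambda>n. sgn (snd (?T (\<phi> x + (0, ?s n))) / ?s n) * t) \<longlonglongrightarrow> sgn d * t"
      using d by (intro tendsto_intros)
    have "eventually (\<lambda>n. snd (\<Psi> (\<Phi>' (?m n))) = sgn (snd (?T (\<phi> x + (0, ?s n))) / ?s n) * t) sequentially"
      using evS evM
    proof eventually_elim
      case (elim n)
      define b' where "b' = \<Phi>' (?m n)"
      have "\<Phi>' (?m n) \<in> topspace (subtopology B {b \<in> topspace B. \<rho> b \<in> ?W}) \<and> \<Phi> (\<Phi>' (?m n)) = ?m n"
        using \<Phi>' elim(2) unfolding homeomorphic_maps_def continuous_map_def by auto
      then have b': "b' \<in> topspace B" "\<rho> b' \<in> ?W" "\<Phi> b' = ?m n" by (auto simp: b'_def)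
      have *: "\<phi> (\<rho> b') = (w1, ?s n)"
        using blowup_coordsD(2)[OF \<Phi> b'(1,2)] unfolding b'(3) by simp
      have 1: "?T (w1, ?s n) = \<psi> (\<rho> b')"
        using b'(2) cU(3) * transition_apply[of \<phi> U "\<rho> b'" \<psi>] by simp
      have nz: "snd (\<psi> (\<rho> b')) \<noteq> 0" using 0[OF elim(1)] sn 1 by simp
      have "\<Psi> b' \<in> flat_model (\<psi> ` ?W)" "fst (\<Psi> b') = \<psi> (\<rho> b')"
        using blowup_coordsD(1,2)[OF \<Psi>] b' by auto
      then have "cmod (snd (\<Psi> b')) = 1" "snd (\<psi> (\<rho> b')) = of_real (cmod (snd (\<psi> (\<rho> b')))) * snd (\<Psi> b')"
        by (auto simp: flat_model_eq[OF oS'] case_prod_beta)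
      then have "snd (\<Psi> b') = sgn (snd (\<psi> (\<rho> b')))"
        using sgn_of_real_mult[of "cmod (snd (\<psi> (\<rho> b')))" "snd (\<Psi> b')"] nz by simp
      \<comment> \<open>Splitting off \<open>?s n\<close> separates the angle into that of the
        difference quotient, which tends to \<open>sgn d\<close>, and the constant direction
        \<open>t\<close>.\<close>
      also have "\<dots> = sgn (snd (?T (w1, ?s n)) / ?s n * ?s n)"
        using 1 sn by simp
      also have "\<dots> = sgn (snd (?T (w1, ?s n)) / ?s n) * sgn (?s n)"
        by (simp only: sgn_mult)
      also have "sgn (?s n) = t" using t by (intro sgn_of_real_mult) auto
      finally show ?case by (simp add: b'_def \<phi>x')
    qed
    from LIMSEQ_unique[OF lim1 Lim_transform_eventually[OF lim2 eventually_mono[OF this]]]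
    show ?thesis by (simp add: t_def)
  qed
  then show ?thesis by blast
qed

text \<open>The constant rotation relating the angles in two flat coordinate systems commutes with
  multiplication by \<open>cis \<Theta>\<close>, so the action has its standard form in whichever
  system is at hand.\<close>

lemma canonical_action_coords:
  assumes S: "complex_surface X A" and act: "canonical_action X A D B \<rho> \<Theta> b b'"
    and V: "flat_coords X A D V \<psi>" "\<rho> b \<in> V" and \<Psi>: "blowup_coords B \<rho> V \<psi> (flat_model (\<psi> ` V)) \<Psi>"
  shows "\<rho> b' = \<rho> b" "\<exists>w1 t. \<psi> (\<rho> b) = (w1, 0) \<and> \<Psi> b = ((w1, 0), t) \<and> \<Psi> b' = ((w1, 0), t * cis \<Theta>)"
proof -
  obtain U \<phi> \<Phi> v t where U: "flat_coords X A D U \<phi>" "blowup_coords B \<rho> U \<phi> (flat_model (\<phi> ` U)) \<Phi>"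
    and b: "b \<in> topspace B" "b' \<in> topspace B" "\<rho> b \<in> U" "\<rho> b' \<in> U"
    and \<Phi>: "\<Phi> b = ((v, 0), t)" "\<Phi> b' = ((v, 0), t * cis \<Theta>)"
    using act unfolding canonical_action_def by blast
  have \<phi>: "\<phi> (\<rho> b) = (v, 0)" "\<phi> (\<rho> b') = (v, 0)"
    using blowup_coordsD(2)[OF U(2)] b \<Phi> by force+
  have "inj_on \<phi> U" using U(1) topological_chartD(3)[OF local_coords_chart] unfolding flat_coords_def by blast
  then show eq: "\<rho> b' = \<rho> b" by (rule inj_onD) (simp_all only: \<phi> b)
  have "snd (\<phi> (\<rho> b)) = 0" using \<phi>(1) by simp
  then have D: "\<rho> b \<in> D" using U(1) b(3) unfolding flat_coords_def by blast
  then obtain c where c: "\<And>b1. b1 \<in> topspace B \<Longrightarrow> \<rho> b1 = \<rho> b \<Longrightarrow> snd (\<Psi> b1) = c * snd (\<Phi> b1)"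
    using flat_blowup_angle_change[OF S U(1) V(1) _ _ U(2) \<Psi>, of "\<rho> b"] b V(2) by blast
  obtain w1 where w1: "\<psi> (\<rho> b) = (w1, 0)"
  proof -
    have "snd (\<psi> (\<rho> b)) = 0" using D V unfolding flat_coords_def by blast
    then show ?thesis using that by (metis prod.collapse)
  qed
  have "\<Psi> b = ((w1, 0), c * t)" "\<Psi> b' = ((w1, 0), c * t * cis \<Theta>)"
    using c[OF b(1)] c[OF b(2) eq] \<Phi> blowup_coordsD(2)[OF \<Psi>] b V eq w1 by (auto simp: prod_eq_iff)
  then show "\<exists>w1 t. \<psi> (\<rho> b) = (w1, 0) \<and> \<Psi> b = ((w1, 0), t) \<and> \<Psi> b' = ((w1, 0), t * cis \<Theta>)"
    using w1 by blast
qed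

section \<open>The ruled map of the quarter plane\<close>

text \<open>For \<open>0 < r < R\<^sub>0\<close>, the segment from \<open>(r m, 0)\<close> to \<open>(R\<^sub>0 m, R\<^sub>0 (1 - m))\<close> consists of the points
  \<open>(spread n * m, n * (1 - m))\<close> with \<open>0 \<le> n \<le> R\<^sub>0\<close>, so that \<open>n\<close> is found from a point
  \<open>(x, a)\<close> by solving a quadratic equation.\<close>

definition spread :: "real \<Rightarrow> real \<Rightarrow> real \<Rightarrow> real" where
  "spread r R0 n = max n (r + (1 - r / R0) * n)"

text \<open>With \<open>k = 1 - r / R0\<close>, eliminating \<open>m\<close> from
  \<open>x = (r + k * y) * m\<close> and \<open>a = y * (1 - m)\<close> gives
  \<open>k * y^2 + (r - k * a - x) * y = a * r\<close>; this is the larger root.\<close>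

definition ruling_root :: "real \<Rightarrow> real \<Rightarrow> real \<Rightarrow> real \<Rightarrow> real" where
  "ruling_root r R0 x a =
     (sqrt ((r - (1 - r / R0) * a - x)\<^sup>2 + 4 * (1 - r / R0) * a * r) - (r - (1 - r / R0) * a - x))
       / (2 * (1 - r / R0))"

text \<open>The root applies inside the triangle \<open>x + a \<le> R0\<close>, and
  \<open>x + a\<close> itself beyond. Taking the minimum makes this choice without a case
  distinction, so continuity is evident.\<close>

definition ruling_size :: "real \<Rightarrow> real \<Rightarrow> real \<Rightarrow> real \<Rightarrow> real" where
  "ruling_size r R0 x a = min (x + a) (ruling_root r R0 x a)"

context
  fixes r R0 k :: real
  assumes r: "0 < r" "r < R0" and k_def: "k = 1 - r / R0"
begin

lemma k_bounds: "0 < k" "k < 1"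
  using r by (auto simp: k_def field_simps)

lemma r_eq: "r = R0 - k * R0"
  using r by (auto simp: k_def field_simps)

lemma spread_le: "n \<le> R0 \<Longrightarrow> spread r R0 n = r + k * n"
proof -
  assume "n \<le> R0"
  then have "(1 - k) * n \<le> (1 - k) * R0" using k_bounds by (intro mult_left_mono) auto
  then show ?thesis
    using r_eq unfolding spread_def k_def[symmetric] by (simp add: algebra_simps max_def)
qed

lemma spread_ge: "R0 \<le> n \<Longrightarrow> spread r R0 n = n"
proof -
  assume "R0 \<le> n"
  then have "(1 - k) * R0 \<le> (1 - k) * n" using k_bounds by (intro mult_left_mono) auto
  then show ?thesis
    using r_eq unfolding spread_def k_def[symmetric] by (simp add: algebra_simps max_def)
qed

lemma spread_bounds:
  "0 \<le> n \<Longrightarrow> r \<le> spread r R0 n" "0 < n \<Longrightarrow> r < spread r R0 n" "n \<le> R0 \<Longrightarrow> spread r R0 n \<le> R0"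
proof -
  show "0 \<le> n \<Longrightarrow> r \<le> spread r R0 n" "0 < n \<Longrightarrow> r < spread r R0 n"
    using k_bounds by (auto simp: spread_def k_def[symmetric] less_max_iff_disj le_max_iff_disj)
  assume n: "n \<le> R0"
  then have "k * n \<le> k * R0" using k_bounds by (intro mult_left_mono) auto
  then show "spread r R0 n \<le> R0" using spread_le[OF n] r_eq by simp
qed

text \<open>The second hypothesis places \<open>y\<close> to the right of the vertex of the
  parabola, hence at the larger root.\<close>

lemma ruling_root_eq:
  assumes "k * y\<^sup>2 + (r - k * a - x) * y = a * r" "0 \<le> 2 * k * y + (r - k * a - x)"
  shows "ruling_root r R0 x a = y"
proof -
  have "(2 * k * y + (r - k * a - x))\<^sup>2 = (r - k * a - x)\<^sup>2 + 4 * k * (k * y\<^sup>2 + (r - k * a - x) * y)"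
    by (simp add: power2_eq_square algebra_simps)
  also have "\<dots> = (r - k * a - x)\<^sup>2 + 4 * k * a * r" unfolding assms(1) by simp
  finally have "sqrt ((r - k * a - x)\<^sup>2 + 4 * k * a * r) = 2 * k * y + (r - k * a - x)"
    using assms(2) by (metis real_sqrt_abs abs_of_nonneg)
  then show ?thesis using k_bounds by (simp add: ruling_root_def k_def[symmetric])
qed

text \<open>Where the quadratic is at most zero, \<open>y\<close> lies between its roots.\<close>

lemma ruling_root_ge:
  assumes "k * y\<^sup>2 + (r - k * a - x) * y \<le> a * r"
  shows "y \<le> ruling_root r R0 x a"
proof -
  have "(2 * k * y + (r - k * a - x))\<^sup>2 = (r - k * a - x)\<^sup>2 + 4 * k * (k * y\<^sup>2 + (r - k * a - x) * y)"
    by (simp add: power2_eq_square algebra_simps)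
  also have "\<dots> \<le> (r - k * a - x)\<^sup>2 + 4 * k * (a * r)"
    using assms k_bounds by (intro add_left_mono mult_left_mono) auto
  finally have "2 * k * y + (r - k * a - x) \<le> sqrt ((r - k * a - x)\<^sup>2 + 4 * k * a * r)"
    by (intro real_le_rsqrt) (simp add: algebra_simps)
  then show ?thesis using k_bounds by (simp add: ruling_root_def k_def[symmetric] field_simps)
qed

lemma ruling_root_le:
  assumes "a * r \<le> k * y\<^sup>2 + (r - k * a - x) * y" "0 \<le> 2 * k * y + (r - k * a - x)"
  shows "ruling_root r R0 x a \<le> y"
proof -
  have "(r - k * a - x)\<^sup>2 + 4 * k * (a * r) \<le> (r - k * a - x)\<^sup>2 + 4 * k * (k * y\<^sup>2 + (r - k * a - x) * y)"
    using assms k_bounds by (intro add_left_mono mult_left_mono) auto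
  also have "\<dots> = (2 * k * y + (r - k * a - x))\<^sup>2"
    by (simp add: power2_eq_square algebra_simps)
  finally have "sqrt ((r - k * a - x)\<^sup>2 + 4 * k * a * r) \<le> 2 * k * y + (r - k * a - x)"
    using assms(2) by (intro real_le_lsqrt) (auto simp: algebra_simps)
  then show ?thesis using k_bounds by (simp add: ruling_root_def k_def[symmetric] field_simps)
qed

lemma ruling_root_quadratic:
  fixes x a :: real
  assumes "0 \<le> a"
  defines "q \<equiv> ruling_root r R0 x a"
  shows "k * q\<^sup>2 + (r - k * a - x) * q = a * r"
proof -
  let ?b = "r - k * a - x"
  have s: "sqrt (?b\<^sup>2 + 4 * k * a * r) = 2 * k * q + ?b"
    using k_bounds by (simp add: q_def ruling_root_def k_def[symmetric])
  have "0 \<le> ?b\<^sup>2 + 4 * k * a * r" using assms(1) k_bounds r by simp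
  then have "(2 * k * q + ?b)\<^sup>2 = ?b\<^sup>2 + 4 * k * a * r" unfolding s[symmetric] by simp
  moreover have "(2 * k * q + ?b)\<^sup>2 = ?b\<^sup>2 + 4 * k * (k * q\<^sup>2 + ?b * q)"
    by (simp add: power2_eq_square algebra_simps)
  ultimately have "4 * k * (k * q\<^sup>2 + ?b * q) = 4 * k * (a * r)" by simp
  then show ?thesis using k_bounds by simp
qed

text \<open>The sign of \<open>R0 - (x + a)\<close> thus decides which term of the minimum in
  \<open>ruling_size\<close> is taken.\<close>

lemma ruling_polynomial_at_sum:
  "k * (x + a)\<^sup>2 + (r - k * a - x) * (x + a) - a * r = x * ((1 - k) * (R0 - (x + a)))"
  by (simp add: r_eq power2_eq_square algebra_simps)

lemma ruling_size_spread:
  assumes "0 \<le> n" "0 \<le> m" "m \<le> 1"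
  shows "ruling_size r R0 (spread r R0 n * m) (n * (1 - m)) = n"
proof (cases "n \<le> R0")
  case True
  let ?x = "(r + k * n) * m" and ?a = "n * (1 - m)"
  have "ruling_root r R0 ?x ?a = n"
  proof (rule ruling_root_eq)
    show "k * n\<^sup>2 + (r - k * ?a - ?x) * n = ?a * r" by (simp add: power2_eq_square algebra_simps)
    have "2 * k * n + (r - k * ?a - ?x) = r * (1 - m) + k * n" by (simp add: algebra_simps)
    moreover have "0 \<le> r * (1 - m) + k * n" using assms k_bounds r by simp
    ultimately show "0 \<le> 2 * k * n + (r - k * ?a - ?x)" by linarith
  qed
  moreover have "n * m \<le> (r + k * n) * m"
    using spread_le[OF True] assms by (intro mult_right_mono) (auto simp: spread_def)
  \<comment> \<open>Here \<open>spread r R0 n\<close> is at least \<open>n\<close>, so the minimum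
    is attained by the root.\<close>
  then have "n \<le> ?x + ?a" by (simp add: algebra_simps)
  ultimately show ?thesis unfolding ruling_size_def spread_le[OF True] by simp
next
  case False
  then have n: "R0 \<le> n" by simp
  let ?x = "n * m" and ?a = "n * (1 - m)"
  have xa: "?x + ?a = n" by (simp add: algebra_simps)
  have "?x * ((1 - k) * (R0 - n)) \<le> 0"
    using assms k_bounds n by (intro mult_nonneg_nonpos) auto
  then have "n \<le> ruling_root r R0 ?x ?a"
    using ruling_polynomial_at_sum[of ?x ?a] unfolding xa by (intro ruling_root_ge) simp
  then show ?thesis unfolding ruling_size_def spread_ge[OF n] xa by simp
qed

text \<open>Every point of the quarter plane lies on a segment of the ruling: the parameter is
  \<open>m = x / spread r R0 n\<close>, and the second claim bounds it by 1.\<close>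

lemma ruling_size_properties:
  fixes x a :: real
  assumes "0 \<le> x" "0 \<le> a"
  defines "n \<equiv> ruling_size r R0 x a"
  shows "0 \<le> n" "x \<le> spread r R0 n" "n * (1 - x / spread r R0 n) = a"
    "n \<le> R0 \<or> n = x + a"
proof -
  have *: "0 \<le> n \<and> x \<le> spread r R0 n \<and> n * (1 - x / spread r R0 n) = a \<and> (n \<le> R0 \<or> n = x + a)"
  proof (cases "x + a \<le> R0")
    case True
    have pos: "0 \<le> x * ((1 - k) * (R0 - (x + a)))"
      using assms k_bounds True by simp
    have "2 * k * (x + a) + (r - k * a - x) = k * a + (1 - k) * (R0 - x) + k * x"
      by (simp add: r_eq algebra_simps)
    moreover have "0 \<le> k * a + (1 - k) * (R0 - x) + k * x"
      using assms k_bounds True by (intro add_nonneg_nonneg mult_nonneg_nonneg) auto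
    ultimately have "0 \<le> 2 * k * (x + a) + (r - k * a - x)" by linarith
    with pos have le: "ruling_root r R0 x a \<le> x + a"
      using ruling_polynomial_at_sum[of x a] by (intro ruling_root_le) simp_all
    then have n: "n = ruling_root r R0 x a" by (simp add: n_def ruling_size_def)
    have n0: "0 \<le> n"
      unfolding n using assms r by (intro ruling_root_ge) simp
    have nR: "n \<le> R0" using le True n by simp
    have q: "k * n\<^sup>2 + (r - k * a - x) * n = a * r"
      unfolding n by (rule ruling_root_quadratic[OF assms(2)])
    then have q': "(n - a) * (r + k * n) = x * n" by (simp add: power2_eq_square algebra_simps)
    have g: "0 < r + k * n" using r k_bounds n0 by (simp add: add_pos_nonneg)
    \<comment> \<open>The quadratic gives this after division by \<open>n\<close>. At
      \<open>n = 0\<close> it says nothing about \<open>x\<close>, but there \<open>a = 0\<close>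
      and the vanishing of the root itself forces \<open>x \<le> r\<close>.\<close>
    have xg: "x \<le> r + k * n"
    proof (cases "n = 0")
      case True
      then have a: "a = 0" using q r by simp
      have "ruling_root r R0 x 0 = 0" using n True a by simp
      then have "\<bar>r - x\<bar> = r - x"
        using k_bounds by (simp add: ruling_root_def k_def[symmetric])
      then show ?thesis using True by simp
    next
      case False
      have "(n - a) * (r + k * n) \<le> n * (r + k * n)"
        using g assms by (intro mult_right_mono) auto
      then have "x * n \<le> (r + k * n) * n" unfolding q' by (simp add: mult.commute)
      then show ?thesis using False n0 by simp
    qed
    have "n * (1 - x / (r + k * n)) = a"
      using q' g by (simp add: field_simps)
    then show ?thesis using n0 nR xg spread_le[OF nR] by simp
  next
    case False
    have "x * ((1 - k) * (R0 - (x + a))) \<le> 0"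
      using assms k_bounds False by (intro mult_nonneg_nonpos) auto
    then have "x + a \<le> ruling_root r R0 x a"
      using ruling_polynomial_at_sum[of x a] by (intro ruling_root_ge) simp
    then have n: "n = x + a" by (simp add: n_def ruling_size_def)
    have "0 < n" using False r n by simp
    then have "n * (1 - x / n) = a" using n by (simp add: field_simps)
    then show ?thesis using n assms spread_ge[of n] False by simp
  qed
  then show "0 \<le> n" "x \<le> spread r R0 n" "n * (1 - x / spread r R0 n) = a" "n \<le> R0 \<or> n = x + a"
    by auto
qed

end

section \<open>Models over the coordinate neighbourhood\<close>

text \<open>With \<open>w\<^sub>2 = a \<theta>\<close>, a point of the blown-up half space is given by the size \<open>n = |w\<^sub>1| + a\<close> and the
  direction \<open>(w\<^sub>1, a) / n = (p, 1 - |p|)\<close>; the exceptional divisor is \<open>n = 0\<close>.\<close>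

definition half_space_model :: "real \<Rightarrow> (real \<times> complex \<times> complex) set" where
  "half_space_model R = {(n, p, t). 0 \<le> n \<and> cmod p \<le> 1 \<and> cmod t = 1 \<and> n * cmod p < R \<and> n * (1 - cmod p) < R}"

definition flat_ball_model :: "real \<Rightarrow> ((complex \<times> complex) \<times> complex) set" where
  "flat_ball_model R = {((w1, w2), t). cmod w1 < R \<and> cmod w2 < R \<and> cmod t = 1 \<and> w2 = of_real (cmod w2) * t}"

text \<open>With \<open>g\<close> the identity this is the lift \<open>\<pi>t\<close> in
  coordinates; with \<open>g = spread r R0\<close> it is the map sought.\<close>

definition polar_map :: "(real \<Rightarrow> real) \<Rightarrow> real \<times> complex \<times> complex \<Rightarrow> (complex \<times> complex) \<times> complex" where
  "polar_map g = (\<lambda>(n, p, t). ((of_real (g n) * p, of_real (n * (1 - cmod p)) * t), t))"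

lemma cmod_of_real_mult: "0 \<le> n \<Longrightarrow> cmod t = 1 \<Longrightarrow> cmod (of_real n * t) = n"
  by (simp add: norm_mult)

text \<open>The ruling is applied to the moduli of \<open>w1\<close> and \<open>w2\<close>. Since
  \<open>spread\<close> is at least \<open>r > 0\<close>, recovering \<open>p\<close> from
  \<open>w1\<close> by division is continuous even over \<open>n = 0\<close>, where the unmodified
  map collapses all directions.\<close>

lemma homeomorphic_map_spread:
  assumes r: "0 < r" "r < R0" "R0 < R"
  shows "homeomorphic_map (top_of_set (half_space_model R)) (top_of_set (flat_ball_model R))
    (polar_map (spread r R0))"
proof -
  define k where "k = 1 - r / R0"
  note kb = k_bounds[OF r(1,2) k_def] and sb = spread_bounds[OF r(1,2) k_def]
    and sle = spread_le[OF r(1,2) k_def] and sge = spread_ge[OF r(1,2) k_def]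
    and sz = ruling_size_spread[OF r(1,2) k_def] and sp = ruling_size_properties[OF r(1,2) k_def]
  let ?g = "spread r R0"
  define G where "G = (\<lambda>((w1, w2), t). let n = ruling_size r R0 (cmod w1) (cmod w2) in
    (n, w1 / of_real (?g n), t::complex))"
  have F: "polar_map ?g m \<in> flat_ball_model R \<and> G (polar_map ?g m) = m" if m: "m \<in> half_space_model R" for m
  proof -
    obtain n p t where npt: "m = (n, p, t)" by (cases m)
    have *: "0 \<le> n" "cmod p \<le> 1" "cmod t = 1" "n * cmod p < R" "n * (1 - cmod p) < R"
      using m npt by (auto simp: half_space_model_def)
    have g: "0 < ?g n" using sb(1)[OF *(1)] r by linarith
    have c: "cmod (of_real (?g n) * p) = ?g n * cmod p" "cmod (of_real (n * (1 - cmod p)) * t) = n * (1 - cmod p)"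
      using * g by (simp add: norm_mult, intro cmod_of_real_mult) auto
    \<comment> \<open>Up to \<open>R0\<close> the values of \<open>spread\<close> stay below
      \<open>R0 < R\<close>; beyond, \<open>spread\<close> is the identity and the bound is part of
      the model.\<close>
    have "?g n * cmod p < R"
    proof (cases "n \<le> R0")
      case True
      have "?g n * cmod p \<le> R0 * 1" using sb(3)[OF True] * g by (intro mult_mono) auto
      then show ?thesis using r by simp
    qed (use * sge[of n] in simp)
    moreover have "ruling_size r R0 (?g n * cmod p) (n * (1 - cmod p)) = n"
      using * by (intro sz) auto
    moreover have e: "polar_map ?g m = ((of_real (?g n) * p, of_real (n * (1 - cmod p)) * t), t)"
      by (simp add: npt polar_map_def)
    ultimately show ?thesis
      using * g unfolding e flat_ball_model_def G_def mem_Collect_eq prod.case c Let_def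
      by (simp add: npt)
  qed
  have G: "G y \<in> half_space_model R \<and> polar_map ?g (G y) = y" if y: "y \<in> flat_ball_model R" for y
  proof -
    obtain w1 w2 t where y': "y = ((w1, w2), t)" by (metis prod.collapse)
    have *: "cmod w1 < R" "cmod w2 < R" "cmod t = 1" "w2 = of_real (cmod w2) * t"
      using y y' by (auto simp: flat_ball_model_def)
    define n where "n = ruling_size r R0 (cmod w1) (cmod w2)"
    note N = sp[OF norm_ge_zero[of w1] norm_ge_zero[of w2], folded n_def]
    have g: "0 < ?g n" using sb(1)[OF N(1)] r by linarith
    have c: "cmod (w1 / of_real (?g n)) = cmod w1 / ?g n" using g by (simp add: norm_divide)
    have le: "cmod w1 / ?g n \<le> 1" using N(2) g by simp
    have "n * (cmod w1 / ?g n) < R"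
    proof (cases "n \<le> R0")
      case True
      have "n * (cmod w1 / ?g n) \<le> n * 1" using N(1) le by (intro mult_left_mono) auto
      then show ?thesis using True r by simp
    next
      case False
      then show ?thesis using sge[of n] r * by simp
    qed
    then have 1: "G y \<in> half_space_model R"
      using N * c le unfolding y' G_def half_space_model_def by (simp add: Let_def n_def[symmetric])
    have "polar_map ?g (G y) =
        ((of_real (?g n) * (w1 / of_real (?g n)), of_real (n * (1 - cmod (w1 / of_real (?g n)))) * t), t)"
      by (simp only: y' G_def polar_map_def Let_def n_def prod.case)
    also have "\<dots> = ((w1, of_real (cmod w2) * t), t)" unfolding c N(3) using g by simp
    finally have "polar_map ?g (G y) = ((w1, of_real (cmod w2) * t), t)" .
    then show ?thesis using 1 *(4) y' by simp
  qed
  have contg: "continuous_on UNIV ?g" unfolding spread_def by (intro continuous_intros)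
  have contF: "continuous_on (half_space_model R) (polar_map ?g)"
    unfolding polar_map_def case_prod_beta
    by (intro continuous_intros continuous_on_compose2[OF contg]) auto
  have contN: "continuous_on UNIV (\<lambda>y::(complex \<times> complex) \<times> complex.
      ruling_size r R0 (cmod (fst (fst y))) (cmod (snd (fst y))))"
    unfolding ruling_size_def ruling_root_def using kb(1)
    by (intro continuous_intros) (auto simp: k_def)
  have "?g (ruling_size r R0 (cmod (fst (fst y))) (cmod (snd (fst y)))) \<noteq> 0"
    for y :: "(complex \<times> complex) \<times> complex"
    using sb(1)[OF sp(1)[OF norm_ge_zero[of "fst (fst y)"] norm_ge_zero[of "snd (fst y)"]]] r by linarith
  then have contG: "continuous_on (flat_ball_model R) G"
    unfolding G_def case_prod_beta Let_def
    by (intro continuous_intros continuous_on_compose2[OF contg]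
        continuous_on_subset[OF contN subset_UNIV]) auto
  show ?thesis
    unfolding homeomorphic_map_maps
    by (rule exI[of _ G]) (use F G contF contG in \<open>auto simp: homeomorphic_maps_def\<close>)
qed

section \<open>The two affine charts as pieces of the blown-up half space\<close>

definition crossing_chart_model :: "real \<Rightarrow> ((complex \<times> complex) \<times> complex \<times> complex) set" where
  "crossing_chart_model R = {((u, v), t1, t2). cmod u < R \<and> cmod (u * v) < R \<and> cmod t1 = 1 \<and> cmod t2 = 1 \<and>
     u = of_real (cmod u) * t1 \<and> v = of_real (cmod v) * t2}"

definition flat_chart_model :: "real \<Rightarrow> ((complex \<times> complex) \<times> complex) set" where
  "flat_chart_model R = {((s, v), t). cmod (s * v) < R \<and> cmod v < R \<and> cmod t = 1 \<and> v = of_real (cmod v) * t}"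

text \<open>Here \<open>w1 = u\<close> and \<open>w2 = u v\<close>, hence
  \<open>n = |u| (1 + |v|)\<close> and \<open>p = w1 / n\<close>. Writing the direction of
  \<open>u\<close> as \<open>t1\<close> extends the formula across \<open>u = 0\<close>; the angle
  of \<open>w2\<close> is \<open>t1 * t2\<close>.\<close>

definition crossing_chart_to_half_space :: "(complex \<times> complex) \<times> complex \<times> complex \<Rightarrow> real \<times> complex \<times> complex" where
  "crossing_chart_to_half_space = (\<lambda>((u, v), t1, t2). (cmod u * (1 + cmod v), t1 / of_real (1 + cmod v), t1 * t2))"

text \<open>Here \<open>w1 = s v\<close> and \<open>w2 = v\<close>, hence
  \<open>n = |v| (1 + |s|)\<close>, and \<open>p = w1 / n\<close> extends across
  \<open>v = 0\<close> once \<open>v / |v|\<close> is replaced by \<open>t\<close>.\<close>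

definition flat_chart_to_half_space :: "(complex \<times> complex) \<times> complex \<Rightarrow> real \<times> complex \<times> complex" where
  "flat_chart_to_half_space = (\<lambda>((s, v), t). (cmod v * (1 + cmod s), s * t / of_real (1 + cmod s), t))"

text \<open>The locus \<open>p = 0\<close>, absent from the image, lies over the strict transform of
  \<open>w1 = 0\<close>, which this chart misses.\<close>

lemma homeomorphic_map_crossing_chart:
  "homeomorphic_map (top_of_set (crossing_chart_model R))
     (top_of_set (half_space_model R \<inter> {(n, p, t). p \<noteq> 0})) crossing_chart_to_half_space"
proof -
  \<comment> \<open>The modulus of \<open>p\<close> is \<open>1 / (1 + |v|)\<close> and its
    direction is \<open>t1\<close>; this determines \<open>|v|\<close>, and \<open>t2\<close> is the
    quotient of \<open>t\<close> by \<open>t1\<close>.\<close>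
  define G :: "real \<times> complex \<times> complex \<Rightarrow> (complex \<times> complex) \<times> complex \<times> complex"
    where "G = (\<lambda>(n, p, t). ((of_real n * p, of_real (1 / cmod p - 1) * (t / (p / of_real (cmod p)))),
      p / of_real (cmod p), t / (p / of_real (cmod p))))"
  have F: "crossing_chart_to_half_space m \<in> half_space_model R \<inter> {(n, p, t). p \<noteq> 0} \<and>
      G (crossing_chart_to_half_space m) = m" if m: "m \<in> crossing_chart_model R" for m
  proof -
    obtain u v t1 t2 where m': "m = ((u, v), t1, t2)" by (metis prod.collapse)
    have *: "cmod u < R" "cmod (u * v) < R" "cmod t1 = 1" "cmod t2 = 1"
       "of_real (cmod u) * t1 = u" "of_real (cmod v) * t2 = v"
      using m m' by (auto simp: crossing_chart_model_def)
    define b where "b = 1 + cmod v"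
    have b: "1 \<le> b" by (simp add: b_def)
    have c: "cmod (t1 / of_real b) = 1 / b" using * b by (simp add: norm_divide)
    have t0: "t1 \<noteq> 0" using * by auto
    have 1: "cmod u * b * (1 / b) = cmod u" using b by simp
    have 2: "cmod u * b * (1 - 1 / b) = cmod (u * v)"
      using b by (simp add: field_simps) (simp add: b_def norm_mult algebra_simps)
    have p: "t1 / of_real b / of_real (1 / b) = t1" using b by simp
    have 3: "of_real (cmod u * b) * (t1 / of_real b) = u" using b *(5) by simp
    have 4: "1 / (1 / b) - 1 = cmod v" using b by (simp add: b_def)
    have 5: "t1 * t2 / t1 = t2" using t0 by simp
    have "crossing_chart_to_half_space m = (cmod u * b, t1 / of_real b, t1 * t2)"
      by (simp add: m' crossing_chart_to_half_space_def b_def)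
    moreover have "(cmod u * b, t1 / of_real b, t1 * t2) \<in> half_space_model R \<inter> {(n, p, t). p \<noteq> 0}"
      unfolding half_space_model_def using * b t0
      by (simp only: Int_iff mem_Collect_eq prod.case c 1 2) (simp add: norm_mult)
    moreover have "G (cmod u * b, t1 / of_real b, t1 * t2) = m"
      unfolding G_def m' prod.case c p 3 4 5 using *(6) by simp
    ultimately show ?thesis by simp
  qed
  have G: "G m \<in> crossing_chart_model R \<and> crossing_chart_to_half_space (G m) = m"
    if m: "m \<in> half_space_model R \<inter> {(n, p, t). p \<noteq> 0}" for m
  proof -
    obtain n p t where m': "m = (n, p, t)" by (metis prod.collapse)
    have *: "0 \<le> n" "cmod p \<le> 1" "cmod t = 1" "n * cmod p < R" "n * (1 - cmod p) < R" "p \<noteq> 0"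
      using m m' by (auto simp: half_space_model_def)
    define t1 where "t1 = p / of_real (cmod p)"
    define t2 where "t2 = t / t1"
    have t1: "cmod t1 = 1" using * by (simp add: t1_def norm_divide)
    have t2: "cmod t2 = 1" using * t1 by (simp add: t2_def norm_divide)
    have t3: "p = of_real (cmod p) * t1" using * by (simp add: t1_def)
    have t4: "t1 \<noteq> 0" using t1 by auto
    note t = t1 t2 t4 t3
    have b: "0 \<le> 1 / cmod p - 1" using * by simp
    have u: "cmod (of_real n * p) = n * cmod p" using * by (simp add: norm_mult)
    have v: "cmod (of_real (1 / cmod p - 1) * t2) = 1 / cmod p - 1"
      using b t(2) by (rule cmod_of_real_mult)
    have uv: "cmod (of_real n * p * (of_real (1 / cmod p - 1) * t2)) = n * (1 - cmod p)"
      unfolding norm_mult[of "of_real n * p"] u v using *(6) by (simp add: field_simps)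
    have Gm: "G m = ((of_real n * p, of_real (1 / cmod p - 1) * t2), t1, t2)"
      by (simp add: m' G_def t1_def t2_def)
    have "of_real n * p = of_real (n * cmod p) * t1" using t(4) by simp
    then have 1: "G m \<in> crossing_chart_model R"
      unfolding Gm crossing_chart_model_def using * t(1,2) u v uv by simp
    have "crossing_chart_to_half_space (G m) = (n * cmod p * (1 / cmod p), t1 / of_real (1 / cmod p), t1 * t2)"
      unfolding Gm crossing_chart_to_half_space_def prod.case u v by simp
    also have "\<dots> = m" using *(6) t(3,4) by (simp add: m' t2_def mult.commute)
    finally show ?thesis using 1 by simp
  qed
  have nz: "1 + cmod v \<noteq> 0" for v using norm_ge_zero[of v] by linarith
  have contF: "continuous_on (crossing_chart_model R) crossing_chart_to_half_space"
    unfolding crossing_chart_to_half_space_def case_prod_beta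
    by (intro continuous_intros) (use nz in \<open>auto simp del: of_real_add\<close>)
  have contG: "continuous_on (half_space_model R \<inter> {(n, p, t). p \<noteq> 0}) G"
    unfolding G_def case_prod_beta by (intro continuous_intros) auto
  show ?thesis
    unfolding homeomorphic_map_maps
    by (rule exI[of _ G]) (use F G contF contG in \<open>auto simp: homeomorphic_maps_def\<close>)
qed

text \<open>The missing locus \<open>cmod p = 1\<close> lies over the strict transform of
  \<open>w2 = 0\<close>, visible only in the other chart.\<close>

lemma homeomorphic_map_flat_chart:
  "homeomorphic_map (top_of_set (flat_chart_model R))
     (top_of_set (half_space_model R \<inter> {(n, p, t). cmod p < 1})) flat_chart_to_half_space"
proof -
  \<comment> \<open>From \<open>|p| = |s| / (1 + |s|)\<close> one gets
    \<open>1 + |s| = 1 / (1 - |p|)\<close>, which yields both \<open>s\<close> and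
    \<open>|v|\<close>.\<close>
  define G :: "real \<times> complex \<times> complex \<Rightarrow> (complex \<times> complex) \<times> complex"
    where "G = (\<lambda>(n, p, t). ((p / (t * of_real (1 - cmod p)), of_real (n * (1 - cmod p)) * t), t))"
  have F: "flat_chart_to_half_space m \<in> half_space_model R \<inter> {(n, p, t). cmod p < 1} \<and>
      G (flat_chart_to_half_space m) = m" if m: "m \<in> flat_chart_model R" for m
  proof -
    obtain s v t where m': "m = ((s, v), t)" by (metis prod.collapse)
    have *: "cmod (s * v) < R" "cmod v < R" "cmod t = 1" "of_real (cmod v) * t = v"
      using m m' by (auto simp: flat_chart_model_def)
    define b where "b = 1 + cmod s"
    have b: "1 \<le> b" by (simp add: b_def)
    have c: "cmod (s * t / of_real b) = cmod s / b" using * b by (simp add: norm_divide norm_mult)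
    have t0: "t \<noteq> 0" using * by auto
    have 1: "cmod v * b * (cmod s / b) = cmod (s * v)" using b by (simp add: norm_mult)
    have 5: "1 - cmod s / b = 1 / b" using b by (simp add: field_simps) (simp add: b_def)
    have 2: "cmod v * b * (1 / b) = cmod v" using b by simp
    have lt: "cmod s / b < 1" using b by (simp add: pos_divide_less_eq) (simp add: b_def)
    have 3: "s * t / of_real b / (t * of_real (1 / b)) = s" using b t0 by simp
    have "flat_chart_to_half_space m = (cmod v * b, s * t / of_real b, t)"
      by (simp add: m' flat_chart_to_half_space_def b_def)
    moreover have "(cmod v * b, s * t / of_real b, t) \<in> half_space_model R \<inter> {(n, p, t). cmod p < 1}"
      unfolding half_space_model_def using * b lt by (simp only: Int_iff mem_Collect_eq prod.case c 5 1 2) simp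
    moreover have "G (cmod v * b, s * t / of_real b, t) = m"
      unfolding G_def m' prod.case c 5 2 3 using *(4) by simp
    ultimately show ?thesis by simp
  qed
  have G: "G m \<in> flat_chart_model R \<and> flat_chart_to_half_space (G m) = m"
    if m: "m \<in> half_space_model R \<inter> {(n, p, t). cmod p < 1}" for m
  proof -
    obtain n p t where m': "m = (n, p, t)" by (metis prod.collapse)
    have *: "0 \<le> n" "cmod p < 1" "cmod t = 1" "n * cmod p < R" "n * (1 - cmod p) < R"
      using m m' by (auto simp: half_space_model_def)
    define e where "e = 1 - cmod p"
    have e: "0 < e" using * by (simp add: e_def)
    have t0: "t \<noteq> 0" using * by auto
    have s: "cmod (p / (t * of_real e)) = cmod p / e" using * e by (simp add: norm_divide norm_mult)
    have v: "cmod (of_real (n * e) * t) = n * e"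
      using * e by (intro cmod_of_real_mult) auto
    have sv: "cmod (p / (t * of_real e) * (of_real (n * e) * t)) = n * cmod p"
      unfolding norm_mult[of "p / (t * of_real e)"] s v using e by simp
    have Gm: "G m = ((p / (t * of_real e), of_real (n * e) * t), t)"
      by (simp add: m' G_def e_def)
    have 1: "G m \<in> flat_chart_model R"
      unfolding Gm flat_chart_model_def using * v sv by (simp add: e_def[symmetric])
    have b: "1 + cmod p / e = 1 / e" using e by (simp add: field_simps) (simp add: e_def)
    have "flat_chart_to_half_space (G m) = (n * e * (1 / e), p / (t * of_real e) * t / of_real (1 / e), t)"
      unfolding Gm flat_chart_to_half_space_def prod.case s v b by simp
    also have "\<dots> = m" using e t0 by (simp add: m')
    finally show ?thesis using 1 by simp
  qed
  have nz: "1 + cmod v \<noteq> 0" for v using norm_ge_zero[of v] by linarith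
  have contF: "continuous_on (flat_chart_model R) flat_chart_to_half_space"
    unfolding flat_chart_to_half_space_def case_prod_beta
    by (intro continuous_intros) (use nz in \<open>auto simp del: of_real_add\<close>)
  have contG: "continuous_on (half_space_model R \<inter> {(n, p, t). cmod p < 1}) G"
    unfolding G_def case_prod_beta
    by (intro continuous_intros) (auto simp: half_space_model_def)
  show ?thesis
    unfolding homeomorphic_map_maps
    by (rule exI[of _ G]) (use F G contF contG in \<open>auto simp: homeomorphic_maps_def\<close>)
qed

lemma sgn_eq_of_polar:
  assumes v: "v = of_real (cmod v) * t" "v \<noteq> 0"
  shows "sgn v = t"
proof -
  have "sgn v = v / of_real (cmod v)" by (rule sgn_eq)
  also have "\<dots> = of_real (cmod v) * t / of_real (cmod v)" using v(1) by (rule arg_cong)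
  also have "\<dots> = t" using v(2) by simp
  finally show ?thesis .
qed

text \<open>Polar coordinates computed from \<open>(w1, w2)\<close> alone where \<open>w2\<close> is
  nonzero: the common reference by which the two charts and the lift are compared off the
  divisor.\<close>

definition half_space_point :: "complex \<times> complex \<Rightarrow> real \<times> complex \<times> complex" where
  "half_space_point = (\<lambda>(w1, w2). (cmod w1 + cmod w2, w1 / of_real (cmod w1 + cmod w2), sgn w2))"

lemma crossing_chart_to_half_space_generic:
  assumes m: "m \<in> crossing_chart_model R" and nz: "fst (fst m) * snd (fst m) \<noteq> 0"
  shows "crossing_chart_to_half_space m = half_space_point (fst (fst m), fst (fst m) * snd (fst m))"
proof -
  obtain u v t1 t2 where m': "m = ((u, v), t1, t2)" by (metis prod.collapse)
  have *: "cmod t1 = 1" "cmod t2 = 1" "u = of_real (cmod u) * t1" "v = of_real (cmod v) * t2" "u \<noteq> 0" "v \<noteq> 0"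
    using m m' nz by (auto simp: crossing_chart_model_def)
  have "sgn u = t1" "sgn v = t2" using * by (auto intro: sgn_eq_of_polar)
  then have 1: "sgn (u * v) = t1 * t2" by (simp add: sgn_mult)
  have 2: "cmod u + cmod (u * v) = cmod u * (1 + cmod v)" by (simp add: norm_mult algebra_simps)
  have "u / of_real (cmod u * (1 + cmod v)) = (u / of_real (cmod u)) / of_real (1 + cmod v)" by simp
  also have "u / of_real (cmod u) = t1" using \<open>sgn u = t1\<close> by (simp add: sgn_eq)
  finally have 3: "u / of_real (cmod u * (1 + cmod v)) = t1 / of_real (1 + cmod v)" .
  show ?thesis
    unfolding m' half_space_point_def crossing_chart_to_half_space_def prod.case fst_conv snd_conv 2 3 1 ..
qed

lemma flat_chart_to_half_space_generic:
  assumes m: "m \<in> flat_chart_model R" and nz: "snd (fst m) \<noteq> 0"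
  shows "flat_chart_to_half_space m = half_space_point (fst (fst m) * snd (fst m), snd (fst m))"
proof -
  obtain s v t where m': "m = ((s, v), t)" by (metis prod.collapse)
  have *: "cmod t = 1" "v = of_real (cmod v) * t" "v \<noteq> 0"
    using m m' nz by (auto simp: flat_chart_model_def)
  have 1: "sgn v = t" using *(2,3) by (rule sgn_eq_of_polar)
  have 2: "cmod (s * v) + cmod v = cmod v * (1 + cmod s)" by (simp add: norm_mult algebra_simps)
  have "s * v / of_real (cmod v * (1 + cmod s)) = s * (v / of_real (cmod v)) / of_real (1 + cmod s)" by simp
  also have "v / of_real (cmod v) = t" using 1 by (simp add: sgn_eq)
  finally have 3: "s * v / of_real (cmod v * (1 + cmod s)) = s * t / of_real (1 + cmod s)" .
  show ?thesis
    unfolding m' half_space_point_def flat_chart_to_half_space_def prod.case fst_conv snd_conv 2 3 1 ..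
qed

lemma polar_map_half_space_point:
  assumes "w2 \<noteq> 0"
  shows "polar_map (\<lambda>n. n) (half_space_point (w1, w2)) = ((w1, w2), sgn w2)"
proof -
  define n where "n = cmod w1 + cmod w2"
  have n: "0 < n" using assms by (simp add: n_def add_nonneg_pos)
  have 1: "of_real n * (w1 / of_real n) = w1" using n by simp
  have "cmod (w1 / of_real n) = cmod w1 / n" using n by (simp add: norm_divide)
  then have 2: "n * (1 - cmod (w1 / of_real n)) = cmod w2"
    using n by (simp add: field_simps) (simp add: n_def)
  have 3: "of_real (cmod w2) * sgn w2 = w2" by (simp add: sgn_eq)
  show ?thesis
    unfolding half_space_point_def prod.case n_def[symmetric] polar_map_def 1 2 3 ..
qed

section \<open>Lifting the point blow-up\<close>

text \<open>The two conditions force \<open>f\<close> to be the inverse of \<open>\<alpha>\<close>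
  composed with \<open>\<beta>\<close>, so it is enough to know a map in coordinates with values in
  a common model.\<close>

lemma homeomorphic_map_lift:
  assumes \<alpha>: "homeomorphic_map T Y \<alpha>" and \<beta>: "homeomorphic_map S Y \<beta>"
    and f: "\<And>s. s \<in> topspace S \<Longrightarrow> f s \<in> topspace T" "\<And>s. s \<in> topspace S \<Longrightarrow> \<alpha> (f s) = \<beta> s"
  shows "homeomorphic_map S T f"
proof -
  obtain \<alpha>' where \<alpha>': "homeomorphic_maps T Y \<alpha> \<alpha>'"
    using \<alpha> unfolding homeomorphic_map_maps by blast
  then have "homeomorphic_map Y T \<alpha>'"
    using homeomorphic_maps_sym homeomorphic_maps_map by blast
  then have "homeomorphic_map S T (\<alpha>' \<circ> \<beta>)" by (rule homeomorphic_map_compose[OF \<beta>])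
  then show ?thesis
  proof (rule homeomorphic_map_eq)
    fix s assume s: "s \<in> topspace S"
    have "\<alpha>' (\<alpha> (f s)) = f s" using \<alpha>' f(1)[OF s] unfolding homeomorphic_maps_def by blast
    then show "(\<alpha>' \<circ> \<beta>) s = f s" using f(2)[OF s] by simp
  qed
qed

text \<open>The cover is taken on the target with full preimages on the source: two points with the
  same image then lie in one piece, so injectivity can be checked locally.\<close>

lemma homeomorphic_map_glue:
  assumes f: "\<And>x. x \<in> topspace S \<Longrightarrow> f x \<in> topspace T"
    and Q: "\<And>i. i \<in> I \<Longrightarrow> openin T (Q i)" "topspace T \<subseteq> (\<Union>i\<in>I. Q i)"
    and P: "\<And>i. i \<in> I \<Longrightarrow> openin S {x \<in> topspace S. f x \<in> Q i}"
    and h: "\<And>i. i \<in> I \<Longrightarrow> homeomorphic_map (subtopology S {x \<in> topspace S. f x \<in> Q i}) (subtopology T (Q i)) f"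
  shows "homeomorphic_map S T f"
proof (rule bijective_open_imp_homeomorphic_map)
  let ?P = "\<lambda>i. {x \<in> topspace S. f x \<in> Q i}"
  have tP: "topspace (subtopology S (?P i)) = ?P i" for i by auto
  have tQ: "topspace (subtopology T (Q i)) = Q i" if "i \<in> I" for i
    using openin_subset[OF Q(1)[OF that]] by auto
  have cov: "\<exists>i\<in>I. f x \<in> Q i" if "x \<in> topspace S" for x using f[OF that] Q(2) by blast
  show "continuous_map S T f"
  proof (rule pasting_lemma[where I = I and T = ?P and f = "\<lambda>_. f"])
    show "continuous_map (subtopology S (?P i)) T f" if "i \<in> I" for i
      using homeomorphic_imp_continuous_map[OF h[OF that]] by (simp add: continuous_map_in_subtopology)
    show "\<exists>j. j \<in> I \<and> x \<in> ?P j \<and> f x = f x" if "x \<in> topspace S" for x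
      using cov[OF that] that by blast
  qed (use P in auto)
  show "open_map S T f"
    unfolding open_map_def
  proof (intro allI impI)
    fix U assume U: "openin S U"
    have "openin T (f ` (U \<inter> ?P i))" if i: "i \<in> I" for i
    proof -
      have "openin (subtopology S (?P i)) (U \<inter> ?P i)"
        using U by (simp add: openin_subtopology_Int)
      then have "openin (subtopology T (Q i)) (f ` (U \<inter> ?P i))"
        using homeomorphic_imp_open_map[OF h[OF i]] unfolding open_map_def by blast
      then show ?thesis using Q(1)[OF i] by (rule openin_trans_full)
    qed
    then have "openin T (\<Union>i\<in>I. f ` (U \<inter> ?P i))" by blast
    moreover have "f ` U = (\<Union>i\<in>I. f ` (U \<inter> ?P i))"
      using cov openin_subset[OF U] by blast
    ultimately show "openin T (f ` U)" by simp
  qed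
  show "f ` topspace S = topspace T"
  proof
    show "f ` topspace S \<subseteq> topspace T" using f by blast
    show "topspace T \<subseteq> f ` topspace S"
    proof
      fix y assume "y \<in> topspace T"
      then obtain i where i: "i \<in> I" "y \<in> Q i" using Q(2) by blast
      then have "y \<in> f ` ?P i"
        using homeomorphic_imp_surjective_map[OF h[OF i(1)]] unfolding tP tQ[OF i(1)] by simp
      then show "y \<in> f ` topspace S" by blast
    qed
  qed
  show "inj_on f (topspace S)"
  proof (rule inj_onI)
    fix x y assume xy: "x \<in> topspace S" "y \<in> topspace S" "f x = f y"
    obtain i where i: "i \<in> I" "f x \<in> Q i" using cov[OF xy(1)] by blast
    have "inj_on f (?P i)" using homeomorphic_imp_injective_map[OF h[OF i(1)]] unfolding tP .
    then show "x = y" by (rule inj_onD) (use xy i in auto)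
  qed
qed

lemma flat_model_determined:
  assumes U: "flat_coords X A D U \<phi>" and m: "m \<in> flat_model (\<phi> ` U)" "m' \<in> flat_model (\<phi> ` U)"
    and x: "fst m = \<phi> x" "fst m' = \<phi> x" "x \<in> U" "x \<notin> D"
  shows "m = m'"
proof -
  have o: "open (\<phi> ` U)" using U topological_chartD(4)[OF local_coords_chart] unfolding flat_coords_def by blast
  have nz: "snd (\<phi> x) \<noteq> 0" using U x unfolding flat_coords_def by blast
  have "snd n = sgn (snd (\<phi> x))" if "n \<in> flat_model (\<phi> ` U)" "fst n = \<phi> x" for n
    using that nz sgn_eq_of_polar[of "snd (\<phi> x)" "snd n"] unfolding flat_model_eq[OF o] by auto
  then show ?thesis using m x by (simp add: prod_eq_iff)
qed

lemma crossing_model_determined: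
  assumes U: "crossing_coords X A D U \<phi>" and m: "m \<in> crossing_model (\<phi> ` U)" "m' \<in> crossing_model (\<phi> ` U)"
    and x: "fst m = \<phi> x" "fst m' = \<phi> x" "x \<in> U" "x \<notin> D"
  shows "m = m'"
proof -
  have o: "open (\<phi> ` U)" using U topological_chartD(4)[OF local_coords_chart] unfolding crossing_coords_def by blast
  have nz: "fst (\<phi> x) * snd (\<phi> x) \<noteq> 0" using U x unfolding crossing_coords_def by blast
  have "snd n = (sgn (fst (\<phi> x)), sgn (snd (\<phi> x)))" if "n \<in> crossing_model (\<phi> ` U)" "fst n = \<phi> x" for n
    using that nz sgn_eq_of_polar[of "fst (\<phi> x)" "fst (snd n)"] sgn_eq_of_polar[of "snd (\<phi> x)" "snd (snd n)"]
    unfolding crossing_model_eq[OF o] by auto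
  then show ?thesis using m x by (simp add: prod_eq_iff)
qed

text \<open>Adds to the data of the theorem the choices its hypotheses permit: charts over
  \<open>W\<close>, model coordinates, and the radius \<open>R0\<close>. With these fixed the
  homeomorphism becomes an explicit function.\<close>

locale blowup_chart =
  fixes X :: "'a topology" and A :: "('a set \<times> ('a \<Rightarrow> complex \<times> complex)) set"
    and D :: "'a set" and z :: 'a
    and Xt :: "'b topology" and At :: "('b set \<times> ('b \<Rightarrow> complex \<times> complex)) set"
    and \<pi> :: "'b \<Rightarrow> 'a" and Dt :: "'b set"
    and W :: "'a set" and w :: "'a \<Rightarrow> complex \<times> complex" and R R0 r :: real
    and B :: "'c topology" and \<rho> :: "'c \<Rightarrow> 'a"
    and Bt :: "'d topology" and \<rho>t :: "'d \<Rightarrow> 'b"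
    and \<pi>t :: "'d \<Rightarrow> 'c"
    and U1 \<psi>1 U2 \<psi>2 \<Phi>W \<Phi>1 \<Phi>2
  assumes S: "complex_surface X A" and nc: "normal_crossings_divisor X A D" and zD: "z \<in> D"
    and pb: "point_blowup X A z Xt At \<pi>" and Dt: "Dt = {x \<in> topspace Xt. \<pi> x \<in> D}"
    and W: "local_coords X A W w" "z \<in> W" "w z = (0, 0)"
    and imW: "w ` W = ball 0 R \<times> ball 0 R" and DW: "D \<inter> W = {x \<in> W. snd (w x) = 0}"
    and r: "0 < r" "r < R0" "R0 < R"
    and rob: "real_oriented_blowup X A D B \<rho>" and robt: "real_oriented_blowup Xt At Dt Bt \<rho>t"
    and cont: "continuous_map Bt B \<pi>t" and comm: "\<And>b. b \<in> topspace Bt \<Longrightarrow> \<rho> (\<pi>t b) = \<pi> (\<rho>t b)"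
    and U1: "local_coords Xt At U1 \<psi>1" and U2: "local_coords Xt At U2 \<psi>2"
    and U12: "U1 \<union> U2 = {x \<in> topspace Xt. \<pi> x \<in> W}"
    and im1: "\<psi>1 ` U1 = {(u, v). (u, u * v) \<in> w ` W}" and im2: "\<psi>2 ` U2 = {(s, t). (s * t, t) \<in> w ` W}"
    and f1: "\<And>x. x \<in> U1 \<Longrightarrow> w (\<pi> x) = (fst (\<psi>1 x), fst (\<psi>1 x) * snd (\<psi>1 x))"
    and f2: "\<And>x. x \<in> U2 \<Longrightarrow> w (\<pi> x) = (fst (\<psi>2 x) * snd (\<psi>2 x), snd (\<psi>2 x))"
    and ov1: "U1 \<inter> U2 = {x \<in> U1. snd (\<psi>1 x) \<noteq> 0}" and ov2: "U1 \<inter> U2 = {x \<in> U2. fst (\<psi>2 x) \<noteq> 0}"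
    and \<Phi>W: "blowup_coords B \<rho> W w (flat_model (w ` W)) \<Phi>W"
    and \<Phi>1: "blowup_coords Bt \<rho>t U1 \<psi>1 (crossing_model (\<psi>1 ` U1)) \<Phi>1"
    and \<Phi>2: "blowup_coords Bt \<rho>t U2 \<psi>2 (flat_model (\<psi>2 ` U2)) \<Phi>2"
begin

lemma St: "complex_surface Xt At"
  using pb unfolding point_blowup_def by blast

lemma pi_continuous: "continuous_map Xt X \<pi>"
  using pb unfolding point_blowup_def by blast

lemma pi_homeo: "homeomorphic_map (subtopology Xt {x \<in> topspace Xt. \<pi> x \<noteq> z}) (subtopology X (topspace X - {z})) \<pi>"
  using pb unfolding point_blowup_def by blast

lemma rho_continuous: "continuous_map B X \<rho>"
  using rob unfolding real_oriented_blowup_def by blast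

lemma rhot_continuous: "continuous_map Bt Xt \<rho>t"
  using robt unfolding real_oriented_blowup_def by blast

lemma pi_in: "x \<in> topspace Xt \<Longrightarrow> \<pi> x \<in> topspace X"
  using pi_continuous by (auto simp: continuous_map_def)

lemma rho_in: "b \<in> topspace B \<Longrightarrow> \<rho> b \<in> topspace X"
  using rho_continuous by (auto simp: continuous_map_def)

lemma rhot_in: "b \<in> topspace Bt \<Longrightarrow> \<rho>t b \<in> topspace Xt"
  using rhot_continuous by (auto simp: continuous_map_def)

lemma pit_in: "b \<in> topspace Bt \<Longrightarrow> \<pi>t b \<in> topspace B"
  using cont by (auto simp: continuous_map_def)

lemma openin_rho: "openin X V \<Longrightarrow> openin B {b \<in> topspace B. \<rho> b \<in> V}"
  using rho_continuous by (rule openin_continuous_map_preimage)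

lemma openin_rhot: "openin Xt V \<Longrightarrow> openin Bt {b \<in> topspace Bt. \<rho>t b \<in> V}"
  using rhot_continuous by (rule openin_continuous_map_preimage)

lemma openin_pi_rhot: "openin X V \<Longrightarrow> openin Bt {b \<in> topspace Bt. \<pi> (\<rho>t b) \<in> V}"
  using openin_continuous_map_preimage[OF continuous_map_compose[OF rhot_continuous pi_continuous], of V] by simp

lemma openW: "openin X W" "W \<subseteq> topspace X" "inj_on w W"
  using topological_chartD[OF local_coords_chart[OF W(1)]] by auto

lemma openU: "openin Xt U1" "openin Xt U2" "U1 \<subseteq> topspace Xt" "U2 \<subseteq> topspace Xt"
  using topological_chartD[OF local_coords_chart[OF U1]] topological_chartD[OF local_coords_chart[OF U2]] by auto

lemma Hausdorff_X: "Hausdorff_space X"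
  using S by (simp add: complex_surface_def)

lemma openin_minus_z: "openin X U \<Longrightarrow> openin X (U - {z})"
  using closedin_Hausdorff_singleton[OF Hausdorff_X, of z] openW W(2) by (intro openin_diff) auto

lemma pull_local:
  "local_coords X A U \<phi> \<Longrightarrow> z \<notin> U \<Longrightarrow> local_coords Xt At {x \<in> topspace Xt. \<pi> x \<in> U} (\<phi> \<circ> \<pi>)"
  using pb unfolding point_blowup_def by blast

lemma pull_flat:
  assumes "flat_coords X A D U \<phi>" "z \<notin> U"
  shows "flat_coords Xt At Dt {x \<in> topspace Xt. \<pi> x \<in> U} (\<phi> \<circ> \<pi>)"
proof -
  have "x \<in> D \<longleftrightarrow> snd (\<phi> x) = 0" if "x \<in> U" for x
    using assms(1) that unfolding flat_coords_def by blast
  then show ?thesis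
    using assms pull_local[of U \<phi>] unfolding flat_coords_def by (auto simp: Dt)
qed

lemma pull_crossing:
  assumes "crossing_coords X A D U \<phi>" "z \<notin> U"
  shows "crossing_coords Xt At Dt {x \<in> topspace Xt. \<pi> x \<in> U} (\<phi> \<circ> \<pi>)"
proof -
  have "x \<in> D \<longleftrightarrow> fst (\<phi> x) * snd (\<phi> x) = 0" if "x \<in> U" for x
    using assms(1) that unfolding crossing_coords_def by blast
  then show ?thesis
    using assms pull_local[of U \<phi>] unfolding crossing_coords_def by (auto simp: Dt)
qed

lemma pi_image:
  assumes "U \<subseteq> topspace X" "z \<notin> U"
  shows "\<pi> ` {x \<in> topspace Xt. \<pi> x \<in> U} = U"
proof
  have t: "topspace (subtopology Xt {x \<in> topspace Xt. \<pi> x \<noteq> z}) = {x \<in> topspace Xt. \<pi> x \<noteq> z}"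
    "topspace (subtopology X (topspace X - {z})) = topspace X - {z}" by auto
  have im: "\<pi> ` {x \<in> topspace Xt. \<pi> x \<noteq> z} = topspace X - {z}"
    using homeomorphic_imp_surjective_map[OF pi_homeo] unfolding t .
  show "U \<subseteq> \<pi> ` {x \<in> topspace Xt. \<pi> x \<in> U}"
  proof
    fix y assume y: "y \<in> U"
    then have "y \<in> \<pi> ` {x \<in> topspace Xt. \<pi> x \<noteq> z}" unfolding im using assms by blast
    then obtain x where "x \<in> topspace Xt" "y = \<pi> x" by blast
    then show "y \<in> \<pi> ` {x \<in> topspace Xt. \<pi> x \<in> U}" using y by blast
  qed
qed blast

lemma flatW: "flat_coords X A D W w"
  using W DW by (simp add: flat_coords_def)

text \<open>The pullback of \<open>w2\<close> is the product of the two coordinates: one factor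
  defines the exceptional divisor, the other the strict transform of \<open>D\<close>.\<close>

lemma crossingU1: "crossing_coords Xt At Dt U1 \<psi>1"
proof -
  have "x \<in> Dt \<longleftrightarrow> fst (\<psi>1 x) * snd (\<psi>1 x) = 0" if x: "x \<in> U1" for x
  proof -
    have "x \<in> topspace Xt" "\<pi> x \<in> W" using U12 x by auto
    then have "x \<in> Dt \<longleftrightarrow> snd (w (\<pi> x)) = 0" using DW unfolding Dt by blast
    then show ?thesis using f1[OF x] by simp
  qed
  then show ?thesis using U1 unfolding crossing_coords_def by blast
qed

text \<open>The pullback of \<open>w2\<close> is the second coordinate, whose zero locus is the
  exceptional divisor; the strict transform does not enter this chart.\<close>

lemma flatU2: "flat_coords Xt At Dt U2 \<psi>2"
proof -
  have "x \<in> Dt \<longleftrightarrow> snd (\<psi>2 x) = 0" if x: "x \<in> U2" for x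
  proof -
    have "x \<in> topspace Xt" "\<pi> x \<in> W" using U12 x by auto
    then have "x \<in> Dt \<longleftrightarrow> snd (w (\<pi> x)) = 0" using DW unfolding Dt by blast
    then show ?thesis using f2[OF x] by simp
  qed
  then show ?thesis using U2 unfolding flat_coords_def by blast
qed

lemma D_cases:
  assumes "x \<in> D" "x \<in> Q" "openin X Q"
  shows "(\<exists>U \<phi>. flat_coords X A D U \<phi> \<and> x \<in> U \<and> U \<subseteq> Q) \<or> (\<exists>U \<phi>. crossing_coords X A D U \<phi> \<and> x \<in> U \<and> U \<subseteq> Q)"
  using normal_crossings_cases[OF S nc assms(1)]
proof (elim disjE exE conjE)
  fix U \<phi> assume U: "flat_coords X A D U \<phi>" "x \<in> U"
  then have "openin X U" using topological_chartD(1)[OF local_coords_chart] unfolding flat_coords_def by blast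
  then have "flat_coords X A D (U \<inter> Q) \<phi>"
    using assms by (intro flat_coords_restrict[OF S U(1)]) auto
  then show ?thesis using U assms by blast
next
  fix U \<phi> assume U: "crossing_coords X A D U \<phi>" "x \<in> U"
  then have "openin X U" using topological_chartD(1)[OF local_coords_chart] unfolding crossing_coords_def by blast
  then have "crossing_coords X A D (U \<inter> Q) \<phi>"
    using assms by (intro crossing_coords_restrict[OF S U(1)]) auto
  then show ?thesis using U assms by blast
qed

lemma D_closed: "closedin X D"
  using nc unfolding normal_crossings_divisor_def
  by (auto simp: smooth_curve_def intro: closedin_locally_finite_Union)

text \<open>Provides the models needed for density upstairs: over \<open>z\<close> from the two
  affine charts, elsewhere by pulling coordinates back along \<open>\<pi>\<close>.\<close>

lemma Dt_cases:
  assumes x: "x \<in> Dt"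
  shows "(\<exists>U \<phi>. flat_coords Xt At Dt U \<phi> \<and> x \<in> U) \<or> (\<exists>U \<phi>. crossing_coords Xt At Dt U \<phi> \<and> x \<in> U)"
proof (cases "\<pi> x = z")
  case True
  then have "x \<in> U1 \<union> U2" using x W(2) unfolding U12 Dt by auto
  then show ?thesis using crossingU1 flatU2 by blast
next
  case False
  have xD: "x \<in> topspace Xt" "\<pi> x \<in> D" "\<pi> x \<in> topspace X - {z}"
    using x False pi_in unfolding Dt by auto
  have "openin X (topspace X - {z})" by (intro openin_minus_z) auto
  from D_cases[OF xD(2,3) this] show ?thesis
  proof (elim disjE exE conjE)
    fix U \<phi> assume U: "flat_coords X A D U \<phi>" "\<pi> x \<in> U" "U \<subseteq> topspace X - {z}"
    then show ?thesis using pull_flat[OF U(1)] xD(1) by blast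
  next
    fix U \<phi> assume U: "crossing_coords X A D U \<phi>" "\<pi> x \<in> U" "U \<subseteq> topspace X - {z}"
    then show ?thesis using pull_crossing[OF U(1)] xD(1) by blast
  qed
qed

lemma Bt_dense: "b \<in> topspace Bt \<Longrightarrow> b \<in> Bt closure_of {b \<in> topspace Bt. \<rho>t b \<notin> Dt}"
  using real_oriented_blowup_dense[OF robt Dt_cases] .

text \<open>Off the divisor a point of the model is determined by its projection, which is
  hypothesis \<open>M\<close>; both sides are continuous, so density gives equality on the boundary
  too.\<close>

lemma lift_agrees:
  fixes M :: "((complex \<times> complex) \<times> 'e::metric_space) set"
  assumes V: "openin X V" and \<Phi>: "blowup_coords B \<rho> V \<phi> M \<Phi>"
    and \<Phi>t: "blowup_coords Bt \<rho>t {x \<in> topspace Xt. \<pi> x \<in> V} (\<phi> \<circ> \<pi>) M \<Phi>t"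
    and M: "\<And>m m' x. m \<in> M \<Longrightarrow> m' \<in> M \<Longrightarrow> fst m = \<phi> x \<Longrightarrow> fst m' = \<phi> x \<Longrightarrow> x \<in> V \<Longrightarrow> x \<notin> D \<Longrightarrow> m = m'"
    and b: "b \<in> topspace Bt" "\<pi> (\<rho>t b) \<in> V"
  shows "\<Phi> (\<pi>t b) = \<Phi>t b"
proof (rule eq_on_open_of_dense[where f = "\<lambda>b. \<Phi> (\<pi>t b)" and g = \<Phi>t and b = b,
      OF Bt_dense openin_pi_rhot[OF V] Hausdorff_space_euclidean])
  let ?P = "{b \<in> topspace Bt. \<pi> (\<rho>t b) \<in> V}" and ?Q = "{b \<in> topspace B. \<rho> b \<in> V}"
  have P: "{b \<in> topspace Bt. \<rho>t b \<in> {x \<in> topspace Xt. \<pi> x \<in> V}} = ?P" using rhot_in by auto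
  show "continuous_map (subtopology Bt ?P) euclidean \<Phi>t"
    using blowup_coordsD(5)[OF \<Phi>t] unfolding P .
  have "continuous_map (subtopology Bt ?P) (subtopology B ?Q) \<pi>t"
    unfolding continuous_map_in_subtopology
    using continuous_map_from_subtopology[OF cont] pit_in comm by auto
  from continuous_map_compose[OF this blowup_coordsD(5)[OF \<Phi>]]
  show "continuous_map (subtopology Bt ?P) euclidean (\<lambda>b. \<Phi> (\<pi>t b))" by (simp add: o_def)
  fix b assume b: "b \<in> ?P" "b \<in> {b \<in> topspace Bt. \<rho>t b \<notin> Dt}"
  have bB: "\<pi>t b \<in> topspace B" "\<rho> (\<pi>t b) = \<pi> (\<rho>t b)" "\<rho>t b \<in> topspace Xt"
    using pit_in comm rhot_in b by auto
  show "\<Phi> (\<pi>t b) = \<Phi>t b"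
  proof (rule M[where x = "\<pi> (\<rho>t b)"])
    show "\<Phi> (\<pi>t b) \<in> M" "fst (\<Phi> (\<pi>t b)) = \<phi> (\<pi> (\<rho>t b))"
      using blowup_coordsD(1,2)[OF \<Phi>, of "\<pi>t b"] bB b by auto
    show "\<Phi>t b \<in> M" "fst (\<Phi>t b) = \<phi> (\<pi> (\<rho>t b))"
      using blowup_coordsD(1,2)[OF \<Phi>t, of b] bB b by auto
    show "\<pi> (\<rho>t b) \<in> V" "\<pi> (\<rho>t b) \<notin> D" using b bB by (auto simp: Dt)
  qed
qed (use b in auto)

lemma lift_homeo:
  fixes M :: "((complex \<times> complex) \<times> 'e::metric_space) set"
  assumes V: "openin X V" and \<Phi>: "blowup_coords B \<rho> V \<phi> M \<Phi>"
    and \<Phi>t: "blowup_coords Bt \<rho>t {x \<in> topspace Xt. \<pi> x \<in> V} (\<phi> \<circ> \<pi>) M \<Phi>t"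
    and M: "\<And>m m' x. m \<in> M \<Longrightarrow> m' \<in> M \<Longrightarrow> fst m = \<phi> x \<Longrightarrow> fst m' = \<phi> x \<Longrightarrow> x \<in> V \<Longrightarrow> x \<notin> D \<Longrightarrow> m = m'"
  shows "homeomorphic_map (subtopology Bt {b \<in> topspace Bt. \<pi> (\<rho>t b) \<in> V}) (subtopology B {b \<in> topspace B. \<rho> b \<in> V}) \<pi>t"
proof (rule homeomorphic_map_lift[OF blowup_coordsD(6)[OF \<Phi>]])
  have P: "{b \<in> topspace Bt. \<rho>t b \<in> {x \<in> topspace Xt. \<pi> x \<in> V}} = {b \<in> topspace Bt. \<pi> (\<rho>t b) \<in> V}"
    using rhot_in by auto
  show "homeomorphic_map (subtopology Bt {b \<in> topspace Bt. \<pi> (\<rho>t b) \<in> V}) (top_of_set M) \<Phi>t"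
    using blowup_coordsD(6)[OF \<Phi>t] unfolding P .
  fix b assume "b \<in> topspace (subtopology Bt {b \<in> topspace Bt. \<pi> (\<rho>t b) \<in> V})"
  then have b: "b \<in> topspace Bt" "\<pi> (\<rho>t b) \<in> V" by auto
  then show "\<pi>t b \<in> topspace (subtopology B {b \<in> topspace B. \<rho> b \<in> V})"
    using pit_in comm by auto
  show "\<Phi> (\<pi>t b) = \<Phi>t b" by (rule lift_agrees[OF V \<Phi> \<Phi>t M b])
qed

lemma flat_lift:
  assumes U: "flat_coords X A D U \<phi>" "z \<notin> U"
  obtains \<Phi> \<Phi>t where "blowup_coords B \<rho> U \<phi> (flat_model (\<phi> ` U)) \<Phi>"
    "blowup_coords Bt \<rho>t {x \<in> topspace Xt. \<pi> x \<in> U} (\<phi> \<circ> \<pi>) (flat_model (\<phi> ` U)) \<Phi>t"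
proof -
  have UX: "U \<subseteq> topspace X" using U topological_chartD(2)[OF local_coords_chart] unfolding flat_coords_def by blast
  have im: "(\<phi> \<circ> \<pi>) ` {x \<in> topspace Xt. \<pi> x \<in> U} = \<phi> ` U"
    unfolding image_comp[symmetric] pi_image[OF UX U(2)] ..
  obtain \<Phi> where "blowup_coords B \<rho> U \<phi> (flat_model (\<phi> ` U)) \<Phi>"
    using rob U(1) unfolding real_oriented_blowup_def by blast
  moreover obtain \<Phi>t where "blowup_coords Bt \<rho>t {x \<in> topspace Xt. \<pi> x \<in> U} (\<phi> \<circ> \<pi>) (flat_model ((\<phi> \<circ> \<pi>) ` {x \<in> topspace Xt. \<pi> x \<in> U})) \<Phi>t"
    using robt pull_flat[OF U] unfolding real_oriented_blowup_def by blast
  ultimately show ?thesis using that unfolding im by blast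
qed

lemma flat_lift_homeo:
  assumes U: "flat_coords X A D U \<phi>" "z \<notin> U"
  shows "homeomorphic_map (subtopology Bt {b \<in> topspace Bt. \<pi> (\<rho>t b) \<in> U}) (subtopology B {b \<in> topspace B. \<rho> b \<in> U}) \<pi>t"
proof -
  have o: "openin X U" using U topological_chartD(1)[OF local_coords_chart] unfolding flat_coords_def by blast
  obtain \<Phi> \<Phi>t where "blowup_coords B \<rho> U \<phi> (flat_model (\<phi> ` U)) \<Phi>"
    "blowup_coords Bt \<rho>t {x \<in> topspace Xt. \<pi> x \<in> U} (\<phi> \<circ> \<pi>) (flat_model (\<phi> ` U)) \<Phi>t"
    using flat_lift[OF U] .
  from lift_homeo[OF o this flat_model_determined[OF U(1)]] show ?thesis .
qed

lemma crossing_lift_homeo: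
  assumes U: "crossing_coords X A D U \<phi>" "z \<notin> U"
  shows "homeomorphic_map (subtopology Bt {b \<in> topspace Bt. \<pi> (\<rho>t b) \<in> U}) (subtopology B {b \<in> topspace B. \<rho> b \<in> U}) \<pi>t"
proof -
  have UX: "openin X U" "U \<subseteq> topspace X"
    using U topological_chartD(1,2)[OF local_coords_chart] unfolding crossing_coords_def by blast+
  have im: "(\<phi> \<circ> \<pi>) ` {x \<in> topspace Xt. \<pi> x \<in> U} = \<phi> ` U"
    unfolding image_comp[symmetric] pi_image[OF UX(2) U(2)] ..
  obtain \<Phi> where \<Phi>: "blowup_coords B \<rho> U \<phi> (crossing_model (\<phi> ` U)) \<Phi>"
    using rob U(1) unfolding real_oriented_blowup_def by blast
  obtain \<Phi>t where "blowup_coords Bt \<rho>t {x \<in> topspace Xt. \<pi> x \<in> U} (\<phi> \<circ> \<pi>) (crossing_model ((\<phi> \<circ> \<pi>) ` {x \<in> topspace Xt. \<pi> x \<in> U})) \<Phi>t"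
    using robt pull_crossing[OF U] unfolding real_oriented_blowup_def by blast
  from lift_homeo[OF UX(1) \<Phi> this[unfolded im] crossing_model_determined[OF U(1)]] show ?thesis .
qed

text \<open>Over \<open>V\<close> the maps \<open>\<rho>\<close>, \<open>\<rho>t\<close> and
  \<open>\<pi>\<close> are all homeomorphisms, and \<open>\<pi>t\<close> is tied to them by the
  commuting square.\<close>

lemma off_divisor_lift_homeo:
  assumes V: "openin X V" "V \<inter> D = {}"
  shows "homeomorphic_map (subtopology Bt {b \<in> topspace Bt. \<pi> (\<rho>t b) \<in> V}) (subtopology B {b \<in> topspace B. \<rho> b \<in> V}) \<pi>t"
proof (rule homeomorphic_map_lift)
  let ?P = "{b \<in> topspace Bt. \<pi> (\<rho>t b) \<in> V}" and ?Q = "{b \<in> topspace B. \<rho> b \<in> V}"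
    and ?V = "{x \<in> topspace Xt. \<pi> x \<in> V}"
  have VX: "V \<subseteq> topspace X" "z \<notin> V" using V openin_subset zD by blast+
  have "homeomorphic_map (subtopology (subtopology B {b \<in> topspace B. \<rho> b \<notin> D}) ?Q)
      (subtopology (subtopology X (topspace X - D)) V) \<rho>"
    by (rule homeomorphic_map_subtopologies_alt)
      (use rob in \<open>auto simp: real_oriented_blowup_def\<close>)
  moreover have "{b \<in> topspace B. \<rho> b \<notin> D} \<inter> ?Q = ?Q" "(topspace X - D) \<inter> V = V" using V VX by auto
  ultimately show "homeomorphic_map (subtopology B ?Q) (subtopology X V) \<rho>"
    by (simp add: subtopology_subtopology)
  have "homeomorphic_map (subtopology (subtopology Bt {b \<in> topspace Bt. \<rho>t b \<notin> Dt}) ?P)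
      (subtopology (subtopology Xt (topspace Xt - Dt)) ?V) \<rho>t"
    by (rule homeomorphic_map_subtopologies_alt)
      (use robt in \<open>auto simp: real_oriented_blowup_def\<close>)
  moreover have "{b \<in> topspace Bt. \<rho>t b \<notin> Dt} \<inter> ?P = ?P" "(topspace Xt - Dt) \<inter> ?V = ?V"
    using V by (auto simp: Dt)
  ultimately have 1: "homeomorphic_map (subtopology Bt ?P) (subtopology Xt ?V) \<rho>t"
    by (simp add: subtopology_subtopology)
  have "homeomorphic_map (subtopology (subtopology Xt {x \<in> topspace Xt. \<pi> x \<noteq> z}) ?V)
      (subtopology (subtopology X (topspace X - {z})) V) \<pi>"
    by (rule homeomorphic_map_subtopologies_alt[OF pi_homeo]) auto
  moreover have "{x \<in> topspace Xt. \<pi> x \<noteq> z} \<inter> ?V = ?V" "(topspace X - {z}) \<inter> V = V" using VX by auto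
  ultimately have "homeomorphic_map (subtopology Xt ?V) (subtopology X V) \<pi>"
    by (simp add: subtopology_subtopology)
  from homeomorphic_map_compose[OF 1 this]
  show "homeomorphic_map (subtopology Bt ?P) (subtopology X V) (\<pi> \<circ> \<rho>t)" .
qed (use pit_in comm in auto)

end

text \<open>Away from the centre at most one axis passes nearby; if it is the axis
  \<open>fst = 0\<close>, exchanging the coordinates makes it flat.\<close>

lemma crossing_coords_off_center:
  assumes S: "complex_surface X A" and U: "crossing_coords X A D U \<phi>" and x: "x \<in> U" "x \<in> D" "\<phi> x \<noteq> (0, 0)"
  shows "ordinary_point X A D x"
proof -
  have lU: "local_coords X A U \<phi>" using U by (simp add: crossing_coords_def)
  note cU = local_coords_chart[OF lU]
  have DU: "y \<in> D \<longleftrightarrow> fst (\<phi> y) = 0 \<or> snd (\<phi> y) = 0" if "y \<in> U" for y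
    using U that unfolding crossing_coords_def by auto
  show ?thesis
  proof (cases "fst (\<phi> x) = 0")
    case False
    let ?V = "{y \<in> U. \<phi> y \<in> {p. fst p \<noteq> 0}}"
    have "open {p::complex \<times> complex. fst p \<noteq> 0}" by (intro open_Collect_neq continuous_intros)
    then have "local_coords X A ?V \<phi>"
      by (intro local_coords_restrict[OF S lU] topological_chart_open_vimage[OF cU]) auto
    moreover have "D \<inter> ?V = {y \<in> ?V. snd (\<phi> y) = 0}" using DU by auto
    ultimately have "flat_coords X A D ?V \<phi>" unfolding flat_coords_def by blast
    then show ?thesis using x False unfolding ordinary_point_def by blast
  next
    case True
    then have x2: "snd (\<phi> x) \<noteq> 0" using x(3) by (simp add: prod_eq_iff)
    let ?N = "\<phi> ` U \<inter> {p. snd p \<noteq> 0}"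
    let ?V = "{y \<in> U. \<phi> y \<in> ?N}"
    have "open {p::complex \<times> complex. snd p \<noteq> 0}" by (intro open_Collect_neq continuous_intros)
    then have oN: "open ?N" using topological_chartD(4)[OF cU] by blast
    have der: "complex_derivative2 prod.swap 0 1 1 0 p" for p
    proof -
      have "((\<lambda>p. (snd p, fst p)) has_derivative (\<lambda>(h, k). (0 * h + 1 * k, 1 * h + 0 * k))) (at p)"
        by (rule has_derivative_eq_rhs[OF has_derivative_Pair[OF has_derivative_snd[OF has_derivative_ident]
            has_derivative_fst[OF has_derivative_ident]]]) auto
      then show ?thesis unfolding complex_derivative2_def prod.swap_def by (simp add: case_prod_beta)
    qed
    have "local_coords X A ?V (prod.swap \<circ> \<phi>)"
    proof (rule local_coords_compose[OF S lU oN])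
      show "\<exists>a b c d. complex_derivative2 prod.swap a b c d p \<and> a * d - b * c \<noteq> 0" for p
        by (intro exI conjI, rule der) simp
    qed auto
    moreover have "D \<inter> ?V = {y \<in> ?V. snd ((prod.swap \<circ> \<phi>) y) = 0}" using DU by auto
    ultimately have "flat_coords X A D ?V (prod.swap \<circ> \<phi>)" unfolding flat_coords_def by blast
    then show ?thesis using x x2 unfolding ordinary_point_def by blast
  qed
qed

lemma canonical_action_ordinary:
  assumes "canonical_action X A D B \<rho> \<Theta> b b'"
  shows "b \<in> topspace B" "b' \<in> topspace B" "ordinary_point X A D (\<rho> b)"
proof -
  obtain U \<phi> \<Phi> v t where U: "flat_coords X A D U \<phi>" "blowup_coords B \<rho> U \<phi> (flat_model (\<phi> ` U)) \<Phi>"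
    and b: "b \<in> topspace B" "b' \<in> topspace B" "\<rho> b \<in> U" and \<Phi>: "\<Phi> b = ((v, 0), t)"
    using assms unfolding canonical_action_def by blast
  show "b \<in> topspace B" "b' \<in> topspace B" using b by auto
  have "snd (\<phi> (\<rho> b)) = 0" using blowup_coordsD(2)[OF U(2) b(1,3)] \<Phi> by (metis fst_conv snd_conv)
  then have "\<rho> b \<in> D" using U(1) b(3) unfolding flat_coords_def by blast
  then show "ordinary_point X A D (\<rho> b)" using U b unfolding ordinary_point_def by blast
qed

lemma continuous_on_polar_map:
  assumes "continuous_on UNIV g"
  shows "continuous_on M (polar_map g)"
  unfolding polar_map_def case_prod_beta
  by (intro continuous_intros continuous_on_compose2[OF assms]) auto

context blowup_chart
begin

section \<open>The homeomorphism over the coordinate neighbourhood\<close>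

lemma modelW: "flat_model (w ` W) = flat_ball_model R"
proof -
  have "open (w ` W)" by (rule topological_chartD(4)[OF local_coords_chart[OF W(1)]])
  from flat_model_eq[OF this] show ?thesis unfolding imW flat_ball_model_def by auto
qed

lemma model1: "crossing_model (\<psi>1 ` U1) = crossing_chart_model R"
proof -
  have "open (\<psi>1 ` U1)" by (rule topological_chartD(4)[OF local_coords_chart[OF U1]])
  from crossing_model_eq[OF this] show ?thesis unfolding im1 imW crossing_chart_model_def by auto
qed

lemma model2: "flat_model (\<psi>2 ` U2) = flat_chart_model R"
proof -
  have "open (\<psi>2 ` U2)" by (rule topological_chartD(4)[OF local_coords_chart[OF U2]])
  from flat_model_eq[OF this] show ?thesis unfolding im2 imW flat_chart_model_def by auto
qed

lemma homeo1: "homeomorphic_map (subtopology Bt {b \<in> topspace Bt. \<rho>t b \<in> U1})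
    (top_of_set (half_space_model R \<inter> {(n, p, t). p \<noteq> 0})) (crossing_chart_to_half_space \<circ> \<Phi>1)"
  using homeomorphic_map_compose[OF blowup_coordsD(6)[OF \<Phi>1[unfolded model1]] homeomorphic_map_crossing_chart] .

lemma homeo2: "homeomorphic_map (subtopology Bt {b \<in> topspace Bt. \<rho>t b \<in> U2})
    (top_of_set (half_space_model R \<inter> {(n, p, t). cmod p < 1})) (flat_chart_to_half_space \<circ> \<Phi>2)"
  using homeomorphic_map_compose[OF blowup_coordsD(6)[OF \<Phi>2[unfolded model2]] homeomorphic_map_flat_chart] .

lemma half_space_in1:
  assumes "b \<in> topspace Bt" "\<rho>t b \<in> U1"
  shows "crossing_chart_to_half_space (\<Phi>1 b) \<in> half_space_model R \<inter> {(n, p, t). p \<noteq> 0}"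
proof -
  have "(crossing_chart_to_half_space \<circ> \<Phi>1) b \<in> (crossing_chart_to_half_space \<circ> \<Phi>1) ` topspace (subtopology Bt {b \<in> topspace Bt. \<rho>t b \<in> U1})"
    using assms by (intro imageI) simp
  then show ?thesis unfolding homeomorphic_imp_surjective_map[OF homeo1] by simp
qed

lemma half_space_in2:
  assumes "b \<in> topspace Bt" "\<rho>t b \<in> U2"
  shows "flat_chart_to_half_space (\<Phi>2 b) \<in> half_space_model R \<inter> {(n, p, t). cmod p < 1}"
proof -
  have "(flat_chart_to_half_space \<circ> \<Phi>2) b \<in> (flat_chart_to_half_space \<circ> \<Phi>2) ` topspace (subtopology Bt {b \<in> topspace Bt. \<rho>t b \<in> U2})"
    using assms by (intro imageI) simp
  then show ?thesis unfolding homeomorphic_imp_surjective_map[OF homeo2] by simp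
qed

lemma half_space_generic1:
  assumes b: "b \<in> topspace Bt" "\<rho>t b \<in> U1" "\<rho>t b \<notin> Dt"
  shows "crossing_chart_to_half_space (\<Phi>1 b) = half_space_point (w (\<pi> (\<rho>t b)))"
proof -
  note D = blowup_coordsD(1,2)[OF \<Phi>1[unfolded model1] b(1,2)]
  have "fst (\<psi>1 (\<rho>t b)) * snd (\<psi>1 (\<rho>t b)) \<noteq> 0"
    using crossingU1 b(2,3) unfolding crossing_coords_def by blast
  then show ?thesis
    using crossing_chart_to_half_space_generic[OF D(1)] unfolding D(2) f1[OF b(2)] by blast
qed

lemma half_space_generic2:
  assumes b: "b \<in> topspace Bt" "\<rho>t b \<in> U2" "\<rho>t b \<notin> Dt"
  shows "flat_chart_to_half_space (\<Phi>2 b) = half_space_point (w (\<pi> (\<rho>t b)))"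
proof -
  note D = blowup_coordsD(1,2)[OF \<Phi>2[unfolded model2] b(1,2)]
  have "snd (\<psi>2 (\<rho>t b)) \<noteq> 0"
    using flatU2 b(2,3) unfolding flat_coords_def by blast
  then show ?thesis
    using flat_chart_to_half_space_generic[OF D(1)] unfolding D(2) f2[OF b(2)] by blast
qed

text \<open>Off the divisor both sides equal \<open>half_space_point\<close> of the same point;
  density extends this to the boundary.\<close>

lemma half_space_agree:
  assumes b: "b \<in> topspace Bt" "\<rho>t b \<in> U1" "\<rho>t b \<in> U2"
  shows "crossing_chart_to_half_space (\<Phi>1 b) = flat_chart_to_half_space (\<Phi>2 b)"
proof -
  let ?O = "{b \<in> topspace Bt. \<rho>t b \<in> U1 \<inter> U2}"
  have o: "openin Bt ?O" using openU by (intro openin_rhot) auto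
  have c1: "continuous_map (subtopology Bt {b \<in> topspace Bt. \<rho>t b \<in> U1}) euclidean (crossing_chart_to_half_space \<circ> \<Phi>1)"
    using homeomorphic_imp_continuous_map[OF homeo1] by (simp add: continuous_map_in_subtopology)
  have c2: "continuous_map (subtopology Bt {b \<in> topspace Bt. \<rho>t b \<in> U2}) euclidean (flat_chart_to_half_space \<circ> \<Phi>2)"
    using homeomorphic_imp_continuous_map[OF homeo2] by (simp add: continuous_map_in_subtopology)
  have "(crossing_chart_to_half_space \<circ> \<Phi>1) b = (flat_chart_to_half_space \<circ> \<Phi>2) b"
  proof (rule eq_on_open_of_dense[OF Bt_dense o Hausdorff_space_euclidean])
    show "continuous_map (subtopology Bt ?O) euclidean (crossing_chart_to_half_space \<circ> \<Phi>1)"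
      by (rule continuous_map_from_subtopology_mono[OF c1]) auto
    show "continuous_map (subtopology Bt ?O) euclidean (flat_chart_to_half_space \<circ> \<Phi>2)"
      by (rule continuous_map_from_subtopology_mono[OF c2]) auto
    show "(crossing_chart_to_half_space \<circ> \<Phi>1) b = (flat_chart_to_half_space \<circ> \<Phi>2) b"
      if "b \<in> ?O" "b \<in> {b \<in> topspace Bt. \<rho>t b \<notin> Dt}" for b
      using that half_space_generic1[of b] half_space_generic2[of b] by simp
    show "b \<in> ?O" using b by simp
  qed
  then show ?thesis by simp
qed

definition half_space_coords :: "'d \<Rightarrow> real \<times> complex \<times> complex" where
  "half_space_coords b =
     (if \<rho>t b \<in> U1 then crossing_chart_to_half_space (\<Phi>1 b) else flat_chart_to_half_space (\<Phi>2 b))"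

lemma half_space_coords2:
  "b \<in> topspace Bt \<Longrightarrow> \<rho>t b \<in> U2 \<Longrightarrow> half_space_coords b = flat_chart_to_half_space (\<Phi>2 b)"
  by (simp add: half_space_coords_def half_space_agree)

abbreviation PW :: "'d set" where "PW \<equiv> {b \<in> topspace Bt. \<pi> (\<rho>t b) \<in> W}"

lemma PW_cases: "b \<in> PW \<Longrightarrow> \<rho>t b \<in> U1 \<or> \<rho>t b \<in> U2"
  using U12 rhot_in by blast

lemma PW_open: "openin Bt PW"
  by (rule openin_pi_rhot[OF openW(1)])

text \<open>Needed to recognise preimages as chart domains when gluing: a point outside
  \<open>U1\<close> has \<open>s = 0\<close> in the other chart, hence \<open>p = 0\<close>.\<close>

lemma half_space_coords_in1:
  assumes b: "b \<in> PW"
  shows "half_space_coords b \<in> half_space_model R \<inter> {(n, p, t). p \<noteq> 0} \<longleftrightarrow> \<rho>t b \<in> U1"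
proof (cases "\<rho>t b \<in> U1")
  case True
  then show ?thesis using half_space_in1[of b] b by (simp add: half_space_coords_def)
next
  case False
  then have 2: "\<rho>t b \<in> U2" using PW_cases[OF b] by blast
  then have "fst (\<psi>2 (\<rho>t b)) = 0" using False ov2 by blast
  then have "fst (fst (\<Phi>2 b)) = 0" using blowup_coordsD(2)[OF \<Phi>2, of b] b 2 by simp
  then have "fst (snd (half_space_coords b)) = 0"
    using False by (simp add: half_space_coords_def flat_chart_to_half_space_def case_prod_beta)
  then show ?thesis using False by auto
qed

text \<open>A point outside \<open>U2\<close> has \<open>v = 0\<close> in the first chart, hence
  \<open>cmod p = 1\<close>.\<close>

lemma half_space_coords_in2:
  assumes b: "b \<in> PW"
  shows "half_space_coords b \<in> half_space_model R \<inter> {(n, p, t). cmod p < 1} \<longleftrightarrow> \<rho>t b \<in> U2"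
proof (cases "\<rho>t b \<in> U2")
  case True
  then show ?thesis using half_space_in2[of b] half_space_coords2[of b] b by simp
next
  case False
  then have 1: "\<rho>t b \<in> U1" using PW_cases[OF b] by blast
  then have "snd (\<psi>1 (\<rho>t b)) = 0" using False ov1 by blast
  then have 0: "snd (fst (\<Phi>1 b)) = 0" using blowup_coordsD(2)[OF \<Phi>1, of b] b 1 by simp
  have "\<Phi>1 b \<in> crossing_chart_model R" using blowup_coordsD(1)[OF \<Phi>1[unfolded model1], of b] b 1 by simp
  then have "cmod (fst (snd (\<Phi>1 b))) = 1" unfolding crossing_chart_model_def by auto
  then have "cmod (fst (snd (half_space_coords b))) = 1"
    using 0 1 by (simp add: half_space_coords_def crossing_chart_to_half_space_def case_prod_beta)
  then show ?thesis using False by auto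
qed

lemma half_space_coords_homeo:
  "homeomorphic_map (subtopology Bt PW) (top_of_set (half_space_model R)) half_space_coords"
proof (rule homeomorphic_map_glue)
  let ?Q = "\<lambda>i. half_space_model R \<inter> (if i then {(n, p, t). p \<noteq> 0} else {(n, p, t). cmod p < 1})"
  let ?U = "\<lambda>i. if i then U1 else U2"
  have tPW: "topspace (subtopology Bt PW) = PW" by auto
  have pre: "{b \<in> topspace (subtopology Bt PW). half_space_coords b \<in> ?Q i} = {b \<in> topspace Bt. \<rho>t b \<in> ?U i}" for i
  proof -
    have key: "half_space_coords b \<in> ?Q i \<longleftrightarrow> \<rho>t b \<in> ?U i" if "b \<in> PW" for b
      using half_space_coords_in1[OF that] half_space_coords_in2[OF that]
      by (cases i) (simp_all only: if_True if_False)
    have "?U i \<subseteq> {x \<in> topspace Xt. \<pi> x \<in> W}" using U12 by auto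
    then show ?thesis unfolding tPW using key by blast
  qed
  have sub: "{b \<in> topspace Bt. \<rho>t b \<in> ?U i} \<subseteq> PW" for i using U12 by auto
  show "openin (top_of_set (half_space_model R)) (?Q i)" for i
  proof -
    have "open {(n::real, p::complex, t::complex). p \<noteq> 0}" "open {(n::real, p::complex, t::complex). cmod p < 1}"
      unfolding case_prod_beta by (intro open_Collect_neq open_Collect_less continuous_intros)+
    then show ?thesis by (cases i) (auto intro: openin_open_Int)
  qed
  show "half_space_coords b \<in> topspace (top_of_set (half_space_model R))"
    if "b \<in> topspace (subtopology Bt PW)" for b
  proof -
    have "b \<in> PW" using that unfolding tPW .
    then show ?thesis using half_space_coords_in1[of b] half_space_coords_in2[of b] PW_cases[of b] by auto
  qed
  show "topspace (top_of_set (half_space_model R)) \<subseteq> (\<Union>i\<in>UNIV. ?Q i)"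
  proof
    fix m assume "m \<in> topspace (top_of_set (half_space_model R))"
    then have "m \<in> ?Q True \<or> m \<in> ?Q False" by (cases m) auto
    then show "m \<in> (\<Union>i\<in>UNIV. ?Q i)" by blast
  qed
  fix i :: bool
  have "openin Bt {b \<in> topspace Bt. \<rho>t b \<in> ?U i}" using openU by (intro openin_rhot) auto
  then show "openin (subtopology Bt PW) {b \<in> topspace (subtopology Bt PW). half_space_coords b \<in> ?Q i}"
    unfolding pre using sub by (simp only: openin_open_subtopology[OF PW_open])
  have "homeomorphic_map (subtopology Bt {b \<in> topspace Bt. \<rho>t b \<in> ?U i}) (top_of_set (?Q i)) half_space_coords"
  proof (cases i)
    case True
    then show ?thesis using homeomorphic_map_eq[OF homeo1, of half_space_coords]
      by (simp add: half_space_coords_def)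
  next
    case False
    then show ?thesis using homeomorphic_map_eq[OF homeo2, of half_space_coords]
      by (simp add: half_space_coords2)
  qed
  moreover have "PW \<inter> {b \<in> topspace Bt. \<rho>t b \<in> ?U i} = {b \<in> topspace Bt. \<rho>t b \<in> ?U i}"
    using sub[of i] by blast
  moreover have "half_space_model R \<inter> ?Q i = ?Q i" by auto
  ultimately show "homeomorphic_map (subtopology (subtopology Bt PW) {b \<in> topspace (subtopology Bt PW). half_space_coords b \<in> ?Q i})
      (subtopology (top_of_set (half_space_model R)) (?Q i)) half_space_coords"
    unfolding pre subtopology_subtopology by (simp only:)
qed

lemma half_space_coords_generic:
  assumes "b \<in> PW" "\<rho>t b \<notin> Dt"
  shows "half_space_coords b = half_space_point (w (\<pi> (\<rho>t b)))"
  using assms half_space_generic1[of b] half_space_generic2[of b] PW_cases[of b]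
  by (auto simp: half_space_coords_def)

lemma lift_in_PW: "b \<in> PW \<Longrightarrow> \<pi>t b \<in> topspace B \<and> \<rho> (\<pi>t b) \<in> W"
  using pit_in comm by auto

text \<open>The lift is given only abstractly; off the divisor both sides consist of
  \<open>w\<close> and the angle of its second component, and density identifies them everywhere
  over \<open>W\<close>.\<close>

lemma lift_polar:
  assumes b: "b \<in> PW"
  shows "\<Phi>W (\<pi>t b) = polar_map (\<lambda>n. n) (half_space_coords b)"
proof (rule eq_on_open_of_dense[where f = "\<lambda>b. \<Phi>W (\<pi>t b)" and b = b
      and g = "\<lambda>b. polar_map (\<lambda>n. n) (half_space_coords b)", OF Bt_dense PW_open Hausdorff_space_euclidean])
  have "continuous_map (subtopology Bt PW) (subtopology B {b \<in> topspace B. \<rho> b \<in> W}) \<pi>t"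
    unfolding continuous_map_in_subtopology
    using continuous_map_from_subtopology[OF cont] lift_in_PW by auto
  from continuous_map_compose[OF this blowup_coordsD(5)[OF \<Phi>W]]
  show "continuous_map (subtopology Bt PW) euclidean (\<lambda>b. \<Phi>W (\<pi>t b))" by (simp add: o_def)
  have "continuous_map (subtopology Bt PW) euclidean half_space_coords"
    using homeomorphic_imp_continuous_map[OF half_space_coords_homeo] by (simp add: continuous_map_in_subtopology)
  moreover have "continuous_map euclidean euclidean (polar_map (\<lambda>n. n))"
    using continuous_on_polar_map[OF continuous_on_id, of UNIV] by (simp add: id_def)
  ultimately have "continuous_map (subtopology Bt PW) euclidean (polar_map (\<lambda>n. n) \<circ> half_space_coords)"
    by (rule continuous_map_compose)
  then show "continuous_map (subtopology Bt PW) euclidean (\<lambda>b. polar_map (\<lambda>n. n) (half_space_coords b))"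
    by (simp add: o_def)
  fix b assume b: "b \<in> PW" "b \<in> {b \<in> topspace Bt. \<rho>t b \<notin> Dt}"
  let ?x = "\<pi> (\<rho>t b)"
  have bB: "\<pi>t b \<in> topspace B" "\<rho> (\<pi>t b) = ?x" "?x \<in> W" "?x \<notin> D"
    using b pit_in comm rhot_in by (auto simp: Dt)
  have nz: "snd (w ?x) \<noteq> 0" using bB(3,4) DW by blast
  have \<Phi>: "\<Phi>W (\<pi>t b) \<in> flat_ball_model R" "fst (\<Phi>W (\<pi>t b)) = w ?x"
    using blowup_coordsD(1,2)[OF \<Phi>W[unfolded modelW], of "\<pi>t b"] bB by auto
  then have "snd (w ?x) = of_real (cmod (snd (w ?x))) * snd (\<Phi>W (\<pi>t b))"
    by (cases "w ?x") (auto simp: flat_ball_model_def)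
  from sgn_eq_of_polar[OF this nz] have "\<Phi>W (\<pi>t b) = (w ?x, sgn (snd (w ?x)))"
    using \<Phi>(2) by (simp add: prod_eq_iff)
  also have "\<dots> = polar_map (\<lambda>n. n) (half_space_point (w ?x))"
    using polar_map_half_space_point[OF nz, of "fst (w ?x)"] by simp
  also have "\<dots> = polar_map (\<lambda>n. n) (half_space_coords b)"
    using half_space_coords_generic[of b] b by simp
  finally show "\<Phi>W (\<pi>t b) = polar_map (\<lambda>n. n) (half_space_coords b)" .
qed (use b in auto)

lemma polar_coords:
  assumes b: "b \<in> PW" and \<kappa>: "half_space_coords b = (n, p, t)"
  shows "0 \<le> n" "cmod p \<le> 1" "cmod t = 1"
    "w (\<pi> (\<rho>t b)) = (of_real n * p, of_real (n * (1 - cmod p)) * t)"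
    "cmod (fst (w (\<pi> (\<rho>t b)))) + cmod (snd (w (\<pi> (\<rho>t b)))) = n"
proof -
  have "half_space_coords b \<in> half_space_model R"
    using half_space_coords_in1[OF b] half_space_coords_in2[OF b] PW_cases[OF b] by blast
  then show *: "0 \<le> n" "cmod p \<le> 1" "cmod t = 1" unfolding \<kappa> half_space_model_def by auto
  have "w (\<pi> (\<rho>t b)) = fst (\<Phi>W (\<pi>t b))"
    using blowup_coordsD(2)[OF \<Phi>W] lift_in_PW[OF b] comm b by simp
  then show w: "w (\<pi> (\<rho>t b)) = (of_real n * p, of_real (n * (1 - cmod p)) * t)"
    unfolding lift_polar[OF b] \<kappa> polar_map_def by simp
  have "cmod (of_real n * p) = n * cmod p" using * by (simp add: norm_mult)
  moreover have "cmod (of_real (n * (1 - cmod p)) * t) = n * (1 - cmod p)"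
    using * by (intro cmod_of_real_mult) auto
  ultimately show "cmod (fst (w (\<pi> (\<rho>t b)))) + cmod (snd (w (\<pi> (\<rho>t b)))) = n"
    unfolding w fst_conv snd_conv by (simp add: algebra_simps)
qed

text \<open>The clauses fit together because the first already equals \<open>\<pi>t\<close> outside
  a compact subset of \<open>W\<close>.\<close>

definition h :: "'d \<Rightarrow> 'c" where
  "h b = (if \<pi> (\<rho>t b) \<in> W
     then inv_into {b \<in> topspace B. \<rho> b \<in> W} \<Phi>W (polar_map (spread r R0) (half_space_coords b))
     else \<pi>t b)"

lemma spread_homeo: "homeomorphic_map (subtopology Bt PW) (top_of_set (flat_ball_model R))
    (polar_map (spread r R0) \<circ> half_space_coords)"
  by (rule homeomorphic_map_compose[OF half_space_coords_homeo homeomorphic_map_spread[OF r]])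

lemma h_PW:
  assumes b: "b \<in> PW"
  shows "h b \<in> topspace B" "\<rho> (h b) \<in> W" "\<Phi>W (h b) = polar_map (spread r R0) (half_space_coords b)"
proof -
  let ?m = "polar_map (spread r R0) (half_space_coords b)" and ?Q = "{b \<in> topspace B. \<rho> b \<in> W}"
  have "?m \<in> flat_ball_model R"
    using homeomorphic_imp_surjective_map[OF spread_homeo] b by force
  from blowup_coordsD(3)[OF \<Phi>W[unfolded modelW] this]
  obtain c where c: "c \<in> ?Q" "\<Phi>W c = ?m" by blast
  have m: "?m \<in> \<Phi>W ` ?Q" unfolding c(2)[symmetric] using c(1) by (rule imageI)
  have h: "h b = inv_into ?Q \<Phi>W ?m" using b by (simp add: h_def)
  show "\<Phi>W (h b) = ?m" unfolding h by (rule f_inv_into_f[OF m])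
  have "h b \<in> ?Q" unfolding h by (rule inv_into_into[OF m])
  then show "h b \<in> topspace B" "\<rho> (h b) \<in> W" by auto
qed

lemma h_homeo_W: "homeomorphic_map (subtopology Bt PW) (subtopology B {b \<in> topspace B. \<rho> b \<in> W}) h"
  by (rule homeomorphic_map_lift[OF blowup_coordsD(6)[OF \<Phi>W[unfolded modelW]] spread_homeo])
    (use h_PW in auto)

section \<open>Gluing along the complement of a compact set\<close>

definition K :: "'a set" where
  "K = {x \<in> W. cmod (fst (w x)) + cmod (snd (w x)) \<le> R0}"

text \<open>Closedness is needed in \<open>X\<close>, not merely in \<open>W\<close>. Because
  \<open>R0 < R\<close>, the set is the image of a compact part of the bidisc, and compact sets of
  the Hausdorff space \<open>X\<close> are closed.\<close>

lemma K_closed: "closedin X K"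
proof -
  let ?C = "{p::complex \<times> complex. cmod (fst p) + cmod (snd p) \<le> R0}"
  have "closed ?C" by (intro closed_Collect_le continuous_intros)
  moreover have sub: "?C \<subseteq> cball 0 R0 \<times> cball 0 R0"
  proof
    fix p :: "complex \<times> complex" assume "p \<in> ?C"
    then have "cmod (fst p) + cmod (snd p) \<le> R0" by simp
    then have "cmod (fst p) \<le> R0" "cmod (snd p) \<le> R0"
      using norm_ge_zero[of "fst p"] norm_ge_zero[of "snd p"] by linarith+
    then show "p \<in> cball 0 R0 \<times> cball 0 R0" by (cases p) auto
  qed
  moreover have "compact (cball (0::complex) R0 \<times> cball (0::complex) R0)" by (intro compact_Times) auto
  ultimately have C: "compact ?C" by (metis compact_Int_closed inf.absorb_iff2)
  have CW: "?C \<subseteq> w ` W"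
  proof (rule subset_trans[OF sub])
    show "cball 0 R0 \<times> cball 0 R0 \<subseteq> w ` W" unfolding imW using r by (intro Sigma_mono) auto
  qed
  obtain g where g: "homeomorphic_maps (subtopology X W) (top_of_set (w ` W)) w g"
    using topological_chartD(6)[OF local_coords_chart[OF W(1)]] unfolding homeomorphic_map_maps by blast
  have "compactin (top_of_set (w ` W)) ?C"
    unfolding compactin_subtopology using C CW by simp
  then have cC: "compactin (subtopology X W) (g ` ?C)"
    using g unfolding homeomorphic_maps_def by (blast intro: image_compactin)
  have "g ` ?C = K"
  proof
    have gw: "w (g p) = p \<and> g p \<in> W" if "p \<in> w ` W" for p
      using g that openW(2) unfolding homeomorphic_maps_def continuous_map_def by auto
    show "g ` ?C \<subseteq> K"
    proof
      fix x assume "x \<in> g ` ?C"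
      then obtain p where p: "x = g p" "p \<in> ?C" by (rule imageE)
      then show "x \<in> K" using gw[OF subsetD[OF CW p(2)]] unfolding K_def by simp
    qed
    show "K \<subseteq> g ` ?C"
    proof
      fix x assume x: "x \<in> K"
      then have "x \<in> topspace (subtopology X W)" using openW(2) unfolding K_def by auto
      then have gx: "g (w x) = x" using g unfolding homeomorphic_maps_def by blast
      have "w x \<in> ?C" using x unfolding K_def by auto
      then have "g (w x) \<in> g ` ?C" by (rule imageI)
      then show "x \<in> g ` ?C" unfolding gx .
    qed
  qed
  with cC have "compactin X K" unfolding compactin_subtopology by metis
  then show ?thesis by (rule compactin_imp_closedin[OF Hausdorff_X])
qed

text \<open>Inside \<open>W\<close> but outside \<open>K\<close> the size \<open>n\<close> exceeds
  \<open>R0\<close>, where \<open>spread\<close> is the identity, so both points have the same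
  coordinates.\<close>

lemma h_outside:
  assumes b: "b \<in> topspace Bt" "\<pi> (\<rho>t b) \<notin> K"
  shows "h b = \<pi>t b"
proof (cases "\<pi> (\<rho>t b) \<in> W")
  case True
  then have bP: "b \<in> PW" using b by simp
  obtain n p t where \<kappa>: "half_space_coords b = (n, p, t)" by (metis prod.collapse)
  have "R0 \<le> n" using polar_coords(5)[OF bP \<kappa>] b True unfolding K_def by simp
  then have "spread r R0 n = n" using spread_ge[OF r(1,2) refl] by simp
  then have "\<Phi>W (h b) = \<Phi>W (\<pi>t b)"
    unfolding h_PW(3)[OF bP] lift_polar[OF bP] \<kappa> polar_map_def by simp
  then show ?thesis
    using h_PW(1,2)[OF bP] lift_in_PW[OF bP] blowup_coordsD(4)[OF \<Phi>W] by (auto dest: inj_onD)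
qed (simp add: h_def)

text \<open>The new size is at most \<open>R0 * cmod p + R0 * (1 - cmod p)\<close>. With
  \<open>h_outside\<close> this shows that over sets disjoint from \<open>K\<close> the maps
  \<open>h\<close> and \<open>\<pi>t\<close> have equal preimages.\<close>

lemma h_in_K:
  assumes b: "b \<in> topspace Bt" "\<pi> (\<rho>t b) \<in> K"
  shows "\<rho> (h b) \<in> K"
proof -
  have bP: "b \<in> PW" using b by (simp add: K_def)
  obtain n p t where \<kappa>: "half_space_coords b = (n, p, t)" by (metis prod.collapse)
  note P = polar_coords[OF bP \<kappa>]
  have n: "n \<le> R0" using P(5) b unfolding K_def by simp
  have g: "0 \<le> spread r R0 n" "spread r R0 n \<le> R0"
    using spread_bounds(1,3)[OF r(1,2) refl] P(1) n r by fastforce+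
  have "w (\<rho> (h b)) = fst (\<Phi>W (h b))"
    using blowup_coordsD(2)[OF \<Phi>W h_PW(1,2)[OF bP]] by simp
  then have w: "w (\<rho> (h b)) = (of_real (spread r R0 n) * p, of_real (n * (1 - cmod p)) * t)"
    unfolding h_PW(3)[OF bP] \<kappa> polar_map_def by simp
  have "cmod (of_real (spread r R0 n) * p) = spread r R0 n * cmod p" using g by (simp add: norm_mult)
  also have "\<dots> \<le> R0 * cmod p" using g by (intro mult_right_mono) auto
  finally have 1: "cmod (of_real (spread r R0 n) * p) \<le> R0 * cmod p" .
  have "cmod (of_real (n * (1 - cmod p)) * t) = n * (1 - cmod p)"
    using P by (intro cmod_of_real_mult) auto
  also have "\<dots> \<le> R0 * (1 - cmod p)" using P n by (intro mult_right_mono) auto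
  finally have "cmod (fst (w (\<rho> (h b)))) + cmod (snd (w (\<rho> (h b)))) \<le> R0 * cmod p + R0 * (1 - cmod p)"
    using 1 unfolding w fst_conv snd_conv by (rule add_mono[rotated])
  also have "\<dots> = R0" by (simp add: algebra_simps)
  finally show ?thesis using h_PW(2)[OF bP] unfolding K_def by simp
qed

lemma zK: "z \<in> K"
  using W r by (simp add: K_def)

lemma h_homeo: "homeomorphic_map Bt B h"
proof (rule homeomorphic_map_glue)
  \<comment> \<open>The index set consists of all open sets over which \<open>h\<close> is already a
    fibre-preserving homeomorphism in this sense: \<open>W\<close>, and sets away from
    \<open>K\<close>, where \<open>h\<close> is the lift.\<close>
  let ?I = "{V. openin X V \<and> (\<forall>b\<in>topspace Bt. \<rho> (h b) \<in> V \<longleftrightarrow> \<pi> (\<rho>t b) \<in> V) \<and>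
    homeomorphic_map (subtopology Bt {b \<in> topspace Bt. \<pi> (\<rho>t b) \<in> V}) (subtopology B {b \<in> topspace B. \<rho> b \<in> V}) h}"
  let ?Q = "\<lambda>V. {b \<in> topspace B. \<rho> b \<in> V}"
  show hB: "h b \<in> topspace B" if "b \<in> topspace Bt" for b
    using that h_PW(1)[of b] pit_in[of b] by (cases "\<pi> (\<rho>t b) \<in> W") (auto simp: h_def)
  have pre: "{b \<in> topspace Bt. h b \<in> ?Q V} = {b \<in> topspace Bt. \<pi> (\<rho>t b) \<in> V}" if "V \<in> ?I" for V
    using that hB by auto
  have WI: "W \<in> ?I"
  proof -
    have "\<rho> (h b) \<in> W \<longleftrightarrow> \<pi> (\<rho>t b) \<in> W" if "b \<in> topspace Bt" for b
      using that h_PW(2)[of b] comm[of b] by (cases "\<pi> (\<rho>t b) \<in> W") (auto simp: h_def)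
    then show ?thesis using openW(1) h_homeo_W by blast
  qed
  have outI: "V \<in> ?I" if V: "openin X V" "V \<inter> K = {}"
      "homeomorphic_map (subtopology Bt {b \<in> topspace Bt. \<pi> (\<rho>t b) \<in> V}) (subtopology B {b \<in> topspace B. \<rho> b \<in> V}) \<pi>t" for V
  proof -
    have "\<rho> (h b) \<in> V \<longleftrightarrow> \<pi> (\<rho>t b) \<in> V" if b: "b \<in> topspace Bt" for b
    proof (cases "\<pi> (\<rho>t b) \<in> K")
      case True
      then show ?thesis using h_in_K[OF b] V(2) by blast
    next
      case False
      then show ?thesis using h_outside[OF b] comm[OF b] by simp
    qed
    moreover have "homeomorphic_map (subtopology Bt {b \<in> topspace Bt. \<pi> (\<rho>t b) \<in> V}) (subtopology B {b \<in> topspace B. \<rho> b \<in> V}) h"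
    proof (rule homeomorphic_map_eq[OF V(3)])
      fix b assume "b \<in> topspace (subtopology Bt {b \<in> topspace Bt. \<pi> (\<rho>t b) \<in> V})"
      then have "b \<in> topspace Bt" "\<pi> (\<rho>t b) \<notin> K" using V(2) by auto
      then show "\<pi>t b = h b" by (rule h_outside[symmetric])
    qed
    ultimately show ?thesis using V(1) by blast
  qed
  show "openin B (?Q V)" if "V \<in> ?I" for V using that by (intro openin_rho) auto
  show "topspace B \<subseteq> (\<Union>V\<in>?I. ?Q V)"
  proof
    fix b assume b: "b \<in> topspace B"
    have "\<exists>V\<in>?I. \<rho> b \<in> V"
    proof (cases "\<rho> b \<in> K")
      case True
      then have "\<rho> b \<in> W" unfolding K_def by simp
      then show ?thesis using WI by (rule bexI)
    next
      case False
      have oK: "openin X (topspace X - K)" using K_closed by (simp add: closedin_def)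
      show ?thesis
      proof (cases "\<rho> b \<in> D")
        case True
        have "\<rho> b \<in> topspace X - K" using rho_in[OF b] False by simp
        from D_cases[OF True this oK] show ?thesis
        proof (elim disjE exE conjE)
          fix U \<phi> assume U: "flat_coords X A D U \<phi>" "\<rho> b \<in> U" "U \<subseteq> topspace X - K"
          have "openin X U" using U topological_chartD(1)[OF local_coords_chart] unfolding flat_coords_def by blast
          moreover have "z \<notin> U" using U(3) zK by blast
          ultimately have "U \<in> ?I" using flat_lift_homeo[OF U(1)] U(3) by (intro outI) auto
          then show ?thesis using U(2) by (rule bexI[rotated])
        next
          fix U \<phi> assume U: "crossing_coords X A D U \<phi>" "\<rho> b \<in> U" "U \<subseteq> topspace X - K"
          have "openin X U" using U topological_chartD(1)[OF local_coords_chart] unfolding crossing_coords_def by blast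
          moreover have "z \<notin> U" using U(3) zK by blast
          ultimately have "U \<in> ?I" using crossing_lift_homeo[OF U(1)] U(3) by (intro outI) auto
          then show ?thesis using U(2) by (rule bexI[rotated])
        qed
      next
        case nD: False
        let ?V = "(topspace X - K) - D"
        have oV: "openin X ?V" using oK D_closed by (rule openin_diff)
        then have "?V \<in> ?I"
          by (intro outI off_divisor_lift_homeo) auto
        moreover have "\<rho> b \<in> ?V" using rho_in[OF b] False nD by simp
        ultimately show ?thesis by (rule bexI[rotated])
      qed
    qed
    then show "b \<in> (\<Union>V\<in>?I. ?Q V)" using b by blast
  qed
  fix V assume V: "V \<in> ?I"
  show "openin Bt {b \<in> topspace Bt. h b \<in> ?Q V}"
    unfolding pre[OF V] using V by (intro openin_pi_rhot) auto
  show "homeomorphic_map (subtopology Bt {b \<in> topspace Bt. h b \<in> ?Q V}) (subtopology B (?Q V)) h"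
    unfolding pre[OF V] using V by auto
qed

section \<open>Compatibility with the circle actions\<close>

text \<open>If only crossing coordinates are at hand at the image, they pull back to crossing
  coordinates at \<open>x\<close>; being ordinary, \<open>x\<close> is not their centre, so its
  image lies on a single axis.\<close>

lemma ordinary_descends:
  assumes x: "\<pi> x \<noteq> z" "ordinary_point Xt At Dt x"
  shows "ordinary_point X A D (\<pi> x)"
proof -
  have xD: "x \<in> topspace Xt" "\<pi> x \<in> D" "\<pi> x \<in> topspace X - {z}"
    using x pi_in unfolding ordinary_point_def Dt by auto
  have "openin X (topspace X - {z})" by (intro openin_minus_z) auto
  from D_cases[OF xD(2,3) this] show ?thesis
  proof (elim disjE exE conjE)
    fix U \<phi> assume U: "flat_coords X A D U \<phi>" "\<pi> x \<in> U" "U \<subseteq> topspace X - {z}"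
    then show ?thesis using xD(2) unfolding ordinary_point_def by blast
  next
    fix U \<phi> assume U: "crossing_coords X A D U \<phi>" "\<pi> x \<in> U" "U \<subseteq> topspace X - {z}"
    have "crossing_coords Xt At Dt {x \<in> topspace Xt. \<pi> x \<in> U} (\<phi> \<circ> \<pi>)"
      using U by (intro pull_crossing) auto
    from crossing_point_not_ordinary[OF St this, of x] have "\<phi> (\<pi> x) \<noteq> (0, 0)"
      using x(2) xD(1) U(2) by auto
    then show ?thesis by (rule crossing_coords_off_center[OF S U(1,2) xD(2)])
  qed
qed

text \<open>Away from \<open>z\<close> the coordinates \<open>\<phi>\<close> and
  \<open>\<phi> \<circ> \<pi>\<close> have the same model, and in it \<open>\<pi>t\<close> is the
  identity.\<close>

lemma lift_action:
  assumes act: "canonical_action Xt At Dt Bt \<rho>t \<Theta> b b'" and U: "flat_coords X A D U \<phi>" "z \<notin> U" "\<pi> (\<rho>t b) \<in> U"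
    and \<Phi>: "blowup_coords B \<rho> U \<phi> (flat_model (\<phi> ` U)) \<Phi>"
  shows "\<rho>t b' = \<rho>t b"
    "\<exists>w1 t. \<phi> (\<pi> (\<rho>t b)) = (w1, 0) \<and> \<Phi> (\<pi>t b) = ((w1, 0), t) \<and> \<Phi> (\<pi>t b') = ((w1, 0), t * cis \<Theta>)"
proof -
  let ?U = "{x \<in> topspace Xt. \<pi> x \<in> U}"
  note b = canonical_action_ordinary(1,2)[OF act]
  have o: "openin X U" "U \<subseteq> topspace X"
    using U topological_chartD(1,2)[OF local_coords_chart] unfolding flat_coords_def by blast+
  have im: "(\<phi> \<circ> \<pi>) ` ?U = \<phi> ` U"
    unfolding image_comp[symmetric] pi_image[OF o(2) U(2)] ..
  obtain \<Phi>t where \<Phi>t: "blowup_coords Bt \<rho>t ?U (\<phi> \<circ> \<pi>) (flat_model ((\<phi> \<circ> \<pi>) ` ?U)) \<Phi>t"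
    using robt pull_flat[OF U(1,2)] unfolding real_oriented_blowup_def by blast
  have "\<rho>t b \<in> ?U" using rhot_in[OF b(1)] U(3) by simp
  note C = canonical_action_coords[OF St act pull_flat[OF U(1,2)] this \<Phi>t]
  show eq: "\<rho>t b' = \<rho>t b" by (rule C(1))
  have "\<Phi> (\<pi>t b) = \<Phi>t b"
    by (rule lift_agrees[OF o(1) \<Phi> \<Phi>t[unfolded im] flat_model_determined[OF U(1)] b(1) U(3)])
  moreover have "\<Phi> (\<pi>t b') = \<Phi>t b'"
    by (rule lift_agrees[OF o(1) \<Phi> \<Phi>t[unfolded im] flat_model_determined[OF U(1)] b(2)])
      (use U(3) eq in simp_all)
  ultimately show "\<exists>w1 t. \<phi> (\<pi> (\<rho>t b)) = (w1, 0) \<and> \<Phi> (\<pi>t b) = ((w1, 0), t) \<and> \<Phi> (\<pi>t b') = ((w1, 0), t * cis \<Theta>)"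
    using C(2) by simp
qed

lemma h_action_exceptional:
  assumes act: "canonical_action Xt At Dt Bt \<rho>t \<Theta> b b'" and bz: "\<pi> (\<rho>t b) = z"
  shows "disc_action B \<rho> W w r \<Theta> (h b) (h b')"
proof -
  note b = canonical_action_ordinary[OF act]
  have "\<rho>t b \<in> U1 \<union> U2" unfolding U12 using rhot_in[OF b(1)] bz W(2) by simp
  \<comment> \<open>The only exceptional point outside \<open>U2\<close> is the origin of the first
    chart, where the exceptional divisor crosses the strict transform; it is not ordinary.\<close>
  moreover have "\<rho>t b \<in> U2" if 1: "\<rho>t b \<in> U1"
  proof (rule ccontr)
    assume "\<rho>t b \<notin> U2"
    then have "snd (\<psi>1 (\<rho>t b)) = 0" using 1 ov1 by blast
    moreover have "fst (\<psi>1 (\<rho>t b)) = 0" using f1[OF 1] bz W(3) by simp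
    ultimately have "\<psi>1 (\<rho>t b) = (0, 0)" by (simp add: prod_eq_iff)
    then show False using crossing_point_not_ordinary[OF St crossingU1 1] b(3) by blast
  qed
  ultimately have 2: "\<rho>t b \<in> U2" by blast
  note C = canonical_action_coords[OF St act flatU2 2 \<Phi>2]
  obtain s t where st: "\<Phi>2 b = ((s, 0), t)" "\<Phi>2 b' = ((s, 0), t * cis \<Theta>)" using C(2) by blast
  have P: "b \<in> PW" "b' \<in> PW" using b bz C(1) W(2) by auto
  have t: "cmod t = 1"
    using blowup_coordsD(1)[OF \<Phi>2[unfolded model2] b(1) 2] unfolding st flat_chart_model_def by auto
  \<comment> \<open>The action fixes \<open>s\<close> and turns \<open>t\<close>; since
    \<open>t\<close> is a factor of \<open>p\<close>, the point of the disc turns by the same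
    angle.\<close>
  have \<kappa>: "half_space_coords b = (0, s * t / of_real (1 + cmod s), t)"
    "half_space_coords b' = (0, s * (t * cis \<Theta>) / of_real (1 + cmod s), t * cis \<Theta>)"
    using half_space_coords2[OF b(1) 2] half_space_coords2[OF b(2)] 2 C(1)
    unfolding st flat_chart_to_half_space_def by simp_all
  have g0: "spread r R0 0 = r" using r by (simp add: spread_def)
  define w1 where "w1 = of_real r * (s * t / of_real (1 + cmod s))"
  have "\<Phi>W (h b) = ((w1, 0), t)"
    unfolding h_PW(3)[OF P(1)] \<kappa> polar_map_def prod.case g0 w1_def by simp
  moreover have "\<Phi>W (h b') = ((w1 * cis \<Theta>, 0), t * cis \<Theta>)"
    unfolding h_PW(3)[OF P(2)] \<kappa> polar_map_def prod.case g0 w1_def by simp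
  \<comment> \<open>As \<open>s\<close> is finite, \<open>cmod p\<close> is strictly below 1, so the
    image avoids the torus over the circle of radius \<open>r\<close>.\<close>
  moreover have "cmod w1 < r"
  proof -
    have pos: "0 < 1 + cmod s" using norm_ge_zero[of s] by linarith
    have "cmod (of_real (1 + cmod s)) = 1 + cmod s" using pos by (simp only: norm_of_real abs_of_pos)
    then have "cmod w1 = r * (cmod s / (1 + cmod s))"
      using r t unfolding w1_def norm_mult norm_divide by simp
    also have "\<dots> < r * 1" using r pos by (intro mult_strict_left_mono) (simp_all add: pos_divide_less_eq)
    finally show ?thesis by simp
  qed
  ultimately show ?thesis
    using \<Phi>W h_PW(1,2)[OF P(1)] h_PW(1,2)[OF P(2)] unfolding disc_action_def by blast
qed

text \<open>On the strict transform \<open>h\<close> moves the base point radially and keeps the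
  angle, so both points of an orbit go to one fibre and differ there by the same rotation.\<close>

lemma h_action_near:
  assumes act: "canonical_action Xt At Dt Bt \<rho>t \<Theta> b b'" and bz: "\<pi> (\<rho>t b) \<noteq> z" "\<pi> (\<rho>t b) \<in> W"
  shows "r < cmod (fst (w (\<rho> (h b))))" "canonical_action X A D B \<rho> \<Theta> (h b) (h b')"
proof -
  note b = canonical_action_ordinary(1,2)[OF act]
  let ?V = "W - {z}"
  have oV: "openin X ?V" by (rule openin_minus_z[OF openW(1)])
  have fV: "flat_coords X A D ?V w" by (rule flat_coords_restrict[OF S flatW oV]) auto
  have \<Phi>V: "blowup_coords B \<rho> ?V w (flat_model (w ` ?V)) \<Phi>W"
    by (rule flat_blowup_coords_restrict[OF \<Phi>W local_coords_chart[OF W(1)] oV]) auto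
  have "z \<notin> ?V" "\<pi> (\<rho>t b) \<in> ?V" using bz by auto
  note L = lift_action[OF act fV this \<Phi>V]
  obtain w1 t where w1: "w (\<pi> (\<rho>t b)) = (w1, 0)" "\<Phi>W (\<pi>t b) = ((w1, 0), t)" "\<Phi>W (\<pi>t b') = ((w1, 0), t * cis \<Theta>)"
    using L(2) by blast
  have w10: "w1 \<noteq> 0"
  proof
    assume "w1 = 0"
    then have "w (\<pi> (\<rho>t b)) = w z" using w1 W(3) by simp
    then show False using inj_onD[OF openW(3) _ bz(2) W(2)] bz(1) by blast
  qed
  have P: "b \<in> PW" "b' \<in> PW" using b bz L(1) by auto
  \<comment> \<open>The coordinate \<open>w2\<close> vanishes here while the size does not, which
    forces \<open>cmod p = 1\<close>.\<close>
  have coords: "half_space_coords c = (cmod w1, w1 / of_real (cmod w1), u)"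
    if c: "c \<in> PW" "\<Phi>W (\<pi>t c) = ((w1, 0), u)" for c u
  proof -
    obtain n p v where \<kappa>: "half_space_coords c = (n, p, v)" by (metis prod.collapse)
    note N = polar_coords[OF c(1) \<kappa>]
    have e: "((of_real n * p, of_real (n * (1 - cmod p)) * v), v) = ((w1, 0), u)"
      using c(2) unfolding lift_polar[OF c(1)] \<kappa> polar_map_def prod.case .
    then have e: "of_real n * p = w1" "of_real (n * (1 - cmod p)) * v = 0" "v = u"
      unfolding prod.inject by blast+
    have "n \<noteq> 0" using e(1) w10 by auto
    moreover have "v \<noteq> 0" using N(3) by auto
    ultimately have p1: "cmod p = 1" using e(2) by (simp add: of_real_eq_0_iff del: of_real_mult of_real_diff)
    have "cmod w1 = n" using N(1) p1 unfolding e(1)[symmetric] by (simp add: norm_mult)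
    moreover have "p = w1 / of_real n" unfolding e(1)[symmetric] using \<open>n \<noteq> 0\<close> by simp
    ultimately show ?thesis using \<kappa> e(3) by simp
  qed
  let ?g = "spread r R0 (cmod w1)" and ?p = "w1 / of_real (cmod w1)"
  have hb: "\<Phi>W (h b) = ((of_real ?g * ?p, 0), t)" "\<Phi>W (h b') = ((of_real ?g * ?p, 0), t * cis \<Theta>)"
    unfolding h_PW(3)[OF P(1)] h_PW(3)[OF P(2)] coords[OF P(1) w1(2)] coords[OF P(2) w1(3)] polar_map_def
    using w10 by (simp_all add: norm_divide)
  \<comment> \<open>Strict because \<open>w1\<close> is nonzero: the image lies outside the closed
    disc, where the canonical action was kept.\<close>
  have g: "r < ?g" using spread_bounds(2)[OF r(1,2) refl] w10 by simp
  have "fst (w (\<rho> (h b))) = of_real ?g * ?p"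
    using blowup_coordsD(2)[OF \<Phi>W h_PW(1,2)[OF P(1)]] hb(1) by (metis fst_conv)
  moreover have "cmod (of_real ?g * ?p) = ?g" using g r w10 by (simp add: norm_mult norm_divide)
  ultimately show "r < cmod (fst (w (\<rho> (h b))))" using g by simp
  show "canonical_action X A D B \<rho> \<Theta> (h b) (h b')"
    using flatW \<Phi>W h_PW(1,2)[OF P(1)] h_PW(1,2)[OF P(2)] hb unfolding canonical_action_def by blast
qed

lemma h_action_far:
  assumes act: "canonical_action Xt At Dt Bt \<rho>t \<Theta> b b'" and bW: "\<pi> (\<rho>t b) \<notin> W"
  shows "canonical_action X A D B \<rho> \<Theta> (h b) (h b')"
proof -
  note b = canonical_action_ordinary[OF act]
  have bz: "\<pi> (\<rho>t b) \<noteq> z" using bW W(2) by auto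
  obtain U0 \<phi> where U0: "flat_coords X A D U0 \<phi>" "\<pi> (\<rho>t b) \<in> U0"
    using ordinary_descends[OF bz b(3)] unfolding ordinary_point_def by blast
  let ?U = "U0 - {z}"
  have "openin X U0" using U0 topological_chartD(1)[OF local_coords_chart] unfolding flat_coords_def by blast
  from flat_coords_restrict[OF S U0(1) openin_minus_z[OF this]]
  have U: "flat_coords X A D ?U \<phi>" by blast
  have xU: "z \<notin> ?U" "\<pi> (\<rho>t b) \<in> ?U" using U0 bz by auto
  obtain \<Phi> where \<Phi>: "blowup_coords B \<rho> ?U \<phi> (flat_model (\<phi> ` ?U)) \<Phi>"
    using rob U unfolding real_oriented_blowup_def by blast
  note L = lift_action[OF act U xU \<Phi>]
  have "h b = \<pi>t b" "h b' = \<pi>t b'" using bW L(1) by (auto simp: h_def)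
  moreover have "\<pi>t b \<in> topspace B" "\<pi>t b' \<in> topspace B" "\<rho> (\<pi>t b) \<in> ?U" "\<rho> (\<pi>t b') \<in> ?U"
    using b pit_in comm xU(2) L(1) by auto
  ultimately show ?thesis
    using L(2) U \<Phi> unfolding canonical_action_def by metis
qed

lemma h_action:
  assumes act: "canonical_action Xt At Dt Bt \<rho>t \<Theta> b b'"
  shows "Z_action X A D B \<rho> W w r \<Theta> (h b) (h b')"
proof (cases "\<pi> (\<rho>t b) \<in> W")
  case True
  then show ?thesis
    using h_action_exceptional[OF act] h_action_near[OF act] unfolding Z_action_def by fastforce
next
  case False
  then have "\<rho> (h b) \<notin> W" using comm[OF canonical_action_ordinary(1)[OF act]] by (simp add: h_def)
  then show ?thesis using h_action_far[OF act False] unfolding Z_action_def by blast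
qed

end

theorem mainTheorem2:
  fixes X :: "'a topology" and A :: "('a set \<times> ('a \<Rightarrow> complex \<times> complex)) set"
    and D :: "'a set" and z :: 'a
    and Xt :: "'b topology" and At :: "('b set \<times> ('b \<Rightarrow> complex \<times> complex)) set"
    and \<pi> :: "'b \<Rightarrow> 'a" and Dt :: "'b set"
    and W :: "'a set" and w :: "'a \<Rightarrow> complex \<times> complex" and R r :: real
    and B :: "'c topology" and \<rho> :: "'c \<Rightarrow> 'a"
    and Bt :: "'d topology" and \<rho>t :: "'d \<Rightarrow> 'b"
    and \<pi>t :: "'d \<Rightarrow> 'c"
  assumes "complex_surface X A"
    and "normal_crossings_divisor X A D"
    and "ordinary_point X A D z"
    and "point_blowup X A z Xt At \<pi>"
    and "Dt = {x \<in> topspace Xt. \<pi> x \<in> D}"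
    and "local_coords X A W w" "z \<in> W" "w z = (0, 0)"
    and "w ` W = ball 0 R \<times> ball 0 R"
    and "D \<inter> W = {x \<in> W. snd (w x) = 0}"
    and "0 < r" "r < R"
    and "real_oriented_blowup X A D B \<rho>"
    and "real_oriented_blowup Xt At Dt Bt \<rho>t"
    and "continuous_map Bt B \<pi>t"
    and "\<forall>b\<in>topspace Bt. \<rho> (\<pi>t b) = \<pi> (\<rho>t b)"
  shows "\<exists>h. homeomorphic_map Bt B h \<and>
           (\<forall>b\<in>topspace Bt. \<pi> (\<rho>t b) \<notin> W \<longrightarrow> h b = \<pi>t b) \<and>
           (\<forall>\<Theta> b b'. canonical_action Xt At Dt Bt \<rho>t \<Theta> b b' \<longrightarrow>
              Z_action X A D B \<rho> W w r \<Theta> (h b) (h b'))"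
proof -
  \<comment> \<open>Extracts the clause of \<open>point_blowup\<close> for coordinates centred at
    \<open>z\<close>, specialised to \<open>w\<close>.\<close>
  note pb = assms(4)[unfolded point_blowup_def, THEN conjunct2, THEN conjunct2, THEN conjunct2,
      THEN conjunct2, THEN spec, THEN spec, THEN mp, OF conjI[OF assms(6) conjI[OF assms(7,8)]]]
  obtain U1 \<psi>1 U2 \<psi>2 where c:
    "local_coords Xt At U1 \<psi>1" "local_coords Xt At U2 \<psi>2"
    "U1 \<union> U2 = {x \<in> topspace Xt. \<pi> x \<in> W}"
    "\<psi>1 ` U1 = {(u, v). (u, u * v) \<in> w ` W}"
    "\<psi>2 ` U2 = {(s, t). (s * t, t) \<in> w ` W}"
    "\<forall>x\<in>U1. w (\<pi> x) = (fst (\<psi>1 x), fst (\<psi>1 x) * snd (\<psi>1 x))"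
    "\<forall>x\<in>U2. w (\<pi> x) = (fst (\<psi>2 x) * snd (\<psi>2 x), snd (\<psi>2 x))"
    "U1 \<inter> U2 = {x \<in> U1. snd (\<psi>1 x) \<noteq> 0}"
    "U1 \<inter> U2 = {x \<in> U2. fst (\<psi>2 x) \<noteq> 0}"
    using pb by (elim exE conjE, intro that)
  have DU: "x \<in> Dt \<longleftrightarrow> snd (w (\<pi> x)) = 0" if "x \<in> U1 \<union> U2" for x
  proof -
    have "x \<in> topspace Xt" "\<pi> x \<in> W" using that c(3) by auto
    then show ?thesis using assms(10) unfolding assms(5) by blast
  qed
  have "crossing_coords Xt At Dt U1 \<psi>1" "flat_coords Xt At Dt U2 \<psi>2"
    using c(1,2,6,7) DU unfolding crossing_coords_def flat_coords_def by auto
  then obtain \<Phi>1 \<Phi>2 where \<Phi>: "blowup_coords Bt \<rho>t U1 \<psi>1 (crossing_model (\<psi>1 ` U1)) \<Phi>1"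
    "blowup_coords Bt \<rho>t U2 \<psi>2 (flat_model (\<psi>2 ` U2)) \<Phi>2"
    using assms(14) unfolding real_oriented_blowup_def by meson
  have "flat_coords X A D W w" using assms(6,10) by (simp add: flat_coords_def)
  then obtain \<Phi>W where \<Phi>W: "blowup_coords B \<rho> W w (flat_model (w ` W)) \<Phi>W"
    using assms(13) unfolding real_oriented_blowup_def by blast
  have zD: "z \<in> D" using assms(3) by (simp add: ordinary_point_def)
  \<comment> \<open>The gap below \<open>R\<close> leaves a collar in \<open>W\<close> on which
    \<open>h\<close> is already the lift.\<close>
  obtain R0 where R0: "r < R0" "R0 < R" using dense[OF assms(12)] by blast
  interpret blowup_chart X A D z Xt At \<pi> Dt W w R R0 r B \<rho> Bt \<rho>t \<pi>t U1 \<psi>1 U2 \<psi>2 \<Phi>W \<Phi>1 \<Phi>2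
    using assms c \<Phi> \<Phi>W zD R0 by unfold_locales simp_all
  have "\<forall>b\<in>topspace Bt. \<pi> (\<rho>t b) \<notin> W \<longrightarrow> h b = \<pi>t b" by (simp add: h_def)
  then show ?thesis using h_homeo h_action by blast
qed

end
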